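(* Let $X$ be a real random variable with $E(X)=0$, $E(X^2)=1$ and $E|X|^n<\infty$ for every integer $n\geq 3$. Let $\{X_{ij}: i,j\geq 1\}$ be a collection of i.i.d. copies of $X$ and, for every integer $N\geq 2$, let $X_N$ be the $N\times N$ random matrix $$X_N=\left\{\frac{X_{ij}}{\sqrt N}: i,j=1,\ldots,N\right\}.$$ Fix $m\geq 1$ and integers $1\leq k_1<\ldots<k_m$. Let $\{Z_k:k\geq 1\}$ denote a collection of real independent centered Gaussian random variables such that $E(Z_k^2)=k$ for every $k\geq 1$. Then the following holds. (i) As $N\to\infty$, $$\Big(\mathrm{Tr}(X_N^{k_1})-E[\mathrm{Tr}(X_N^{k_1})],\ldots,\mathrm{Tr}(X_N^{k_m})-E[\mathrm{Tr}(X_N^{k_m})]\Big)\longrightarrow (Z_{k_1},\ldots,Z_{k_m})\quad\text{in law}.$$ (ii) Write $\beta=E|X|^3$. Suppose that the function $\varphi:\mathbb{R}^m\to\mathbb{R}$ is thrice differentiable and that its partial derivatives up to the order three are bounded by some constant $B<\infty$. Then there exists a finite constant $C=C(\beta,B,m,k_1,\ldots,k_m)$, not depending on $N$, such that $$\left|E\left[\varphi\left(\frac{\mathrm{Tr}(X_N^{k_1})-E[\mathrm{Tr}(X_N^{k_1})]}{\sqrt{\mathrm{Var}(\mathrm{Tr}(X_N^{k_1}))}},\ldots,\frac{\mathrm{Tr}(X_N^{k_m})-E[\mathrm{Tr}(X_N^{k_m})]}{\sqrt{\mathrm{Var}(\mathrm{Tr}(X_N^{k_m}))}}\right)\right]-E\left[\varphi\left(\frac{Z_{k_1}}{\sqrt{k_1}},\ldots,\frac{Z_{k_m}}{\sqrt{k_m}}\right)\right]\right|\leq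 C\,N^{-1/4}.$$
   Context: $\mathrm{Tr}(\cdot)$ is the usual trace, $X_N^k$ is the $k$th power of the matrix $X_N$, and $E$ and $\mathrm{Var}$ denote expectation and variance. No absolute continuity assumption is made on the law of $X$.
   Formalization: In (ii) the constant C may depend on the whole law of X (through further moments), not only on β, B, m and k_1,…,k_m; a constant depending on X only through β is impossible, e.g. for m=1, k_1=2, φ=cos. C does not depend on N, nor on φ except through B. *)

theory Defs
  imports "HOL-Probability.Probability" "Jordan_Normal_Form.Matrix"
begin

definition mat_trace :: "'a::comm_monoid_add mat \<Rightarrow> 'a" where
  "mat_trace A = (\<Sum>i<dim_row A. A $$ (i, i))"

text \<open>Matrices are indexed from 0, the array \<open>Y\<close> from 1.\<close>

definition random_mat :: "(nat \<Rightarrow> nat \<Rightarrow> 'a \<Rightarrow> real) \<Rightarrow> nat \<Rightarrow> 'a \<Rightarrow> real mat" where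
  "random_mat Y N \<omega> = mat N N (\<lambda>(i, j). Y (Suc i) (Suc j) \<omega> / sqrt (real N))"

definition trace_power :: "(nat \<Rightarrow> nat \<Rightarrow> 'a \<Rightarrow> real) \<Rightarrow> nat \<Rightarrow> nat \<Rightarrow> 'a \<Rightarrow> real" where
  "trace_power Y N k \<omega> = mat_trace (random_mat Y N \<omega> ^\<^sub>m k)"

text \<open>The library's \<^const>\<open>weak_conv_m\<close> is restricted to measures on the real line.\<close>

definition weakly_converges ::
    "(nat \<Rightarrow> 'b::metric_space measure) \<Rightarrow> 'b measure \<Rightarrow> bool" where
  "weakly_converges \<mu> \<nu> \<longleftrightarrow>
     (\<forall>f :: 'b \<Rightarrow> real. continuous_on UNIV f \<and> bounded (range f) \<longrightarrow>
        (\<lambda>n. integral\<^sup>L (\<mu> n) f) \<longlonglongrightarrow> integral\<^sup>L \<nu> f)"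

definition partial_deriv :: "'n::finite \<Rightarrow> (real^'n \<Rightarrow> real) \<Rightarrow> real^'n \<Rightarrow> real" where
  "partial_deriv i f x = deriv (\<lambda>t. f (x + t *\<^sub>R axis i 1)) 0"

text \<open>\<open>iter_partial [i\<^sub>1, \<dots>, i\<^sub>r] f\<close> is the partial derivative of order \<open>r\<close> of \<open>f\<close>,
  taken first in direction \<open>i\<^sub>r\<close> and last in direction \<open>i\<^sub>1\<close>.\<close>

definition iter_partial :: "'n::finite list \<Rightarrow> (real^'n \<Rightarrow> real) \<Rightarrow> real^'n \<Rightarrow> real" where
  "iter_partial is f = foldr partial_deriv is f"

text \<open>Every partial derivative of order less than \<open>r\<close> (including \<open>f\<close> itself) is Frechet
  differentiable; no continuity of the derivatives of order \<open>r\<close> is required.\<close>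

definition times_differentiable :: "nat \<Rightarrow> (real^'n::finite \<Rightarrow> real) \<Rightarrow> bool" where
  "times_differentiable r f \<longleftrightarrow>
     (\<forall>is x. length is < r \<longrightarrow> iter_partial is f differentiable (at x))"

text \<open>Orders 1 to \<open>r\<close>: \<open>f\<close> itself may be unbounded.\<close>

definition partials_bounded :: "nat \<Rightarrow> real \<Rightarrow> (real^'n::finite \<Rightarrow> real) \<Rightarrow> bool" where
  "partials_bounded r B f \<longleftrightarrow>
     (\<forall>is x. 1 \<le> length is \<and> length is \<le> r \<longrightarrow> \<bar>iter_partial is f x\<bar> \<le> B)"

end

theory Submission
  imports Defs "HOL-Real_Asymp.Real_Asymp" "HOL-Number_Theory.Cong"
begin

text \<open>The trace of the \<open>k\<close>-th power is \<open>N\<close> to the power \<open>-k/2\<close> times a sum over closed walks of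
length \<open>k\<close> on \<open>N\<close> vertices. Walks with pairwise distinct vertices form the cycle sum, a
homogeneous polynomial of degree \<open>k\<close> that is affine in every matrix entry; the remaining
walks form the degenerate sum. The degenerate sum has variance \<open>O(1/N)\<close>: two closed walks can
have nonzero covariance only if they share an edge and every edge occurs at least twice in their union,
which leaves at most \<open>k\<close> distinct edges. A connected directed graph made of closed walks has at most as
many vertices as edges, with equality only for a single cycle, and a degenerate walk of length
\<open>k\<close> cannot run along a cycle on \<open>k\<close> vertices.

For the vector \<open>V\<close> of cycle sums divided by \<open>sqrt k\<close>, Euler's identity for homogeneous
polynomials writes \<open>k V\<^sub>k\<close> as the sum over all edges \<open>e\<close> of the entry \<open>X\<^sub>e\<close> times the
derivative \<open>D\<^sub>e\<close> of \<open>V\<^sub>k\<close> in that entry. Since \<open>D\<^sub>e\<close> does not involve \<open>X\<^sub>e\<close>, a second order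
Taylor expansion of \<open>g(V)\<close> in \<open>X\<^sub>e\<close> shows that \<open>E[V\<^sub>a g(V)]\<close> equals \<open>E[\<partial>\<^sub>a g(V)]\<close> up to two errors. The
first is the deviation of the inner products of the gradients of the cycle sums from their limits, \<open>k\<^sup>2\<close> for equal
lengths and \<open>0\<close> otherwise; their variance is \<open>O(1/N)\<close>, because a connected graph on \<open>n\<close> edges has at most
\<open>n + 1\<close> vertices. The second is a sum of third absolute moments of the derivatives, which is
controlled by second and fourth moments. So \<open>V\<close> satisfies the integration by parts
identity of the standard normal law up to an error of order \<open>1/sqrt N\<close>
(\<open>cycle_vec_approx_stein\<close>).

Two independent vectors with such identities are compared by the rotation \<open>cos t V + sin t W\<close>: the
derivative in \<open>t\<close> of the expectation of a test function along this path consists of the errors in the two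
identities only, as the main terms cancel (\<open>approx_stein_compare\<close>). This gives the rate
\<open>1/sqrt N\<close>, which is at most the required one, for test functions with bounded derivatives; replacing
\<open>V\<close> by the centred traces costs \<open>O(1/sqrt N)\<close> in \<open>L\<^sup>1\<close>. Weak convergence follows since a bounded
continuous function is approximated, on a large box, by a bounded polynomial in sines of the coordinates, with
the Stone-Weierstrass theorem, while second moments control the mass outside the box.\<close>

section \<open>Test functions with Lipschitz derivatives\<close>

\<comment> \<open>the dollar sign is kept for the components of Cartesian vectors\<close>
no_notation vec_index (infixl "$" 100)

text \<open>\<open>C1_with L g g'\<close> says that \<open>g\<close> is Frechet differentiable with partial derivatives \<open>g'\<close>, all of them
bounded by \<open>L\<close> and \<open>L\<close>-Lipschitz. In \<open>C2_with B \<phi> \<phi>1 \<phi>2\<close> the function \<open>\<phi>\<close> itself may be unbounded;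
its first partial derivatives \<open>\<phi>1\<close> are bounded and again of the former kind, \<open>\<phi>2 a b\<close> being
the derivative of \<open>\<phi>1 a\<close> in direction \<open>b\<close>.\<close>

definition C1_with :: "real \<Rightarrow> (real^'n \<Rightarrow> real) \<Rightarrow> ('n \<Rightarrow> real^'n \<Rightarrow> real) \<Rightarrow> bool" where
  "C1_with L g g' \<longleftrightarrow>
     (\<forall>x. (g has_derivative (\<lambda>h. \<Sum>b\<in>UNIV. g' b x * h $ b)) (at x)) \<and>
     (\<forall>b x. \<bar>g' b x\<bar> \<le> L) \<and> (\<forall>b x y. \<bar>g' b x - g' b y\<bar> \<le> L * norm (x - y))"

definition C2_with :: "real \<Rightarrow> (real^'n \<Rightarrow> real) \<Rightarrow> ('n \<Rightarrow> real^'n \<Rightarrow> real)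
    \<Rightarrow> ('n \<Rightarrow> 'n \<Rightarrow> real^'n \<Rightarrow> real) \<Rightarrow> bool" where
  "C2_with B \<phi> \<phi>1 \<phi>2 \<longleftrightarrow>
     (\<forall>x. (\<phi> has_derivative (\<lambda>h. \<Sum>b\<in>UNIV. \<phi>1 b x * h $ b)) (at x)) \<and>
     (\<forall>b x. \<bar>\<phi>1 b x\<bar> \<le> B) \<and> (\<forall>a. C1_with B (\<phi>1 a) (\<phi>2 a))"

text \<open>The integration by parts identity \<open>E[V\<^sub>a g(V)] = E[\<partial>\<^sub>a g(V)]\<close>, which characterises the standard
normal law, up to an error \<open>\<delta>\<close> that is uniform over test functions with constant \<open>L = 1\<close>.\<close>

definition approx_stein :: "'a measure \<Rightarrow> ('a \<Rightarrow> real^'n) \<Rightarrow> real \<Rightarrow> bool" where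
  "approx_stein M V \<delta> \<longleftrightarrow>
     (\<forall>g g' L a. C1_with L g g' \<longrightarrow>
        \<bar>(\<integral>\<omega>. V \<omega> $ a * g (V \<omega>) \<partial>M) - (\<integral>\<omega>. g' a (V \<omega>) \<partial>M)\<bar> \<le> \<delta> * L)"

lemma mvt_partials:
  fixes g :: "real^'n \<Rightarrow> real"
  assumes "\<And>x. (g has_derivative (\<lambda>h. \<Sum>b\<in>UNIV. g' b x * h $ b)) (at x)"
  shows "\<exists>t\<in>{0<..<1}. g x - g y = (\<Sum>b\<in>UNIV. g' b (y + t *\<^sub>R (x - y)) * (x - y) $ b)"
proof -
  define c where "c = (\<lambda>t. y + t *\<^sub>R (x - y))"
  have c: "(c has_derivative (\<lambda>t. t *\<^sub>R (x - y))) (at t)" for t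
    unfolding c_def by (auto intro!: derivative_eq_intros)
  have d: "((\<lambda>t. g (c t)) has_derivative (\<lambda>s. \<Sum>b\<in>UNIV. g' b (c t) * (s *\<^sub>R (x - y)) $ b)) (at t)" for t
    using has_derivative_compose[OF c assms] .
  have "\<exists>t\<in>{0<..<1}. g (c 1) - g (c 0) = (\<lambda>s. \<Sum>b\<in>UNIV. g' b (c t) * (s *\<^sub>R (x - y)) $ b) (1 - 0)"
    by (rule mvt_simple, simp, rule has_derivative_at_withinI, rule d)
  then show ?thesis by (simp add: c_def)
qed

lemma sum_abs_component_le: "(\<Sum>b\<in>UNIV. \<bar>(h :: real^'n) $ b\<bar>) \<le> real CARD('n) * norm h"
  using sum_bounded_above[of UNIV "\<lambda>b. \<bar>h $ b\<bar>" "norm h"] component_le_norm_cart[of h] by simp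

lemma lipschitz_partials:
  fixes g :: "real^'n \<Rightarrow> real"
  assumes d: "\<And>x. (g has_derivative (\<lambda>h. \<Sum>b\<in>UNIV. g' b x * h $ b)) (at x)"
    and b: "\<And>b x. \<bar>g' b x\<bar> \<le> L"
  shows "\<bar>g x - g y\<bar> \<le> L * (\<Sum>b\<in>UNIV. \<bar>(x - y) $ b\<bar>)"
proof -
  obtain t where "g x - g y = (\<Sum>b\<in>UNIV. g' b (y + t *\<^sub>R (x - y)) * (x - y) $ b)"
    using mvt_partials[OF d] by blast
  also have "\<bar>\<dots>\<bar> \<le> (\<Sum>b\<in>UNIV. L * \<bar>(x - y) $ b\<bar>)"
    by (intro order.trans[OF sum_abs] sum_mono) (auto simp: abs_mult intro!: mult_right_mono b)
  finally show ?thesis by (simp add: sum_distrib_left)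
qed

lemma lipschitz_partials_norm:
  fixes g :: "real^'n \<Rightarrow> real"
  assumes d: "\<And>x. (g has_derivative (\<lambda>h. \<Sum>b\<in>UNIV. g' b x * h $ b)) (at x)"
    and b: "\<And>b x. \<bar>g' b x\<bar> \<le> L"
  shows "\<bar>g x - g y\<bar> \<le> L * real CARD('n) * norm (x - y)"
proof -
  have "L \<ge> 0" using b[of undefined undefined] by linarith
  have "\<bar>g x - g y\<bar> \<le> L * (\<Sum>b\<in>UNIV. \<bar>(x - y) $ b\<bar>)"
    using d b by (rule lipschitz_partials)
  also have "\<dots> \<le> L * (real CARD('n) * norm (x - y))"
    using \<open>L \<ge> 0\<close> by (intro mult_left_mono sum_abs_component_le)
  finally show ?thesis by (simp add: mult.assoc)
qed

lemma taylor_partials: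
  fixes g :: "real^'n \<Rightarrow> real"
  assumes d: "\<And>x. (g has_derivative (\<lambda>h. \<Sum>b\<in>UNIV. g' b x * h $ b)) (at x)"
    and l: "\<And>b x y. \<bar>g' b x - g' b y\<bar> \<le> L * norm (x - y)" and "L \<ge> 0"
  shows "\<bar>g x - g y - (\<Sum>b\<in>UNIV. g' b y * (x - y) $ b)\<bar> \<le> L * norm (x - y) * (\<Sum>b\<in>UNIV. \<bar>(x - y) $ b\<bar>)"
proof -
  obtain t where t: "t \<in> {0<..<1}" "g x - g y = (\<Sum>b\<in>UNIV. g' b (y + t *\<^sub>R (x - y)) * (x - y) $ b)"
    using mvt_partials[OF d] by blast
  have "g x - g y - (\<Sum>b\<in>UNIV. g' b y * (x - y) $ b)
      = (\<Sum>b\<in>UNIV. (g' b (y + t *\<^sub>R (x - y)) - g' b y) * (x - y) $ b)"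
    unfolding t(2) by (simp add: sum_subtractf left_diff_distrib)
  also have "\<bar>\<dots>\<bar> \<le> (\<Sum>b\<in>UNIV. L * norm (x - y) * \<bar>(x - y) $ b\<bar>)"
  proof (intro order.trans[OF sum_abs] sum_mono)
    fix b
    have "\<bar>g' b (y + t *\<^sub>R (x - y)) - g' b y\<bar> \<le> L * norm (y + t *\<^sub>R (x - y) - y)" by (rule l)
    also have "\<dots> = L * (\<bar>t\<bar> * norm (x - y))" by simp
    also have "\<dots> \<le> L * (1 * norm (x - y))"
      using t \<open>L \<ge> 0\<close> by (intro mult_left_mono mult_right_mono) auto
    finally show "\<bar>(g' b (y + t *\<^sub>R (x - y)) - g' b y) * (x - y) $ b\<bar> \<le> L * norm (x - y) * \<bar>(x - y) $ b\<bar>"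
      by (auto simp: abs_mult intro!: mult_right_mono)
  qed
  finally show ?thesis by (simp add: sum_distrib_left)
qed

lemma C1_with_nonneg: "C1_with L g g' \<Longrightarrow> L \<ge> 0"
  unfolding C1_with_def using abs_ge_zero[of "g' undefined undefined"] order.trans by blast

lemma C1_with_continuous:
  assumes "C1_with L g g'"
  shows "continuous_on UNIV g" "continuous_on UNIV (g' b)"
proof -
  show "continuous_on UNIV g"
    using assms unfolding C1_with_def
    by (intro differentiable_imp_continuous_on) (auto simp: differentiable_on_def differentiable_def)
  have "L-lipschitz_on UNIV (g' b)"
    using assms C1_with_nonneg[OF assms] unfolding C1_with_def lipschitz_on_def
    by (auto simp: dist_norm real_norm_def)
  then show "continuous_on UNIV (g' b)" by (rule lipschitz_on_continuous_on)
qed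

lemma C1_with_scale_shift:
  assumes "C1_with L g g'" "\<bar>s\<bar> \<le> 1"
  shows "C1_with L (\<lambda>v. g (s *\<^sub>R v + w)) (\<lambda>b v. s * g' b (s *\<^sub>R v + w))"
  unfolding C1_with_def
proof (intro conjI allI)
  have L: "L \<ge> 0" using C1_with_nonneg[OF assms(1)] .
  fix x
  have "((\<lambda>v. s *\<^sub>R v + w) has_derivative (\<lambda>h. s *\<^sub>R h)) (at x)"
    by (auto intro!: derivative_eq_intros)
  moreover have "(g has_derivative (\<lambda>h. \<Sum>b\<in>UNIV. g' b (s *\<^sub>R x + w) * h $ b)) (at (s *\<^sub>R x + w))"
    using assms(1) unfolding C1_with_def by blast
  ultimately have "((\<lambda>v. g (s *\<^sub>R v + w)) has_derivative
      (\<lambda>h. \<Sum>b\<in>UNIV. g' b (s *\<^sub>R x + w) * (s *\<^sub>R h) $ b)) (at x)"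
    by (rule has_derivative_compose)
  then show "((\<lambda>v. g (s *\<^sub>R v + w)) has_derivative (\<lambda>h. \<Sum>b\<in>UNIV. s * g' b (s *\<^sub>R x + w) * h $ b)) (at x)"
    by (simp add: mult.left_commute mult.assoc)
  fix b y
  have "\<bar>s * g' b (s *\<^sub>R x + w)\<bar> \<le> 1 * L"
    unfolding abs_mult by (rule mult_mono) (use assms in \<open>auto simp: C1_with_def\<close>)
  then show "\<bar>s * g' b (s *\<^sub>R x + w)\<bar> \<le> L" by simp
  have "\<bar>g' b (s *\<^sub>R x + w) - g' b (s *\<^sub>R y + w)\<bar> \<le> L * norm (s *\<^sub>R x + w - (s *\<^sub>R y + w))"
    using assms unfolding C1_with_def by blast
  also have "\<dots> = L * (\<bar>s\<bar> * norm (x - y))" by (simp flip: scaleR_diff_right)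
  also have "\<dots> \<le> L * (1 * norm (x - y))" using assms L by (intro mult_left_mono mult_right_mono) auto
  finally have "\<bar>s\<bar> * \<bar>g' b (s *\<^sub>R x + w) - g' b (s *\<^sub>R y + w)\<bar> \<le> 1 * (L * norm (x - y))"
    using assms by (intro mult_mono) auto
  then show "\<bar>s * g' b (s *\<^sub>R x + w) - s * g' b (s *\<^sub>R y + w)\<bar> \<le> L * norm (x - y)"
    by (simp flip: right_diff_distrib abs_mult)
qed

text \<open>Replaces differentiation under the integral sign: a local bound with a quadratic error,
summed over a fine partition, bounds the whole increment.\<close>

lemma increment_le_of_local:
  fixes F :: "real \<Rightarrow> real"
  assumes "\<And>s t. \<bar>F t - F s\<bar> \<le> \<epsilon> * \<bar>t - s\<bar> + K * (t - s)\<^sup>2" and "b \<ge> 0"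
  shows "\<bar>F b - F 0\<bar> \<le> \<epsilon> * b"
proof -
  have *: "\<bar>F b - F 0\<bar> \<le> \<epsilon> * b + K * b\<^sup>2 / real (Suc n)" for n
  proof -
    define h where "h = b / real (Suc n)"
    have "\<bar>F (real j * h) - F 0\<bar> \<le> real j * (\<epsilon> * h + K * h\<^sup>2)" for j
    proof (induction j)
      case (Suc j)
      have "\<bar>F (real (Suc j) * h) - F (real j * h)\<bar> \<le> \<epsilon> * \<bar>h\<bar> + K * h\<^sup>2"
        using assms(1)[of "real (Suc j) * h" "real j * h"] by (simp add: algebra_simps)
      moreover have "\<bar>h\<bar> = h" using assms(2) by (simp add: h_def)
      ultimately show ?case using Suc by (simp add: algebra_simps)
    qed simp
    from this[of "Suc n"] have "\<bar>F b - F 0\<bar> \<le> real (Suc n) * (\<epsilon> * h + K * h\<^sup>2)"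
      by (simp add: h_def)
    also have "\<dots> = \<epsilon> * b + K * b\<^sup>2 / real (Suc n)"
      by (simp add: h_def field_simps power2_eq_square del: of_nat_Suc)
    finally show ?thesis .
  qed
  have "(\<lambda>n. \<epsilon> * b + K * b\<^sup>2 * inverse (real (Suc n))) \<longlonglongrightarrow> \<epsilon> * b + K * b\<^sup>2 * 0"
    by (intro tendsto_intros LIMSEQ_inverse_real_of_nat)
  from LIMSEQ_le_const[OF this] * show ?thesis by (simp add: divide_inverse)
qed

lemma cos_taylor1: "\<bar>cos t - cos s + (t - s) * sin s\<bar> \<le> (t - s :: real)\<^sup>2"
  and sin_taylor1: "\<bar>sin t - sin s - (t - s) * cos s\<bar> \<le> (t - s :: real)\<^sup>2"
  and cos_lipschitz: "\<bar>cos t - cos s\<bar> \<le> \<bar>t - s\<bar>"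
  and sin_lipschitz: "\<bar>sin t - sin s\<bar> \<le> \<bar>t - s\<bar>"
proof -
  have aux: "\<bar>f t - f s\<bar> \<le> \<bar>t - s\<bar> * K"
    if "\<And>x. x \<in> closed_segment s t \<Longrightarrow> (f has_real_derivative f' x) (at x)"
      "\<And>x. x \<in> closed_segment s t \<Longrightarrow> \<bar>f' x\<bar> \<le> K" for f f' :: "real \<Rightarrow> real" and s t K
    using field_differentiable_bound[of "closed_segment s t" f f' K t s] that
    by (auto simp: has_field_derivative_at_within mult.commute)
  show c: "\<bar>cos t - cos s\<bar> \<le> \<bar>t - s\<bar>" for t s :: real
    using aux[of s t cos "\<lambda>x. - sin x" 1] by (auto intro!: derivative_eq_intros)
  show s: "\<bar>sin t - sin s\<bar> \<le> \<bar>t - s\<bar>" for t s :: real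
    using aux[of s t sin "\<lambda>x. cos x" 1] by (auto intro!: derivative_eq_intros)
  have seg: "\<bar>x - s\<bar> \<le> \<bar>t - s\<bar>" if "x \<in> closed_segment s t" for x
    using that by (auto simp: closed_segment_eq_real_ivl split: if_splits)
  have "\<bar>(cos t + t * sin s) - (cos s + s * sin s)\<bar> \<le> \<bar>t - s\<bar> * \<bar>t - s\<bar>"
  proof (rule aux[where f = "\<lambda>x. cos x + x * sin s" and f' = "\<lambda>x. sin s - sin x"])
    fix x assume "x \<in> closed_segment s t"
    show "\<bar>sin s - sin x\<bar> \<le> \<bar>t - s\<bar>"
      using s[of x s] seg[OF \<open>x \<in> _\<close>] by linarith
  qed (auto intro!: derivative_eq_intros)
  then show "\<bar>cos t - cos s + (t - s) * sin s\<bar> \<le> (t - s)\<^sup>2"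
    by (simp add: algebra_simps power2_eq_square flip: abs_mult)
  have "\<bar>(sin t - t * cos s) - (sin s - s * cos s)\<bar> \<le> \<bar>t - s\<bar> * \<bar>t - s\<bar>"
  proof (rule aux[where f = "\<lambda>x. sin x - x * cos s" and f' = "\<lambda>x. cos x - cos s"])
    fix x assume "x \<in> closed_segment s t"
    show "\<bar>cos x - cos s\<bar> \<le> \<bar>t - s\<bar>"
      using c[of x s] seg[OF \<open>x \<in> _\<close>] by linarith
  qed (auto intro!: derivative_eq_intros)
  then show "\<bar>sin t - sin s - (t - s) * cos s\<bar> \<le> (t - s)\<^sup>2"
    by (simp add: algebra_simps power2_eq_square flip: abs_mult)
qed

section \<open>Comparison of vectors with approximate Stein identities\<close>

lemma C2_with_grow:
  fixes \<phi> :: "real^'n \<Rightarrow> real"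
  assumes "C2_with B \<phi> \<phi>1 \<phi>2"
  shows "\<bar>\<phi> x\<bar> \<le> \<bar>\<phi> 0\<bar> + B * real CARD('n) * norm x"
proof -
  have "\<bar>\<phi> x - \<phi> 0\<bar> \<le> B * real CARD('n) * norm (x - 0)"
    using assms unfolding C2_with_def by (intro lipschitz_partials_norm[of \<phi> \<phi>1 B x 0]) blast+
  then show ?thesis by simp
qed

lemma measurable_vec_nth [measurable (raw)]:
  "f \<in> borel_measurable M \<Longrightarrow> (\<lambda>x. (f x :: real^'n) $ a) \<in> borel_measurable M"
  by (erule measurable_compose) (intro borel_measurable_continuous_onI continuous_intros)

lemma continuous_imp_measurable: "continuous_on UNIV (f :: real^'n \<Rightarrow> real) \<Longrightarrow> f \<in> borel_measurable borel"
  by (rule borel_measurable_continuous_onI)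

lemma C2_with_continuous:
  assumes "C2_with B \<phi> \<phi>1 \<phi>2"
  shows "continuous_on UNIV \<phi>"
  using assms unfolding C2_with_def
  by (intro differentiable_imp_continuous_on) (auto simp: differentiable_on_def differentiable_def)

text \<open>First order expansion of \<open>\<phi>\<close> along the rotation from \<open>v\<close> to \<open>w\<close>, with an error that is
integrable as soon as \<open>v\<close> and \<open>w\<close> have second moments.\<close>

lemma rotation_taylor:
  fixes \<phi> :: "real^'n \<Rightarrow> real" and v w :: "real^'n"
  assumes \<phi>: "C2_with B \<phi> \<phi>1 \<phi>2"
  defines "c \<equiv> \<lambda>t. cos t *\<^sub>R v + sin t *\<^sub>R w"
  shows "\<bar>\<phi> (c t) - \<phi> (c s) - (t - s) * (\<Sum>a\<in>UNIV. \<phi>1 a (c s) * (cos s * w $ a - sin s * v $ a))\<bar>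
      \<le> (B * real CARD('n) * real CARD('n) * (norm v + norm w)\<^sup>2 + B * real CARD('n) * (norm v + norm w)) * (t - s)\<^sup>2"
proof -
  define n where "n = real CARD('n)"
  define r where "r = norm v + norm w"
  have [simp]: "r \<ge> 0" "n \<ge> 0" by (auto simp: r_def n_def)
  have d: "\<And>x. (\<phi> has_derivative (\<lambda>h. \<Sum>b\<in>UNIV. \<phi>1 b x * h $ b)) (at x)"
    and b: "\<And>a x. \<bar>\<phi>1 a x\<bar> \<le> B" and c1: "\<And>a. C1_with B (\<phi>1 a) (\<phi>2 a)"
    using \<phi> unfolding C2_with_def by blast+
  have B: "B \<ge> 0" using C1_with_nonneg[OF c1[of undefined]] .
  have lip: "\<bar>\<phi>1 a x - \<phi>1 a y\<bar> \<le> (B * n) * norm (x - y)" for a x y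
    unfolding n_def
    by (rule lipschitz_partials_norm[of _ "\<phi>2 a"]) (use c1[of a] in \<open>auto simp: C1_with_def\<close>)
  define d2 where "d2 = c t - c s"
  define e where "e = d2 - (t - s) *\<^sub>R (cos s *\<^sub>R w - sin s *\<^sub>R v)"
  have nd: "norm d2 \<le> \<bar>t - s\<bar> * r"
  proof -
    have "d2 = (cos t - cos s) *\<^sub>R v + (sin t - sin s) *\<^sub>R w"
      by (simp add: d2_def c_def algebra_simps)
    also have "norm \<dots> \<le> \<bar>cos t - cos s\<bar> * norm v + \<bar>sin t - sin s\<bar> * norm w"
      by (rule order.trans[OF norm_triangle_ineq]) simp
    also have "\<dots> \<le> \<bar>t - s\<bar> * norm v + \<bar>t - s\<bar> * norm w"
      by (intro add_mono mult_right_mono cos_lipschitz sin_lipschitz) auto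
    finally show ?thesis by (simp add: r_def algebra_simps)
  qed
  have ne: "norm e \<le> (t - s)\<^sup>2 * r"
  proof -
    have "e = (cos t - cos s + (t - s) * sin s) *\<^sub>R v + (sin t - sin s - (t - s) * cos s) *\<^sub>R w"
      by (simp add: e_def d2_def c_def algebra_simps)
    also have "norm \<dots> \<le> \<bar>cos t - cos s + (t - s) * sin s\<bar> * norm v + \<bar>sin t - sin s - (t - s) * cos s\<bar> * norm w"
      by (rule order.trans[OF norm_triangle_ineq]) simp
    also have "\<dots> \<le> (t - s)\<^sup>2 * norm v + (t - s)\<^sup>2 * norm w"
      by (intro add_mono mult_right_mono cos_taylor1 sin_taylor1) auto
    finally show ?thesis by (simp add: r_def algebra_simps)
  qed
  have "\<bar>\<phi> (c t) - \<phi> (c s) - (\<Sum>a\<in>UNIV. \<phi>1 a (c s) * d2 $ a)\<bar>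
      \<le> (B * n) * norm d2 * (\<Sum>a\<in>UNIV. \<bar>d2 $ a\<bar>)"
    unfolding d2_def by (rule taylor_partials[OF d lip]) (use B in auto)
  also have "\<dots> \<le> (B * n) * norm d2 * (n * norm d2)"
    unfolding n_def using B by (intro mult_left_mono sum_abs_component_le) auto
  also have "\<dots> = (B * n * n) * (norm d2)\<^sup>2" by (simp add: power2_eq_square)
  also have "\<dots> \<le> (B * n * n) * (\<bar>t - s\<bar> * r)\<^sup>2"
    using B nd by (intro mult_left_mono power_mono) auto
  finally have 1: "\<bar>\<phi> (c t) - \<phi> (c s) - (\<Sum>a\<in>UNIV. \<phi>1 a (c s) * d2 $ a)\<bar> \<le> B * n * n * r\<^sup>2 * (t - s)\<^sup>2"
    by (simp add: power_mult_distrib mult_ac)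
  have "(\<Sum>a\<in>UNIV. \<phi>1 a (c s) * d2 $ a) - (t - s) * (\<Sum>a\<in>UNIV. \<phi>1 a (c s) * (cos s * w $ a - sin s * v $ a))
      = (\<Sum>a\<in>UNIV. \<phi>1 a (c s) * e $ a)"
    by (simp add: e_def sum_distrib_left algebra_simps flip: sum_subtractf)
  also have "\<bar>\<dots>\<bar> \<le> (\<Sum>a\<in>UNIV. B * \<bar>e $ a\<bar>)"
    by (intro order.trans[OF sum_abs] sum_mono) (auto simp: abs_mult intro!: mult_right_mono b)
  also have "\<dots> = B * (\<Sum>a\<in>UNIV. \<bar>e $ a\<bar>)" by (simp add: sum_distrib_left)
  also have "\<dots> \<le> B * (n * norm e)" unfolding n_def using B by (intro mult_left_mono sum_abs_component_le)
  also have "\<dots> \<le> B * (n * ((t - s)\<^sup>2 * r))" using B ne by (intro mult_left_mono) auto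
  finally have 2: "\<bar>(\<Sum>a\<in>UNIV. \<phi>1 a (c s) * d2 $ a)
      - (t - s) * (\<Sum>a\<in>UNIV. \<phi>1 a (c s) * (cos s * w $ a - sin s * v $ a))\<bar> \<le> B * n * r * (t - s)\<^sup>2"
    by (simp add: mult_ac)
  show ?thesis using 1 2 unfolding n_def[symmetric] r_def[symmetric] by (simp add: algebra_simps)
qed

lemma integrable_pair_fst:
  fixes f :: "'a \<Rightarrow> real"
  assumes "prob_space M2" "integrable M1 f"
  shows "integrable (M1 \<Otimes>\<^sub>M M2) (\<lambda>p. f (fst p))"
proof -
  interpret prob_space M2 by fact
  have "integrable (distr (M1 \<Otimes>\<^sub>M M2) M1 fst) f" using assms by (simp add: distr_pair_fst)
  then show ?thesis using assms by (subst (asm) integrable_distr_eq) auto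
qed

lemma integral_pair_fst:
  fixes f :: "'a \<Rightarrow> real"
  assumes "prob_space M2" "f \<in> borel_measurable M1"
  shows "(\<integral>p. f (fst p) \<partial>(M1 \<Otimes>\<^sub>M M2)) = (\<integral>x. f x \<partial>M1)"
proof -
  interpret prob_space M2 by fact
  have "(\<integral>x. f x \<partial>M1) = (\<integral>x. f x \<partial>distr (M1 \<Otimes>\<^sub>M M2) M1 fst)" by (simp add: distr_pair_fst)
  also have "\<dots> = (\<integral>p. f (fst p) \<partial>(M1 \<Otimes>\<^sub>M M2))" using assms by (subst integral_distr) auto
  finally show ?thesis ..
qed

text \<open>The Stein identity of \<open>V\<close>, applied for each fixed value of the independent vector \<open>W\<close> to
the function \<open>v \<mapsto> g (s v + u W)\<close>.\<close>

lemma approx_stein_rotation: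
  fixes V :: "'a \<Rightarrow> real^'n" and W :: "'b \<Rightarrow> real^'n" and s u :: real
  assumes M1: "prob_space M1" and M2: "prob_space M2"
    and V [measurable]: "V \<in> borel_measurable M1" and W [measurable]: "W \<in> borel_measurable M2"
    and iV: "integrable M1 (\<lambda>\<omega>. norm (V \<omega>))"
    and st: "approx_stein M1 V \<delta>" and g: "C1_with L g g'" and s: "\<bar>s\<bar> \<le> 1"
    and gL: "\<And>x. \<bar>g x\<bar> \<le> L"
  defines "c \<equiv> \<lambda>(x, y). s *\<^sub>R V x + u *\<^sub>R W y"
  shows "\<bar>(\<integral>p. V (fst p) $ a * g (c p) \<partial>(M1 \<Otimes>\<^sub>M M2)) - s * (\<integral>p. g' a (c p) \<partial>(M1 \<Otimes>\<^sub>M M2))\<bar> \<le> \<delta> * L"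
    and "integrable (M1 \<Otimes>\<^sub>M M2) (\<lambda>p. V (fst p) $ a * g (c p))"
proof -
  interpret M1: prob_space M1 by fact
  interpret M2: prob_space M2 by fact
  interpret P: pair_prob_space M1 M2 ..
  have gm [measurable]: "g \<in> borel_measurable borel" "\<And>b. g' b \<in> borel_measurable borel"
    using C1_with_continuous[OF g] by (auto intro: continuous_imp_measurable)
  have cm [measurable]: "c \<in> borel_measurable (M1 \<Otimes>\<^sub>M M2)" unfolding c_def by measurable
  have gb: "\<bar>g' b x\<bar> \<le> L" for b x using g unfolding C1_with_def by blast
  have iV': "integrable (M1 \<Otimes>\<^sub>M M2) (\<lambda>p. norm (V (fst p)))"
    by (rule integrable_pair_fst[OF M2 iV])
  have I1: "integrable (M1 \<Otimes>\<^sub>M M2) (\<lambda>p. V (fst p) $ a * g (c p))"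
  proof (rule Bochner_Integration.integrable_bound)
    show "integrable (M1 \<Otimes>\<^sub>M M2) (\<lambda>p. L * norm (V (fst p)))" using iV' by simp
    show "AE p in M1 \<Otimes>\<^sub>M M2. norm (V (fst p) $ a * g (c p)) \<le> norm (L * norm (V (fst p)))"
    proof (intro AE_I2)
      fix p
      have "\<bar>V (fst p) $ a\<bar> * \<bar>g (c p)\<bar> \<le> norm (V (fst p)) * L"
        using gL component_le_norm_cart by (intro mult_mono) auto
      then show "norm (V (fst p) $ a * g (c p)) \<le> norm (L * norm (V (fst p)))"
        using C1_with_nonneg[OF g] by (simp add: abs_mult mult.commute)
    qed
  qed measurable
  then show "integrable (M1 \<Otimes>\<^sub>M M2) (\<lambda>p. V (fst p) $ a * g (c p))" .
  have I2: "integrable (M1 \<Otimes>\<^sub>M M2) (\<lambda>p. s * g' a (c p))"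
    by (rule P.integrable_const_bound[of _ "\<bar>s\<bar> * L"]) (auto simp: abs_mult intro!: mult_left_mono gb)
  let ?F = "\<lambda>x y. V x $ a * g (c (x, y))" and ?G = "\<lambda>x y. s * g' a (c (x, y))"
  have I1': "integrable (M1 \<Otimes>\<^sub>M M2) (case_prod ?F)"
    by (rule Bochner_Integration.integrable_cong[THEN iffD1, OF refl _ I1]) auto
  have I2': "integrable (M1 \<Otimes>\<^sub>M M2) (case_prod ?G)"
    by (rule Bochner_Integration.integrable_cong[THEN iffD1, OF refl _ I2]) auto
  have "\<bar>(\<integral>x. ?F x y \<partial>M1) - (\<integral>x. ?G x y \<partial>M1)\<bar> \<le> \<delta> * L" for y
    using st C1_with_scale_shift[OF g s, of "u *\<^sub>R W y"] unfolding approx_stein_def c_def by fastforce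
  then have "\<bar>\<integral>y. (\<integral>x. ?F x y \<partial>M1) - (\<integral>x. ?G x y \<partial>M1) \<partial>M2\<bar> \<le> \<delta> * L"
    using P.integrable_snd[OF I1'] P.integrable_snd[OF I2']
    by (intro order.trans[OF integral_abs_bound] M2.integral_le_const) auto
  also have "(\<integral>y. (\<integral>x. ?F x y \<partial>M1) - (\<integral>x. ?G x y \<partial>M1) \<partial>M2)
      = (\<integral>p. case_prod ?F p \<partial>(M1 \<Otimes>\<^sub>M M2)) - (\<integral>p. case_prod ?G p \<partial>(M1 \<Otimes>\<^sub>M M2))"
    unfolding P.integral_snd[OF I1', symmetric] P.integral_snd[OF I2', symmetric]
    by (rule Bochner_Integration.integral_diff[OF P.integrable_snd[OF I1'] P.integrable_snd[OF I2']])
  finally show "\<bar>(\<integral>p. V (fst p) $ a * g (c p) \<partial>(M1 \<Otimes>\<^sub>M M2)) - s * (\<integral>p. g' a (c p) \<partial>(M1 \<Otimes>\<^sub>M M2))\<bar> \<le> \<delta> * L"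
    by (simp add: case_prod_beta')
qed

text \<open>Let \<open>F t\<close> be the expectation of \<open>\<phi> (cos t V + sin t W)\<close> for independent \<open>V\<close> and \<open>W\<close>. Its
derivative is the sum over \<open>a\<close> of \<open>cos t E[W\<^sub>a \<phi>1 a] - sin t E[V\<^sub>a \<phi>1 a]\<close>. By the two Stein identities, both
terms equal \<open>cos t sin t E[\<phi>2 a a]\<close> up to the errors, so these main terms cancel.\<close>

theorem approx_stein_compare:
  fixes V :: "'a \<Rightarrow> real^'n" and W :: "'b \<Rightarrow> real^'n"
  assumes M1: "prob_space M1" and M2: "prob_space M2"
    and V [measurable]: "V \<in> borel_measurable M1" and W [measurable]: "W \<in> borel_measurable M2"
    and iV: "integrable M1 (\<lambda>\<omega>. (norm (V \<omega>))\<^sup>2)" and iW: "integrable M2 (\<lambda>\<omega>. (norm (W \<omega>))\<^sup>2)"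
    and sV: "approx_stein M1 V \<delta>1" and sW: "approx_stein M2 W \<delta>2"
    and \<phi>: "C2_with B \<phi> \<phi>1 \<phi>2"
  shows "\<bar>(\<integral>\<omega>. \<phi> (V \<omega>) \<partial>M1) - (\<integral>\<omega>. \<phi> (W \<omega>) \<partial>M2)\<bar> \<le> real CARD('n) * B * (\<delta>1 + \<delta>2) * (pi / 2)"
proof -
  interpret M1: prob_space M1 by fact
  interpret M2: prob_space M2 by fact
  interpret P: pair_prob_space M1 M2 ..
  let ?P = "M1 \<Otimes>\<^sub>M M2" and ?n = "real CARD('n)"
  define c where "c = (\<lambda>t p. cos t *\<^sub>R V (fst p) + sin t *\<^sub>R W (snd p))"
  define r where "r = (\<lambda>p. norm (V (fst p)) + norm (W (snd p)))"
  have b: "\<bar>\<phi>1 a x\<bar> \<le> B" and c1: "C1_with B (\<phi>1 a) (\<phi>2 a)" for a x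
    using \<phi> unfolding C2_with_def by blast+
  have B: "B \<ge> 0" using C1_with_nonneg[OF c1[of undefined]] .
  have [measurable]: "\<phi> \<in> borel_measurable borel" "\<phi>1 a \<in> borel_measurable borel"
      "\<phi>2 a b \<in> borel_measurable borel" for a b
    using C1_with_continuous[OF c1] C2_with_continuous[OF \<phi>] by (auto intro: continuous_imp_measurable)
  have [measurable]: "c t \<in> borel_measurable ?P" "r \<in> borel_measurable ?P" for t
    unfolding c_def r_def by measurable
  have iV1: "integrable M1 (\<lambda>\<omega>. norm (V \<omega>))"
    by (rule M1.square_integrable_imp_integrable[OF _ iV]) measurable
  have iW1: "integrable M2 (\<lambda>\<omega>. norm (W \<omega>))"
    by (rule M2.square_integrable_imp_integrable[OF _ iW]) measurable
  have snd: "integrable ?P (\<lambda>p. f (snd p))" if "integrable M2 f" for f :: "'b \<Rightarrow> real"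
    by (rule P.integrable_product_swap_iff[THEN iffD1])
       (use integrable_pair_fst[OF M1 that] in \<open>simp add: case_prod_beta'\<close>)
  have isnd: "(\<integral>p. f (snd p) \<partial>?P) = (\<integral>x. f x \<partial>M2)" if [measurable]: "f \<in> borel_measurable M2" for f :: "'b \<Rightarrow> real"
    using integral_pair_fst[OF M1 that] P.integral_product_swap[of "\<lambda>p. f (snd p)"]
    by (simp add: case_prod_beta')
  have ir: "integrable ?P r" unfolding r_def
    by (intro Bochner_Integration.integrable_add integrable_pair_fst M2 iV1 snd iW1)
  have ir2: "integrable ?P (\<lambda>p. (r p)\<^sup>2)"
  proof (rule Bochner_Integration.integrable_bound)
    show "integrable ?P (\<lambda>p. 2 * (norm (V (fst p)))\<^sup>2 + 2 * (norm (W (snd p)))\<^sup>2)"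
      by (intro Bochner_Integration.integrable_add integrable_mult_right integrable_pair_fst[OF M2 iV] snd[OF iW])
    have "(x + y)\<^sup>2 \<le> 2 * x\<^sup>2 + 2 * y\<^sup>2" for x y :: real
      using sum_squares_ge_zero[of "x - y" 0] by (simp add: power2_eq_square algebra_simps)
    then show "AE p in ?P. norm ((r p)\<^sup>2) \<le> norm (2 * (norm (V (fst p)))\<^sup>2 + 2 * (norm (W (snd p)))\<^sup>2)"
      by (simp add: r_def)
  qed measurable
  define K where "K = (\<integral>p. B * ?n * ?n * (r p)\<^sup>2 + B * ?n * r p \<partial>?P)"
  define F where "F = (\<lambda>t. \<integral>p. \<phi> (c t p) \<partial>?P)"
  have nc: "norm (c t p) \<le> r p" for t p
  proof -
    have "norm (c t p) \<le> \<bar>cos t\<bar> * norm (V (fst p)) + \<bar>sin t\<bar> * norm (W (snd p))"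
      unfolding c_def by (rule order.trans[OF norm_triangle_ineq]) simp
    also have "\<dots> \<le> 1 * norm (V (fst p)) + 1 * norm (W (snd p))"
      by (intro add_mono mult_right_mono) auto
    finally show ?thesis by (simp add: r_def)
  qed
  have iF: "integrable ?P (\<lambda>p. \<phi> (c t p))" for t
  proof (rule Bochner_Integration.integrable_bound)
    show "integrable ?P (\<lambda>p. \<bar>\<phi> 0\<bar> + B * ?n * r p)"
      by (intro Bochner_Integration.integrable_add integrable_mult_right ir) simp
    have "\<bar>\<phi> (c t p)\<bar> \<le> \<bar>\<phi> 0\<bar> + B * ?n * r p" for p
      using C2_with_grow[OF \<phi>, of "c t p"] mult_left_mono[OF nc[of t p], of "B * ?n"] B by simp
    then show "AE p in ?P. norm (\<phi> (c t p)) \<le> norm (\<bar>\<phi> 0\<bar> + B * ?n * r p)"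
      by (intro AE_I2) (metis abs_ge_self order.trans real_norm_def)
  qed measurable
  have rot: "\<bar>(\<integral>p. V (fst p) $ a * \<phi>1 a (c s p) \<partial>?P) - cos s * (\<integral>p. \<phi>2 a a (c s p) \<partial>?P)\<bar> \<le> \<delta>1 * B"
       "integrable ?P (\<lambda>p. V (fst p) $ a * \<phi>1 a (c s p))" for s a
    using approx_stein_rotation[OF M1 M2 V W iV1 sV c1[of a] abs_cos_le_one[of s] b, where u = "sin s" and a = a]
    by (simp_all add: c_def case_prod_beta')
  \<comment> \<open>the same estimate with the two factors of the product space exchanged\<close>
  have rot2: "\<bar>(\<integral>p. W (snd p) $ a * \<phi>1 a (c s p) \<partial>?P) - sin s * (\<integral>p. \<phi>2 a a (c s p) \<partial>?P)\<bar> \<le> \<delta>2 * B"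
       "integrable ?P (\<lambda>p. W (snd p) $ a * \<phi>1 a (c s p))" for s a
  proof -
    have [measurable]: "(\<lambda>p. c s (snd p, fst p)) \<in> borel_measurable (M2 \<Otimes>\<^sub>M M1)"
      unfolding c_def by measurable
    note * = approx_stein_rotation[OF M2 M1 W V iW1 sW c1[of a] abs_sin_le_one[of s] b, where u = "cos s" and a = a]
    have i2: "integrable (M2 \<Otimes>\<^sub>M M1) (\<lambda>p. W (fst p) $ a * \<phi>1 a (c s (snd p, fst p)))"
      using *(2) by (simp add: c_def case_prod_beta' add.commute)
    then show "integrable ?P (\<lambda>p. W (snd p) $ a * \<phi>1 a (c s p))"
      by (intro P.integrable_product_swap_iff[THEN iffD1]) (simp add: case_prod_beta')
    have "(\<integral>p. W (snd p) $ a * \<phi>1 a (c s p) \<partial>?P) = (\<integral>p. W (fst p) $ a * \<phi>1 a (c s (snd p, fst p)) \<partial>(M2 \<Otimes>\<^sub>M M1))"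
      using P.integral_product_swap[of "\<lambda>p. W (snd p) $ a * \<phi>1 a (c s p)"] by (simp add: case_prod_beta')
    moreover have "(\<integral>p. \<phi>2 a a (c s p) \<partial>?P) = (\<integral>p. \<phi>2 a a (c s (snd p, fst p)) \<partial>(M2 \<Otimes>\<^sub>M M1))"
      using P.integral_product_swap[of "\<lambda>p. \<phi>2 a a (c s p)"] by (simp add: case_prod_beta')
    ultimately show "\<bar>(\<integral>p. W (snd p) $ a * \<phi>1 a (c s p) \<partial>?P) - sin s * (\<integral>p. \<phi>2 a a (c s p) \<partial>?P)\<bar> \<le> \<delta>2 * B"
      using *(1) by (simp add: c_def case_prod_beta' add.commute)
  qed
  have "0 \<le> \<delta>1 * B" "0 \<le> \<delta>2 * B" using rot(1) rot2(1) abs_ge_zero order.trans by blast+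
  have local: "\<bar>F t - F s\<bar> \<le> ?n * B * (\<delta>1 + \<delta>2) * \<bar>t - s\<bar> + K * (t - s)\<^sup>2" for s t
  proof -
    define D where "D = (\<lambda>p. \<Sum>a\<in>UNIV. \<phi>1 a (c s p) * (cos s * W (snd p) $ a - sin s * V (fst p) $ a))"
    have Deq: "D = (\<lambda>p. \<Sum>a\<in>UNIV. cos s * (W (snd p) $ a * \<phi>1 a (c s p)) - sin s * (V (fst p) $ a * \<phi>1 a (c s p)))"
      by (simp add: D_def algebra_simps)
    have iD: "integrable ?P D" unfolding Deq
      by (intro Bochner_Integration.integrable_sum Bochner_Integration.integrable_diff integrable_mult_right rot rot2)
    have "(\<integral>p. D p \<partial>?P) = (\<Sum>a\<in>UNIV. cos s * (\<integral>p. W (snd p) $ a * \<phi>1 a (c s p) \<partial>?P)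
        - sin s * (\<integral>p. V (fst p) $ a * \<phi>1 a (c s p) \<partial>?P))"
      unfolding Deq using rot(2) rot2(2) by (simp add: Bochner_Integration.integral_sum)
    also have "\<bar>\<dots>\<bar> \<le> (\<Sum>a\<in>(UNIV::'n set). B * (\<delta>1 + \<delta>2))"
    proof (intro order.trans[OF sum_abs] sum_mono)
      fix a
      let ?w = "(\<integral>p. W (snd p) $ a * \<phi>1 a (c s p) \<partial>?P)" and ?v = "(\<integral>p. V (fst p) $ a * \<phi>1 a (c s p) \<partial>?P)"
        and ?j = "(\<integral>p. \<phi>2 a a (c s p) \<partial>?P)"
      \<comment> \<open>the main terms \<open>cos s sin s ?j\<close> cancel\<close>
      have "cos s * ?w - sin s * ?v = cos s * (?w - sin s * ?j) - sin s * (?v - cos s * ?j)"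
        by (simp add: algebra_simps)
      also have "\<bar>\<dots>\<bar> \<le> \<bar>cos s\<bar> * \<bar>?w - sin s * ?j\<bar> + \<bar>sin s\<bar> * \<bar>?v - cos s * ?j\<bar>"
        unfolding abs_mult[symmetric] by (rule abs_triangle_ineq4)
      also have "\<dots> \<le> 1 * (\<delta>2 * B) + 1 * (\<delta>1 * B)"
        by (intro add_mono mult_mono rot rot2) auto
      finally show "\<bar>cos s * ?w - sin s * ?v\<bar> \<le> B * (\<delta>1 + \<delta>2)" by (simp add: algebra_simps)
    qed
    finally have 1: "\<bar>\<integral>p. D p \<partial>?P\<bar> \<le> ?n * B * (\<delta>1 + \<delta>2)" by simp
    have "\<bar>\<integral>p. \<phi> (c t p) - \<phi> (c s p) - (t - s) * D p \<partial>?P\<bar>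
        \<le> (\<integral>p. (B * ?n * ?n * (r p)\<^sup>2 + B * ?n * r p) * (t - s)\<^sup>2 \<partial>?P)"
    proof (rule order.trans[OF integral_abs_bound integral_mono])
      show "\<bar>\<phi> (c t p) - \<phi> (c s p) - (t - s) * D p\<bar> \<le> (B * ?n * ?n * (r p)\<^sup>2 + B * ?n * r p) * (t - s)\<^sup>2" for p
        using rotation_taylor[OF \<phi>] by (simp add: D_def r_def c_def)
    qed (use iF iD ir ir2 in auto)
    also have "\<dots> = K * (t - s)\<^sup>2" by (simp add: K_def)
    also have "(\<integral>p. \<phi> (c t p) - \<phi> (c s p) - (t - s) * D p \<partial>?P) = F t - F s - (t - s) * (\<integral>p. D p \<partial>?P)"
      using iF iD by (simp add: F_def)
    finally have 2: "\<bar>F t - F s - (t - s) * (\<integral>p. D p \<partial>?P)\<bar> \<le> K * (t - s)\<^sup>2" .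
    have "\<bar>(t - s) * (\<integral>p. D p \<partial>?P)\<bar> \<le> \<bar>t - s\<bar> * (?n * B * (\<delta>1 + \<delta>2))"
      unfolding abs_mult by (intro mult_left_mono 1) auto
    then show ?thesis using 2 by (simp add: mult_ac)
  qed
  have "\<bar>F (pi / 2) - F 0\<bar> \<le> ?n * B * (\<delta>1 + \<delta>2) * (pi / 2)"
    by (rule increment_le_of_local[OF local]) simp
  moreover have "F 0 = (\<integral>\<omega>. \<phi> (V \<omega>) \<partial>M1)"
    using integral_pair_fst[OF M2, of "\<lambda>\<omega>. \<phi> (V \<omega>)" M1] by (simp add: F_def c_def)
  moreover have "F (pi / 2) = (\<integral>\<omega>. \<phi> (W \<omega>) \<partial>M2)"
    using isnd[of "\<lambda>\<omega>. \<phi> (W \<omega>)"] by (simp add: F_def c_def)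
  ultimately show ?thesis by (simp add: abs_minus_commute)
qed

section \<open>The standard normal vector\<close>

lemma measurable_vec_lambda [measurable (raw)]:
  assumes "\<And>a. (\<lambda>x. f a x) \<in> borel_measurable M"
  shows "(\<lambda>x. (\<chi> a. f a x) :: real^'n) \<in> borel_measurable M"
  unfolding borel_measurable_euclidean_space[of "\<lambda>x. (\<chi> a. f a x) :: real^'n"]
  using assms by (auto simp: Basis_vec_def inner_axis)

text \<open>Gaussian integration by parts on the line: the derivative of \<open>n(x) h(x)\<close>, for the normal density
\<open>n\<close>, is \<open>n(x) (h'(x) - x h(x))\<close> and integrates to zero.\<close>

lemma std_normal_by_parts:
  fixes h h' :: "real \<Rightarrow> real"
  assumes d: "\<And>x. (h has_real_derivative h' x) (at x)" and c: "continuous_on UNIV h'"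
    and b: "\<And>x. \<bar>h' x\<bar> \<le> L"
  defines "N \<equiv> density lborel std_normal_density"
  shows "(\<integral>x. x * h x \<partial>N) = (\<integral>x. h' x \<partial>N)" and "integrable N (\<lambda>x. x * h x)"
proof -
  let ?n = "std_normal_density"
  define C where "C = \<bar>h 0\<bar>"
  have L: "L \<ge> 0" using b[of 0] by linarith
  have h: "continuous_on UNIV h" using d by (meson DERIV_isCont continuous_at_imp_continuous_on)
  have [measurable]: "h \<in> borel_measurable borel" "h' \<in> borel_measurable borel"
    using h c by (auto intro: borel_measurable_continuous_onI)
  have grow: "\<bar>h x\<bar> \<le> C + L * \<bar>x\<bar>" for x
  proof -
    have "norm (h x - h 0) \<le> L * norm (x - 0)"
      by (rule field_differentiable_bound[of UNIV h h']) (use d b in auto)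
    then show ?thesis by (auto simp: C_def)
  qed
  have i1: "integrable lborel (\<lambda>x. ?n x * (x * h x))"
  proof (rule Bochner_Integration.integrable_bound)
    show "integrable lborel (\<lambda>x. C * (?n x * \<bar>x\<bar> ^ 1) + L * (?n x * \<bar>x\<bar> ^ 2))"
      by (intro Bochner_Integration.integrable_add integrable_mult_right integrable_std_normal_moment_abs)
    have "norm (?n x * (x * h x)) \<le> C * (?n x * \<bar>x\<bar> ^ 1) + L * (?n x * \<bar>x\<bar> ^ 2)" for x
    proof -
      have "norm (?n x * (x * h x)) = ?n x * (\<bar>x\<bar> * \<bar>h x\<bar>)" by (simp add: abs_mult)
      also have "\<dots> \<le> ?n x * (\<bar>x\<bar> * (C + L * \<bar>x\<bar>))" by (intro mult_left_mono grow) auto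
      also have "\<dots> = C * (?n x * \<bar>x\<bar> ^ 1) + L * (?n x * \<bar>x\<bar> ^ 2)"
        unfolding power2_eq_square power_one_right by (simp only: distrib_left mult_ac)
      finally show ?thesis .
    qed
    then show "AE x in lborel. norm (?n x * (x * h x)) \<le> norm (C * (?n x * \<bar>x\<bar> ^ 1) + L * (?n x * \<bar>x\<bar> ^ 2))"
      by (intro AE_I2) (metis abs_ge_self order.trans real_norm_def)
  qed measurable
  have i2: "integrable lborel (\<lambda>x. ?n x * h' x)"
  proof (rule Bochner_Integration.integrable_bound)
    show "integrable lborel (\<lambda>x. L * (?n x * \<bar>x\<bar> ^ 0))"
      by (intro integrable_mult_right integrable_std_normal_moment_abs)
    have "?n x * \<bar>h' x\<bar> \<le> ?n x * L" for x by (intro mult_left_mono b) auto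
    then show "AE x in lborel. norm (?n x * h' x) \<le> norm (L * (?n x * \<bar>x\<bar> ^ 0))"
      using L by (simp add: abs_mult mult.commute)
  qed measurable
  define f where "f = (\<lambda>x. ?n x * h' x - ?n x * (x * h x))"
  have F: "((\<lambda>x. ?n x * h x) has_real_derivative f x) (at x)" for x
    unfolding std_normal_density_def f_def
    by (rule derivative_eq_intros d refl | simp add: algebra_simps)+
  have cn: "continuous_on UNIV ?n"
    unfolding std_normal_density_def by (intro continuous_intros) auto
  have "continuous_on UNIV f" unfolding f_def by (intro continuous_intros cn c h)
  then have isf: "isCont f x" for x by (simp add: continuous_on_eq_continuous_at)
  have lim: "((\<lambda>x. ?n x * h x) \<longlongrightarrow> 0) F" if "((\<lambda>x. ?n x * (C + L * \<bar>x\<bar>)) \<longlongrightarrow> 0) F" for F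
  proof (rule Lim_null_comparison[OF _ that])
    show "\<forall>\<^sub>F x in F. norm (?n x * h x) \<le> ?n x * (C + L * \<bar>x\<bar>)"
      by (intro always_eventually allI) (simp add: abs_mult mult_left_mono grow)
  qed
  have "((\<lambda>x. ?n x * (C + L * \<bar>x\<bar>)) \<longlongrightarrow> 0) at_top"
    unfolding std_normal_density_def by real_asymp
  then have lt: "((\<lambda>x. ?n x * h x) \<longlongrightarrow> 0) at_top" by (rule lim)
  have "((\<lambda>x. ?n x * (C + L * \<bar>x\<bar>)) \<longlongrightarrow> 0) at_bot"
    unfolding std_normal_density_def by real_asymp
  then have lb: "((\<lambda>x. ?n x * h x) \<longlongrightarrow> 0) at_bot" by (rule lim)
  have "integrable lborel f" unfolding f_def using i1 i2 by simp
  then have si: "set_integrable lborel (einterval (-\<infinity>) \<infinity>) f"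
    by (simp add: einterval_def set_integrable_def)
  have "(LBINT x=-\<infinity>..\<infinity>. f x) = 0 - 0"
    by (rule interval_integral_FTC_integrable[where F = "\<lambda>x. ?n x * h x"])
       (use F isf si lt lb in \<open>auto simp: has_real_derivative_iff_has_vector_derivative ereal_tendsto_simps\<close>)
  then have "(\<integral>x. f x \<partial>lborel) = 0"
    by (simp add: interval_lebesgue_integral_def einterval_def set_lebesgue_integral_def)
  then have "(\<integral>x. ?n x * (x * h x) \<partial>lborel) = (\<integral>x. ?n x * h' x \<partial>lborel)"
    unfolding f_def using i1 i2 by simp
  then show "(\<integral>x. x * h x \<partial>N) = (\<integral>x. h' x \<partial>N)"
    unfolding N_def by (simp add: integral_real_density)
  show "integrable N (\<lambda>x. x * h x)"
    unfolding N_def using i1 by (subst integrable_real_density) auto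
qed

lemma std_normal_vector_square_integrable:
  fixes G :: "'q \<Rightarrow> real^'n"
  assumes G: "\<And>a. (\<lambda>\<omega>. G \<omega> $ a) \<in> borel_measurable Q"
    and N: "\<And>a. distr Q borel (\<lambda>\<omega>. G \<omega> $ a) = density lborel std_normal_density"
  shows "integrable Q (\<lambda>\<omega>. (G \<omega> $ a)\<^sup>2)" and "integrable Q (\<lambda>\<omega>. (norm (G \<omega>))\<^sup>2)"
proof -
  have "integrable (density lborel std_normal_density) (\<lambda>x. x\<^sup>2)"
    using integrable_std_normal_moment[of 2] by (subst integrable_real_density) auto
  then have "integrable (distr Q borel (\<lambda>\<omega>. G \<omega> $ a)) (\<lambda>x. x\<^sup>2)" for a by (simp add: N)
  then show *: "integrable Q (\<lambda>\<omega>. (G \<omega> $ a)\<^sup>2)" for a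
    by (subst (asm) integrable_distr_eq) (use G in auto)
  have "(norm (G \<omega>))\<^sup>2 = (\<Sum>a\<in>UNIV. (G \<omega> $ a)\<^sup>2)" for \<omega>
    by (simp add: norm_vec_def L2_set_def sum_nonneg)
  then show "integrable Q (\<lambda>\<omega>. (norm (G \<omega>))\<^sup>2)" using * by simp
qed

text \<open>By independence of the coordinates, the one-dimensional identity is applied to the coordinate
\<open>a\<close> while the vector of the other coordinates is fixed.\<close>

theorem std_normal_vector_stein:
  fixes G :: "'q \<Rightarrow> real^'n"
  assumes Q: "prob_space Q"
    and ind: "prob_space.indep_vars Q (\<lambda>_. borel) (\<lambda>a \<omega>. G \<omega> $ a) UNIV"
    and N: "\<And>a. distr Q borel (\<lambda>\<omega>. G \<omega> $ a) = density lborel std_normal_density"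
  shows "approx_stein Q G 0"
  unfolding approx_stein_def
proof (intro allI impI)
  fix g :: "real^'n \<Rightarrow> real" and g' L and a :: 'n
  assume g: "C1_with L g g'"
  interpret Q: prob_space Q by fact
  let ?N = "density lborel std_normal_density"
  have Gm [measurable]: "(\<lambda>\<omega>. G \<omega> $ a) \<in> borel_measurable Q" for a
    using ind unfolding Q.indep_vars_def by auto
  have gm [measurable]: "g \<in> borel_measurable borel" "g' b \<in> borel_measurable borel" for b
    using C1_with_continuous[OF g] by (auto intro: continuous_imp_measurable)
  define e where "e = (axis a 1 :: real^'n)"
  \<comment> \<open>\<open>G\<close> with its coordinate \<open>a\<close> replaced by zero\<close>
  define H where "H = (\<lambda>\<omega>. (\<chi> b. if b = a then 0 else G \<omega> $ b) :: real^'n)"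
  have Hm [measurable]: "H \<in> borel_measurable Q" unfolding H_def by measurable
  have GH: "G \<omega> = H \<omega> + (G \<omega> $ a) *\<^sub>R e" for \<omega>
    by (simp add: Finite_Cartesian_Product.vec_eq_iff H_def e_def axis_def)
  define R1 where "R1 = (\<lambda>\<omega>. restrict (\<lambda>b. G \<omega> $ b) {a})"
  define R2 where "R2 = (\<lambda>\<omega>. restrict (\<lambda>b. G \<omega> $ b) (- {a}))"
  define vec where "vec = (\<lambda>r. (\<chi> b. if b = a then 0 else r b) :: real^'n)"
  have iv: "Q.indep_var (Pi\<^sub>M {a} (\<lambda>_. borel)) R1 (Pi\<^sub>M (- {a}) (\<lambda>_. borel)) R2"
    unfolding R1_def R2_def by (rule Q.indep_var_restrict[OF ind]) auto
  then have R [measurable]: "R1 \<in> Q \<rightarrow>\<^sub>M Pi\<^sub>M {a} (\<lambda>_. borel)" "R2 \<in> Q \<rightarrow>\<^sub>M Pi\<^sub>M (- {a}) (\<lambda>_. borel)"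
    using Q.indep_var_distribution_eq by blast+
  define N1 where "N1 = distr Q (Pi\<^sub>M {a} (\<lambda>_. borel :: real measure)) R1"
  define N2 where "N2 = distr Q (Pi\<^sub>M (- {a}) (\<lambda>_. borel :: real measure)) R2"
  have D: "N1 \<Otimes>\<^sub>M N2 = distr Q (Pi\<^sub>M {a} (\<lambda>_. borel) \<Otimes>\<^sub>M Pi\<^sub>M (- {a}) (\<lambda>_. borel)) (\<lambda>\<omega>. (R1 \<omega>, R2 \<omega>))"
    using iv Q.indep_var_distribution_eq unfolding N1_def N2_def by blast
  have setsN [measurable_cong]: "sets N1 = sets (Pi\<^sub>M {a} (\<lambda>_. borel))" "sets N2 = sets (Pi\<^sub>M (- {a}) (\<lambda>_. borel))"
    by (auto simp: N1_def N2_def)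
  have am [measurable]: "(\<lambda>r. r a) \<in> borel_measurable (Pi\<^sub>M {a} (\<lambda>_. borel :: real measure))"
    by (rule measurable_component_singleton) simp
  have vm [measurable]: "vec \<in> borel_measurable (Pi\<^sub>M (- {a}) (\<lambda>_. borel))"
  proof -
    have "(\<lambda>r. if b = a then 0 else r b) \<in> borel_measurable (Pi\<^sub>M (- {a}) (\<lambda>_. borel :: real measure))" for b
      by (cases "b = a") (auto intro!: measurable_component_singleton)
    then show ?thesis unfolding vec_def by (rule measurable_vec_lambda)
  qed
  have N1': "?N = distr N1 borel (\<lambda>r. r a)"
    unfolding N1_def N[of a, symmetric] by (subst distr_distr) (auto simp: comp_def R1_def)
  have vH: "vec (R2 \<omega>) = H \<omega>" "R1 \<omega> a = G \<omega> $ a" for \<omega>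
    by (auto simp: H_def vec_def R1_def R2_def Finite_Cartesian_Product.vec_eq_iff)
  interpret N1: prob_space N1 unfolding N1_def by (rule Q.prob_space_distr) simp
  interpret N2: prob_space N2 unfolding N2_def by (rule Q.prob_space_distr) simp
  interpret P: pair_prob_space N1 N2 ..
  let ?F = "\<lambda>x h. x * g (h + x *\<^sub>R e)" and ?F' = "\<lambda>x h. g' a (h + x *\<^sub>R e)"
  have ibp: "(\<integral>x. ?F x h \<partial>?N) = (\<integral>x. ?F' x h \<partial>?N)" for h
  proof (rule std_normal_by_parts)
    fix x
    have "((\<lambda>x. h + x *\<^sub>R e) has_derivative (\<lambda>t. t *\<^sub>R e)) (at x)"
      by (auto intro!: derivative_eq_intros)
    moreover have "(g has_derivative (\<lambda>v. \<Sum>b\<in>UNIV. g' b (h + x *\<^sub>R e) * v $ b)) (at (h + x *\<^sub>R e))"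
      using g unfolding C1_with_def by blast
    ultimately have "((\<lambda>x. g (h + x *\<^sub>R e)) has_derivative
        (\<lambda>t. \<Sum>b\<in>UNIV. g' b (h + x *\<^sub>R e) * (t *\<^sub>R e) $ b)) (at x)"
      by (rule has_derivative_compose)
    also have "(\<lambda>t. \<Sum>b\<in>UNIV. g' b (h + x *\<^sub>R e) * (t *\<^sub>R e) $ b) = (\<lambda>t. g' a (h + x *\<^sub>R e) * t)"
    proof
      fix t
      have "(\<Sum>b\<in>UNIV. g' b (h + x *\<^sub>R e) * (t *\<^sub>R e) $ b) = (\<Sum>b\<in>{a}. g' b (h + x *\<^sub>R e) * (t *\<^sub>R e) $ b)"
        by (rule sum.mono_neutral_right) (auto simp: e_def axis_def)
      then show "(\<Sum>b\<in>UNIV. g' b (h + x *\<^sub>R e) * (t *\<^sub>R e) $ b) = g' a (h + x *\<^sub>R e) * t"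
        by (simp add: e_def axis_def)
    qed
    finally show "((\<lambda>x. g (h + x *\<^sub>R e)) has_real_derivative g' a (h + x *\<^sub>R e)) (at x)"
      unfolding has_field_derivative_def .
    show "\<bar>g' a (h + x *\<^sub>R e)\<bar> \<le> L" using g unfolding C1_with_def by blast
  next
    show "continuous_on UNIV (\<lambda>x. g' a (h + x *\<^sub>R e))"
      by (rule continuous_on_compose2[OF C1_with_continuous(2)[OF g]]) (auto intro!: continuous_intros)
  qed
  let ?K = "\<lambda>r1 r2. ?F (r1 a) (vec r2)" and ?K' = "\<lambda>r1 r2. ?F' (r1 a) (vec r2)"
  have Km: "case_prod ?K \<in> borel_measurable (Pi\<^sub>M {a} (\<lambda>_. borel) \<Otimes>\<^sub>M Pi\<^sub>M (- {a}) (\<lambda>_. borel))"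
    "case_prod ?K' \<in> borel_measurable (Pi\<^sub>M {a} (\<lambda>_. borel) \<Otimes>\<^sub>M Pi\<^sub>M (- {a}) (\<lambda>_. borel))"
    by measurable
  have iF': "integrable (N1 \<Otimes>\<^sub>M N2) (case_prod ?K')"
    using g by (intro P.integrable_const_bound[of _ L]) (auto simp: C1_with_def)
  have F_eq: "(\<integral>\<omega>. G \<omega> $ a * g (G \<omega>) \<partial>Q) = (\<integral>p. case_prod ?K p \<partial>(N1 \<Otimes>\<^sub>M N2))"
    unfolding D by (subst integral_distr) (use Km in \<open>auto simp: vH simp flip: GH\<close>)
  have F'_eq: "(\<integral>\<omega>. g' a (G \<omega>) \<partial>Q) = (\<integral>p. case_prod ?K' p \<partial>(N1 \<Otimes>\<^sub>M N2))"
    unfolding D by (subst integral_distr) (use Km in \<open>auto simp: vH simp flip: GH\<close>)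
  have iF: "integrable (N1 \<Otimes>\<^sub>M N2) (case_prod ?K)"
  proof -
    have sq: "integrable Q (\<lambda>\<omega>. (norm (G \<omega>))\<^sup>2)"
      by (rule std_normal_vector_square_integrable[OF Gm N])
    have "(\<lambda>\<omega>. H \<omega> + (G \<omega> $ a) *\<^sub>R e) \<in> borel_measurable Q" by measurable
    then have [measurable]: "G \<in> borel_measurable Q" by (simp flip: GH)
    have "integrable Q (\<lambda>\<omega>. norm (G \<omega>))"
      by (rule Q.square_integrable_imp_integrable[OF _ sq]) measurable
    then have dom: "integrable Q (\<lambda>\<omega>. \<bar>g 0\<bar> * norm (G \<omega>) + L * real CARD('n) * (norm (G \<omega>))\<^sup>2)"
      using sq by simp
    have "integrable Q (\<lambda>\<omega>. G \<omega> $ a * g (G \<omega>))"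
    proof (rule Bochner_Integration.integrable_bound[OF dom])
      have "norm (G \<omega> $ a * g (G \<omega>)) \<le> \<bar>g 0\<bar> * norm (G \<omega>) + L * real CARD('n) * (norm (G \<omega>))\<^sup>2" for \<omega>
      proof -
        have "\<bar>g (G \<omega>) - g 0\<bar> \<le> L * real CARD('n) * norm (G \<omega> - 0)"
          by (rule lipschitz_partials_norm[of g g']) (use g in \<open>auto simp: C1_with_def\<close>)
        then have "\<bar>g (G \<omega>)\<bar> \<le> \<bar>g 0\<bar> + L * real CARD('n) * norm (G \<omega>)" by simp
        then have "\<bar>G \<omega> $ a\<bar> * \<bar>g (G \<omega>)\<bar> \<le> norm (G \<omega>) * (\<bar>g 0\<bar> + L * real CARD('n) * norm (G \<omega>))"
          by (intro mult_mono component_le_norm_cart) auto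
        then show ?thesis by (simp add: abs_mult algebra_simps power2_eq_square)
      qed
      then show "AE \<omega> in Q. norm (G \<omega> $ a * g (G \<omega>))
          \<le> norm (\<bar>g 0\<bar> * norm (G \<omega>) + L * real CARD('n) * (norm (G \<omega>))\<^sup>2)"
        by (intro AE_I2) (metis abs_ge_self order.trans real_norm_def)
    qed measurable
    then show ?thesis unfolding D by (subst integrable_distr_eq) (use Km in \<open>auto simp: vH simp flip: GH\<close>)
  qed
  have fib: "(\<integral>r1. ?K r1 r2 \<partial>N1) = (\<integral>r1. ?K' r1 r2 \<partial>N1)" for r2
    using ibp[of "vec r2"] unfolding N1' by (subst (asm) (1 2) integral_distr) auto
  have "(\<integral>\<omega>. G \<omega> $ a * g (G \<omega>) \<partial>Q) = (\<integral>r2. (\<integral>r1. ?K r1 r2 \<partial>N1) \<partial>N2)"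
    unfolding F_eq by (rule P.integral_snd[OF iF, symmetric])
  also have "\<dots> = (\<integral>r2. (\<integral>r1. ?K' r1 r2 \<partial>N1) \<partial>N2)" by (simp only: fib)
  also have "\<dots> = (\<integral>\<omega>. g' a (G \<omega>) \<partial>Q)"
    unfolding F'_eq by (rule P.integral_snd[OF iF'])
  finally show "\<bar>(\<integral>\<omega>. G \<omega> $ a * g (G \<omega>) \<partial>Q) - (\<integral>\<omega>. g' a (G \<omega>) \<partial>Q)\<bar> \<le> 0 * L" by simp
qed

section \<open>Counting configurations of closed walks\<close>

text \<open>A family of edges indexed by \<open>C\<close> is covered if every edge in it is attained at least twice.
By centring and independence, the other families have products of expectation zero.\<close>

definition covered :: "'c set \<Rightarrow> ('c \<Rightarrow> 'e) \<Rightarrow> bool" where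
  "covered C \<epsilon> \<longleftrightarrow> (\<forall>c\<in>C. \<exists>c'\<in>C. c' \<noteq> c \<and> \<epsilon> c' = \<epsilon> c)"

text \<open>Every function with at most \<open>v\<close> values factors through a set of \<open>v\<close> elements. Hence the number of
labellings of a fixed index set with at most \<open>v\<close> labels is of order \<open>N\<close> to the power \<open>v\<close>.\<close>

lemma card_bounded_image:
  fixes I :: "'i set"
  assumes I: "finite I" "I \<noteq> {}"
  shows "card {f \<in> I \<rightarrow>\<^sub>E {..<N::nat}. card (f ` I) \<le> v} \<le> N ^ v * v ^ card I"
proof -
  let ?G = "{..<v} \<rightarrow>\<^sub>E {..<N}" and ?H = "I \<rightarrow>\<^sub>E {..<v}"
  have "{f \<in> I \<rightarrow>\<^sub>E {..<N}. card (f ` I) \<le> v} \<subseteq> (\<lambda>(g, h). restrict (g \<circ> h) I) ` (?G \<times> ?H)"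
  proof clarify
    fix f assume f: "f \<in> I \<rightarrow>\<^sub>E {..<N}" and c: "card (f ` I) \<le> v"
    let ?S = "f ` I"
    obtain h where h: "bij_betw h ?S {0..<card ?S}"
      using ex_bij_betw_finite_nat[of ?S] I by auto
    obtain s where s: "s \<in> ?S" using I by auto
    define g where "g = restrict (\<lambda>u. if u < card ?S then the_inv_into ?S h u else s) {..<v}"
    have "the_inv_into ?S h u \<in> ?S" if "u < card ?S" for u
      using h that by (intro the_inv_into_into[of h ?S]) (auto simp: bij_betw_def)
    then have gS: "g u \<in> ?S" if "u < v" for u using s that by (simp add: g_def)
    have SN: "?S \<subseteq> {..<N}" using f by (auto simp: PiE_def Pi_def)
    have "g \<in> ?G"
      by (rule PiE_I) (use gS SN in \<open>blast, simp add: g_def\<close>)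
    moreover have hS: "h y < card ?S" if "y \<in> ?S" for y
      using bij_betwE[OF h] that by auto
    have "restrict (h \<circ> f) I \<in> ?H"
    proof (rule PiE_I)
      fix u assume "u \<in> I"
      then show "restrict (h \<circ> f) I u \<in> {..<v}" using hS[of "f u"] c by simp
    qed simp
    moreover have "f = restrict (g \<circ> restrict (h \<circ> f) I) I"
    proof
      fix u
      show "f u = restrict (g \<circ> restrict (h \<circ> f) I) I u"
      proof (cases "u \<in> I")
        case True
        then have "the_inv_into ?S h (h (f u)) = f u"
          using h by (intro the_inv_into_f_f) (auto simp: bij_betw_def)
        then show ?thesis using True hS[of "f u"] c by (auto simp: g_def)
      next
        case False
        then show ?thesis using f by (auto simp: PiE_def extensional_def)
      qed
    qed
    ultimately show "f \<in> (\<lambda>(g, h). restrict (g \<circ> h) I) ` (?G \<times> ?H)" by (intro image_eqI[of _ _ "(g, restrict (h \<circ> f) I)"]) auto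
  qed
  then have "card {f \<in> I \<rightarrow>\<^sub>E {..<N}. card (f ` I) \<le> v} \<le> card (?G \<times> ?H)"
    using I by (intro surj_card_le) (auto intro!: finite_PiE)
  also have "\<dots> = N ^ v * v ^ card I"
    using I by (simp add: card_cartesian_product card_PiE)
  finally show ?thesis .
qed

text \<open>A connected graph has at most one vertex more than edges. Connectedness is stated without
paths: a set that contains the root and is not left by any edge is the whole vertex set.\<close>

lemma connected_card_le:
  assumes F: "finite F" "F \<subseteq> V \<times> V" and V: "finite V" "r \<in> V"
    and conn: "\<And>S. S \<subseteq> V \<Longrightarrow> r \<in> S \<Longrightarrow> (\<And>a b. (a, b) \<in> F \<Longrightarrow> a \<in> S \<longleftrightarrow> b \<in> S) \<Longrightarrow> S = V"
  shows "card V \<le> card F + 1"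
proof -
  let ?P = "\<lambda>S. S \<subseteq> V \<and> r \<in> S \<and> card S \<le> card (F \<inter> S \<times> S) + 1"
  \<comment> \<open>a largest vertex set with at least \<open>card S - 1\<close> inner edges: it grows along any edge that leaves it\<close>
  have "?P {r}" using V by auto
  then obtain S where S: "?P S" and max: "\<And>S'. ?P S' \<Longrightarrow> card S' \<le> card S"
    using ex_has_greatest_nat[of ?P "{r}" card "card V"] card_mono[OF V(1)] by (metis le_eq_less_or_eq less_Suc_eq_le)
  have fS: "finite S" using S V finite_subset by blast
  have no: False if ab: "(a, b) \<in> F" and cross: "u \<in> S" "w \<notin> S" "{a, b} = {u, w}" for a b u w
  proof -
    have w: "w \<in> V" using ab cross F by (auto simp: doubleton_eq_iff)
    have "card (insert w S) = card S + 1" using cross fS by simp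
    also have "\<dots> \<le> card (insert (a, b) (F \<inter> S \<times> S)) + 1"
      using S F cross by (subst card_insert_disjoint) (auto simp: doubleton_eq_iff)
    also have "card (insert (a, b) (F \<inter> S \<times> S)) \<le> card (F \<inter> insert w S \<times> insert w S)"
      using F ab cross by (intro card_mono) (auto simp: doubleton_eq_iff)
    finally have "?P (insert w S)" using S w by auto
    then have "card (insert w S) \<le> card S" by (rule max)
    then show False using cross fS by simp
  qed
  have "S = V"
  proof (rule conn)
    fix a b assume "(a, b) \<in> F"
    then show "a \<in> S \<longleftrightarrow> b \<in> S" using no[of a b a b] no[of a b b a] by (auto simp: insert_commute)
  qed (use S in auto)
  then have "F \<inter> S \<times> S = F" using F by blast
  then show ?thesis using S \<open>S = V\<close> by simp
qed

text \<open>A cycle from which one edge, here the one leaving position \<open>i\<close>, is removed is still connected.\<close>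

lemma cyclic_path_const:
  assumes i: "i < k" and step: "\<And>j. j < k \<Longrightarrow> j \<noteq> i \<Longrightarrow> P j = P (Suc j mod k)"
    and ab: "a < k" "b < k"
  shows "P a = P b"
proof -
  have low: "P j = P 0" if "j \<le> i" for j
    using that
  proof (induction j)
    case (Suc j)
    then show ?case using step[of j] i by simp
  qed simp
  have high: "P j = P 0" if "i < j" "j < k" for j
  proof -
    have "P (k - 1 - d) = P 0" if "i < k - 1 - d" for d
      using that
    proof (induction d)
      case 0
      then show ?case using step[of "k - 1"] i by simp
    next
      case (Suc d)
      have "Suc (k - 1 - Suc d) = k - 1 - d" using Suc.prems by linarith
      moreover have "k - 1 - d < k" using i by linarith
      ultimately show ?case using step[of "k - 1 - Suc d"] Suc i by simp
    qed
    from this[of "k - 1 - j"] that show ?thesis by simp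
  qed
  have "P j = P 0" if "j < k" for j using low[of j] high[of j] that by linarith
  then show ?thesis using ab by metis
qed

lemma covered_card:
  assumes "finite C" "covered C \<epsilon>"
  shows "2 * card (\<epsilon> ` C) \<le> card C"
proof -
  have "2 * card (\<epsilon> ` C) = (\<Sum>e\<in>\<epsilon> ` C. 2)" by simp
  also have "\<dots> \<le> (\<Sum>e\<in>\<epsilon> ` C. card {c \<in> C. \<epsilon> c = e})"
  proof (rule sum_mono)
    fix e assume "e \<in> \<epsilon> ` C"
    then obtain c c' where "c \<in> C" "c' \<in> C" "c' \<noteq> c" "\<epsilon> c' = e" "\<epsilon> c = e"
      using assms(2) unfolding covered_def by (metis imageE)
    then have "card {c, c'} \<le> card {c \<in> C. \<epsilon> c = e}"
      using assms(1) by (intro card_mono) auto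
    moreover have "card {c, c'} = 2" using \<open>c' \<noteq> c\<close> by simp
    ultimately show "2 \<le> card {c \<in> C. \<epsilon> c = e}" by linarith
  qed
  also have "\<dots> = card C"
    using sum.image_gen[OF assms(1), of "\<lambda>_. 1 :: nat" \<epsilon>] by simp
  finally show ?thesis .
qed

text \<open>A closed walk of length \<open>k\<close> is a function on the positions \<open>0, ..., k - 1\<close>, extended by
\<open>undefined\<close>; the edge that leaves position \<open>i\<close> ends at the cyclically next position. Walks with
distinct vertices are cycles, the other walks are degenerate.\<close>

definition cyc_edge :: "nat \<Rightarrow> (nat \<Rightarrow> nat) \<Rightarrow> nat \<Rightarrow> nat \<times> nat" where
  "cyc_edge k x i = (x i, x (Suc i mod k))"

definition cycles :: "nat \<Rightarrow> nat \<Rightarrow> (nat \<Rightarrow> nat) set" where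
  "cycles k N = {x \<in> {..<k} \<rightarrow>\<^sub>E {..<N}. inj_on x {..<k}}"

definition degenerate :: "nat \<Rightarrow> nat \<Rightarrow> (nat \<Rightarrow> nat) set" where
  "degenerate k N = {x \<in> {..<k} \<rightarrow>\<^sub>E {..<N}. \<not> inj_on x {..<k}}"

text \<open>An element \<open>(x, i, y, j)\<close> of \<open>edge_pairs k l N\<close> consists of two cycles with a common
edge, at position \<open>i\<close> of \<open>x\<close> and \<open>j\<close> of \<open>y\<close>. These index the terms of the inner product of
the gradients of two cycle sums. The common edge is the base of the pair; the slots are the positions of
the edges other than this one.\<close>

type_synonym edge_pair = "(nat \<Rightarrow> nat) \<times> nat \<times> (nat \<Rightarrow> nat) \<times> nat"

definition edge_pairs :: "nat \<Rightarrow> nat \<Rightarrow> nat \<Rightarrow> edge_pair set" where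
  "edge_pairs k l N = {(x, i, y, j). x \<in> cycles k N \<and> i < k \<and> y \<in> cycles l N \<and> j < l \<and> cyc_edge k x i = cyc_edge l y j}"

fun pair_slots :: "nat \<Rightarrow> nat \<Rightarrow> edge_pair \<Rightarrow> (nat + nat) set" where
  "pair_slots k l (x, i, y, j) = ({..<k} - {i}) <+> ({..<l} - {j})"

fun pair_edge :: "nat \<Rightarrow> nat \<Rightarrow> edge_pair \<Rightarrow> nat + nat \<Rightarrow> nat \<times> nat" where
  "pair_edge k l (x, i, y, j) = case_sum (cyc_edge k x) (cyc_edge l y)"

fun pair_verts :: "nat \<Rightarrow> nat \<Rightarrow> edge_pair \<Rightarrow> nat set" where
  "pair_verts k l (x, i, y, j) = x ` {..<k} \<union> y ` {..<l}"

fun pair_base :: "nat \<Rightarrow> edge_pair \<Rightarrow> nat \<times> nat" where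
  "pair_base k (x, i, y, j) = cyc_edge k x i"

lemma finite_cycles [simp]: "finite (cycles k N)"
  unfolding cycles_def by (rule finite_subset[of _ "{..<k} \<rightarrow>\<^sub>E {..<N}"]) (auto intro!: finite_PiE)

lemma finite_degenerate [simp]: "finite (degenerate k N)"
  unfolding degenerate_def by (rule finite_subset[of _ "{..<k} \<rightarrow>\<^sub>E {..<N}"]) (auto intro!: finite_PiE)

lemma finite_edge_pairs [simp]: "finite (edge_pairs k l N)"
  by (rule finite_subset[of _ "cycles k N \<times> {..<k} \<times> cycles l N \<times> {..<l}"]) (auto simp: edge_pairs_def)

lemma pair_slots_finite: "finite (pair_slots k l p)"
  by (cases p) auto

lemma pair_slots_card: "p \<in> edge_pairs k l N \<Longrightarrow> card (pair_slots k l p) = (k - 1) + (l - 1)"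
  by (cases p) (auto simp: edge_pairs_def card_Plus)

text \<open>The two cycles of a pair stay connected after removal of the base edge: what is left of each cycle is a path
through all its vertices, and the two paths have the same end points.\<close>

lemma edge_pairs_connected:
  assumes p: "p \<in> edge_pairs k l N"
    and closed: "\<And>c. c \<in> pair_slots k l p \<Longrightarrow> fst (pair_edge k l p c) \<in> S \<longleftrightarrow> snd (pair_edge k l p c) \<in> S"
    and r: "r \<in> pair_verts k l p" "r \<in> S"
  shows "pair_verts k l p \<subseteq> S"
proof -
  obtain x i y j where pe: "p = (x, i, y, j)" by (cases p) auto
  have ij: "i < k" "j < l" "x i = y j" using p by (auto simp: pe edge_pairs_def cyc_edge_def)
  have "(x a \<in> S) = (x (Suc a mod k) \<in> S)" if "a < k" "a \<noteq> i" for a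
    using closed[of "Inl a"] that by (auto simp: pe cyc_edge_def)
  from cyclic_path_const[OF ij(1), of "\<lambda>a. x a \<in> S", OF this]
  have X: "(x a \<in> S) = (x i \<in> S)" if "a < k" for a using that ij by blast
  have "(y a \<in> S) = (y (Suc a mod l) \<in> S)" if "a < l" "a \<noteq> j" for a
    using closed[of "Inr a"] that by (auto simp: pe cyc_edge_def)
  from cyclic_path_const[OF ij(2), of "\<lambda>a. y a \<in> S", OF this]
  have Y: "(y a \<in> S) = (x i \<in> S)" if "a < l" for a using that ij by metis
  have "x i \<in> S" using r X Y by (auto simp: pe)
  then show ?thesis using X Y by (auto simp: pe)
qed

text \<open>Two pairs that meet in a vertex form a connected graph. If each of the \<open>2 (k + l - 2)\<close> slots
carries an edge that is attained twice, there are at most \<open>k + l - 2\<close> distinct edges.\<close>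

lemma edge_pairs_vertex_bound:
  assumes p: "p \<in> edge_pairs k l N" and q: "q \<in> edge_pairs k l N"
    and cov: "covered (pair_slots k l p <+> pair_slots k l q) (case_sum (pair_edge k l p) (pair_edge k l q))"
    and meet: "pair_verts k l p \<inter> pair_verts k l q \<noteq> {}"
  shows "card (pair_verts k l p \<union> pair_verts k l q) \<le> k + l - 1"
proof -
  let ?J = "pair_slots k l p <+> pair_slots k l q" and ?\<eta> = "case_sum (pair_edge k l p) (pair_edge k l q)"
  let ?V = "pair_verts k l p \<union> pair_verts k l q"
  obtain x i y j where pe: "p = (x, i, y, j)" by (cases p) auto
  obtain x' i' y' j' where qe: "q = (x', i', y', j')" by (cases q) auto
  have kl: "k \<ge> 1" "l \<ge> 1" using p by (auto simp: pe edge_pairs_def)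
  obtain r where r: "r \<in> pair_verts k l p" "r \<in> pair_verts k l q" using meet by blast
  have fin: "finite ?J" by (simp add: pair_slots_finite)
  have "card ?V \<le> card (?\<eta> ` ?J) + 1"
  proof (rule connected_card_le[where r = r])
    show "?\<eta> ` ?J \<subseteq> ?V \<times> ?V"
      using kl by (auto simp: pe qe cyc_edge_def)
    fix S assume S: "S \<subseteq> ?V" "r \<in> S" and cl: "\<And>a b. (a, b) \<in> ?\<eta> ` ?J \<Longrightarrow> a \<in> S \<longleftrightarrow> b \<in> S"
    have "pair_verts k l p \<subseteq> S"
    proof (rule edge_pairs_connected[OF p _ r(1) S(2)])
      fix c assume "c \<in> pair_slots k l p"
      then have "pair_edge k l p c \<in> ?\<eta> ` ?J" by (intro image_eqI[of _ _ "Inl c"]) auto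
      then show "fst (pair_edge k l p c) \<in> S \<longleftrightarrow> snd (pair_edge k l p c) \<in> S"
        using cl[of "fst (pair_edge k l p c)" "snd (pair_edge k l p c)"] by simp
    qed
    moreover have "pair_verts k l q \<subseteq> S"
    proof (rule edge_pairs_connected[OF q _ r(2) S(2)])
      fix c assume "c \<in> pair_slots k l q"
      then have "pair_edge k l q c \<in> ?\<eta> ` ?J" by (intro image_eqI[of _ _ "Inr c"]) auto
      then show "fst (pair_edge k l q c) \<in> S \<longleftrightarrow> snd (pair_edge k l q c) \<in> S"
        using cl[of "fst (pair_edge k l q c)" "snd (pair_edge k l q c)"] by simp
    qed
    ultimately show "S = ?V" using S by blast
  qed (use fin r in \<open>auto simp: pe qe\<close>)
  moreover have "2 * card (?\<eta> ` ?J) \<le> card ?J" by (rule covered_card[OF fin cov])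
  moreover have "card ?J = 2 * ((k - 1) + (l - 1))"
    by (simp add: card_Plus pair_slots_finite pair_slots_card[OF p] pair_slots_card[OF q])
  ultimately show ?thesis using kl by arith
qed

text \<open>The pairs of index terms that can contribute to the second moment of the inner product of the
gradients.\<close>

definition linked_pairs :: "nat \<Rightarrow> nat \<Rightarrow> nat \<Rightarrow> (edge_pair \<times> edge_pair) set" where
  "linked_pairs k l N = {(p, q) \<in> edge_pairs k l N \<times> edge_pairs k l N.
     covered (pair_slots k l p <+> pair_slots k l q) (case_sum (pair_edge k l p) (pair_edge k l q)) \<and>
     pair_verts k l p \<inter> pair_verts k l q \<noteq> {}}"

lemma finite_linked_pairs [simp]: "finite (linked_pairs k l N)"
  by (rule finite_subset[of _ "edge_pairs k l N \<times> edge_pairs k l N"]) (auto simp: linked_pairs_def)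

lemma case_sum_PiE: "x \<in> I \<rightarrow>\<^sub>E T \<Longrightarrow> y \<in> J \<rightarrow>\<^sub>E T \<Longrightarrow> case_sum x y \<in> (I <+> J) \<rightarrow>\<^sub>E T"
  by (auto simp: PiE_def Pi_def extensional_def split: sum.split)

lemma case_sum_eq_iff: "case_sum f g = case_sum f' g' \<longleftrightarrow> f = f' \<and> g = g'"
  by (metis case_sum_o_inj(1) case_sum_o_inj(2))

lemma card_linked_pairs:
  assumes "k \<ge> 1" "l \<ge> 1"
  shows "card (linked_pairs k l N) \<le> (N ^ (k + l - 1) * (k + l - 1) ^ (2 * (k + l))) * (k * l * (k * l))"
proof -
  let ?I = "({..<k} <+> {..<l}) <+> ({..<k} <+> {..<l})"
  let ?T = "{f \<in> ?I \<rightarrow>\<^sub>E {..<N}. card (f ` ?I) \<le> k + l - 1} \<times> ({..<k} \<times> {..<l} \<times> {..<k} \<times> {..<l})"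
  define code where "code = (\<lambda>((x, i, y, j), (x', i', y', j')).
     (case_sum (case_sum x y) (case_sum x' y') :: (nat + nat) + (nat + nat) \<Rightarrow> nat, (i :: nat, j :: nat, i' :: nat, j' :: nat)))"
  have "card (linked_pairs k l N) \<le> card ?T"
  proof (rule card_inj_on_le)
    show "inj_on code (linked_pairs k l N)"
      by (rule inj_onI) (auto simp: code_def case_sum_eq_iff)
    show "code ` linked_pairs k l N \<subseteq> ?T"
    proof
      fix z assume "z \<in> code ` linked_pairs k l N"
      then obtain p q where pq: "(p, q) \<in> linked_pairs k l N" "z = code (p, q)" by auto
      obtain x i y j x' i' y' j' where e: "p = (x, i, y, j)" "q = (x', i', y', j')"
        by (cases p; cases q) auto
      have *: "((x, i, y, j), (x', i', y', j')) \<in> linked_pairs k l N" using pq e by simp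
      let ?f = "case_sum (case_sum x y) (case_sum x' y')"
      have "?f ` ?I = pair_verts k l (x, i, y, j) \<union> pair_verts k l (x', i', y', j')"
        by (auto simp: Plus_def image_Un image_image)
      moreover have "card (pair_verts k l (x, i, y, j) \<union> pair_verts k l (x', i', y', j')) \<le> k + l - 1"
        using * edge_pairs_vertex_bound unfolding linked_pairs_def by blast
      moreover have "?f \<in> ?I \<rightarrow>\<^sub>E {..<N}"
        using * by (intro case_sum_PiE) (auto simp: linked_pairs_def edge_pairs_def cycles_def)
      ultimately show "z \<in> ?T"
        using * by (simp add: pq(2) e code_def linked_pairs_def edge_pairs_def)
    qed
    have "finite (?I \<rightarrow>\<^sub>E {..<N})" by (intro finite_PiE) auto
    then show "finite ?T" by auto
  qed
  also have "\<dots> = card {f \<in> ?I \<rightarrow>\<^sub>E {..<N}. card (f ` ?I) \<le> k + l - 1} * (k * l * (k * l))"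
    by (simp add: card_cartesian_product)
  also have "\<dots> \<le> (N ^ (k + l - 1) * (k + l - 1) ^ card ?I) * (k * l * (k * l))"
    using assms by (intro mult_right_mono card_bounded_image) (auto simp: lessThan_empty_iff Plus_eq_empty_conv)
  also have "card ?I = 2 * (k + l)" by (simp add: card_Plus)
  finally show ?thesis .
qed

text \<open>Each of the \<open>2 k\<close> edges is attained at least twice, so there are at most \<open>k\<close> distinct ones, and every vertex is
the starting point of an edge. If there were \<open>k\<close> vertices, each vertex would have exactly one
outgoing edge. Then a walk is determined by any of its vertices, and the degenerate
walk \<open>x\<close> is periodic with a period less than \<open>k\<close>. The walk \<open>x'\<close> follows the same orbit, as it shares an edge
with \<open>x\<close>.\<close>

lemma degenerate_walk_vertex_bound:
  assumes x: "x \<in> degenerate k N"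
    and cov: "covered ({..<k} <+> {..<k}) (case_sum (cyc_edge k x) (cyc_edge k x'))"
    and meet: "cyc_edge k x ` {..<k} \<inter> cyc_edge k x' ` {..<k} \<noteq> {}"
  shows "card (x ` {..<k} \<union> x' ` {..<k}) \<le> k - 1"
proof (rule ccontr)
  assume neg: "\<not> ?thesis"
  let ?J = "{..<k} <+> {..<k}" and ?\<eta> = "case_sum (cyc_edge k x) (cyc_edge k x')"
  define V where "V = x ` {..<k} \<union> x' ` {..<k}"
  define F where "F = ?\<eta> ` ?J"
  have FF: "F = cyc_edge k x ` {..<k} \<union> cyc_edge k x' ` {..<k}"
    by (auto simp: F_def Plus_def image_Un image_image)
  have fF: "finite F" by (simp add: F_def)
  have "fst ` F = V" by (auto simp: FF V_def cyc_edge_def image_Un image_image)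
  moreover have "2 * card F \<le> card ?J" unfolding F_def by (rule covered_card[OF _ cov]) simp
  then have "card F \<le> k" by (simp add: card_Plus)
  moreover have "card V \<ge> k" using neg by (simp add: V_def)
  ultimately have "card (fst ` F) = card F" using card_image_le[OF fF, of fst] by simp
  then have inj: "inj_on fst F" using fF by (simp add: eq_card_imp_inj_on)
  obtain i j where ij: "i < j" "j < k" "x i = x j"
    using x unfolding degenerate_def inj_on_def by (auto simp: not_less) (metis linorder_neqE_nat)
  then have k: "k > 0" by simp
  \<comment> \<open>the walks, continued periodically\<close>
  define X X' where "X = (\<lambda>n. x (n mod k))" and "X' = (\<lambda>n. x' (n mod k))"
  have Xe: "(X n, X (Suc n)) \<in> F" "(X' n, X' (Suc n)) \<in> F" for n
  proof -
    have "n mod k < k" using k by simp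
    then have "cyc_edge k x (n mod k) \<in> F" "cyc_edge k x' (n mod k) \<in> F" unfolding FF by auto
    then show "(X n, X (Suc n)) \<in> F" "(X' n, X' (Suc n)) \<in> F"
      by (simp_all add: cyc_edge_def X_def X'_def mod_Suc_eq)
  qed
  have det: "b = c" if "(a, b) \<in> F" "(a, c) \<in> F" for a b c
    using inj_onD[OF inj _ that] by simp
  \<comment> \<open>the orbit between two visits of the same vertex\<close>
  define S where "S = X ` {i..<j}"
  have Sstep: "b \<in> S" if ab: "(a, b) \<in> F" "a \<in> S" for a b
  proof -
    obtain m where m: "m \<in> {i..<j}" "a = X m" using ab by (auto simp: S_def)
    have b: "b = X (Suc m)" using det[of a b "X (Suc m)"] Xe ab m by blast
    show ?thesis
    proof (cases "Suc m = j")
      case True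
      then have "b = X i" using b ij by (simp add: X_def)
      then show ?thesis using ij by (auto simp: S_def)
    next
      case False
      then show ?thesis using b m by (auto simp: S_def)
    qed
  qed
  have orbit: "f (a + d) \<in> S" if "\<And>n. (f n, f (Suc n)) \<in> F" "f a \<in> S" for f :: "nat \<Rightarrow> nat" and a d
    by (induction d) (use that Sstep in auto)
  have all: "f n \<in> S" if f: "\<And>n. (f n, f (Suc n)) \<in> F" "f a \<in> S" and per: "\<And>n m. f (n + m * k) = f n"
    for f :: "nat \<Rightarrow> nat" and a n
  proof -
    have "a \<le> n + a * k" using k by (cases k) auto
    then have "f (n + a * k) \<in> S" using orbit[OF f, of "n + a * k - a"] by simp
    then show ?thesis by (simp add: per)
  qed
  have Xi: "X i \<in> S" using ij by (auto simp: S_def)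
  have XS: "X n \<in> S" for n by (rule all[where f = X and a = i]) (use Xi in \<open>auto simp: Xe\<close>, simp add: X_def)
  obtain a b where ab: "a < k" "b < k" "cyc_edge k x a = cyc_edge k x' b"
  proof -
    from meet obtain e where "e \<in> cyc_edge k x ` {..<k}" "e \<in> cyc_edge k x' ` {..<k}" by blast
    then show ?thesis using that by (elim imageE) simp
  qed
  then have "X' b = X a" by (simp add: cyc_edge_def X_def X'_def)
  then have "X' b \<in> S" using XS by simp
  have X'S: "X' n \<in> S" for n
    by (rule all[where f = X' and a = b]) (use \<open>X' b \<in> S\<close> in \<open>auto simp: Xe\<close>, simp add: X'_def)
  have "V \<subseteq> S"
  proof -
    have "x n \<in> S" "x' n \<in> S" if "n < k" for n
      using XS[of n] X'S[of n] that by (simp_all add: X_def X'_def)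
    then show ?thesis by (auto simp: V_def)
  qed
  then have "card V \<le> card S" by (intro card_mono) (auto simp: S_def)
  also have "\<dots> \<le> j - i" using card_image_le[of "{i..<j}" X] by (simp add: S_def)
  finally show False using \<open>card V \<ge> k\<close> ij by linarith
qed

text \<open>The pairs of degenerate walks that can have nonzero covariance.\<close>

definition linked_degenerate :: "nat \<Rightarrow> nat \<Rightarrow> ((nat \<Rightarrow> nat) \<times> (nat \<Rightarrow> nat)) set" where
  "linked_degenerate k N = {(x, x') \<in> degenerate k N \<times> degenerate k N.
     covered ({..<k} <+> {..<k}) (case_sum (cyc_edge k x) (cyc_edge k x')) \<and>
     cyc_edge k x ` {..<k} \<inter> cyc_edge k x' ` {..<k} \<noteq> {}}"

lemma finite_linked_degenerate [simp]: "finite (linked_degenerate k N)"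
  by (rule finite_subset[of _ "degenerate k N \<times> degenerate k N"]) (auto simp: linked_degenerate_def)

lemma card_linked_degenerate:
  assumes "k \<ge> 1"
  shows "card (linked_degenerate k N) \<le> N ^ (k - 1) * (k - 1) ^ (2 * k)"
proof -
  let ?I = "{..<k} <+> {..<k}"
  let ?T = "{f \<in> ?I \<rightarrow>\<^sub>E {..<N}. card (f ` ?I) \<le> k - 1}"
  have "card (linked_degenerate k N) \<le> card ?T"
  proof (rule card_inj_on_le)
    show "inj_on (\<lambda>(x, x'). case_sum x x') (linked_degenerate k N)"
      by (rule inj_onI) (auto simp: case_sum_eq_iff)
    show "(\<lambda>(x, x'). case_sum x x') ` linked_degenerate k N \<subseteq> ?T"
    proof
      fix z assume "z \<in> (\<lambda>(x, x'). case_sum x x') ` linked_degenerate k N"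
      then obtain x x' where *: "(x, x') \<in> linked_degenerate k N" "z = case_sum x x'" by auto
      have "z ` ?I = x ` {..<k} \<union> x' ` {..<k}"
        by (auto simp: * Plus_def image_Un image_image)
      moreover have "card (x ` {..<k} \<union> x' ` {..<k}) \<le> k - 1"
        using * degenerate_walk_vertex_bound unfolding linked_degenerate_def by blast
      moreover have "z \<in> ?I \<rightarrow>\<^sub>E {..<N}"
        using * by (auto intro!: case_sum_PiE simp: linked_degenerate_def degenerate_def)
      ultimately show "z \<in> ?T" by simp
    qed
    have "finite (?I \<rightarrow>\<^sub>E {..<N})" by (intro finite_PiE) auto
    then show "finite ?T" by auto
  qed
  also have "\<dots> \<le> N ^ (k - 1) * (k - 1) ^ card ?I"
    using assms by (intro card_bounded_image) (auto simp: lessThan_empty_iff Plus_eq_empty_conv)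
  also have "card ?I = 2 * k" by (simp add: card_Plus)
  finally show ?thesis .
qed

lemma card_degenerate:
  assumes "k \<ge> 1"
  shows "card (degenerate k N) \<le> N ^ (k - 1) * (k - 1) ^ k"
proof -
  have "degenerate k N \<subseteq> {f \<in> {..<k} \<rightarrow>\<^sub>E {..<N}. card (f ` {..<k}) \<le> k - 1}"
  proof
    fix f assume f: "f \<in> degenerate k N"
    then have "card (f ` {..<k}) \<noteq> k"
      using eq_card_imp_inj_on[of "{..<k}" f] by (auto simp: degenerate_def)
    moreover have "card (f ` {..<k}) \<le> k" using card_image_le[of "{..<k}" f] by simp
    ultimately show "f \<in> {f \<in> {..<k} \<rightarrow>\<^sub>E {..<N}. card (f ` {..<k}) \<le> k - 1}"
      using f by (auto simp: degenerate_def)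
  qed
  moreover have "finite ({..<k} \<rightarrow>\<^sub>E {..<N})" by (intro finite_PiE) auto
  ultimately have "card (degenerate k N) \<le> card {f \<in> {..<k} \<rightarrow>\<^sub>E {..<N}. card (f ` {..<k}) \<le> k - 1}"
    by (intro card_mono) auto
  also have "\<dots> \<le> N ^ (k - 1) * (k - 1) ^ card {..<k}"
    using assms by (intro card_bounded_image) (auto simp: lessThan_empty_iff)
  finally show ?thesis by simp
qed

lemma card_cycles_degenerate: "card (cycles k N) + card (degenerate k N) = N ^ k"
proof -
  have "card (cycles k N) + card (degenerate k N) = card (cycles k N \<union> degenerate k N)"
    by (intro card_Un_disjoint[symmetric] finite_cycles finite_degenerate) (auto simp: cycles_def degenerate_def)
  also have "cycles k N \<union> degenerate k N = {..<k} \<rightarrow>\<^sub>E {..<N}"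
    by (auto simp: cycles_def degenerate_def)
  finally show ?thesis by (simp add: card_PiE)
qed

lemma cyc_edge_inj: "x \<in> cycles k N \<Longrightarrow> inj_on (cyc_edge k x) {..<k}"
  by (auto simp: cycles_def cyc_edge_def inj_on_def)

definition rotate_cycle :: "nat \<Rightarrow> (nat \<Rightarrow> nat) \<Rightarrow> nat \<Rightarrow> nat \<Rightarrow> nat" where
  "rotate_cycle k x b = restrict (\<lambda>t. x ((b + t) mod k)) {..<k}"

lemma inj_on_add_mod: "inj_on (\<lambda>t. (b + t) mod k) {..<k::nat}"
proof (rule inj_onI)
  fix s t assume st: "s \<in> {..<k}" "t \<in> {..<k}" and eq: "(b + s) mod k = (b + t) mod k"
  have "[s = t] (mod k)" using eq by (simp add: cong_def[symmetric] cong_add_lcancel_nat)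
  then show "s = t" using st by (simp add: cong_def)
qed

text \<open>Cycles with the same set of edges are rotations of each other.\<close>

lemma cycles_same_edges:
  assumes x: "x \<in> cycles k N" and k: "k \<ge> 1"
  shows "{y \<in> cycles k N. cyc_edge k y ` {..<k} = cyc_edge k x ` {..<k}} = rotate_cycle k x ` {..<k}"
proof (intro equalityI subsetI)
  fix y assume "y \<in> {y \<in> cycles k N. cyc_edge k y ` {..<k} = cyc_edge k x ` {..<k}}"
  then have y: "y \<in> cycles k N" and e: "cyc_edge k y ` {..<k} = cyc_edge k x ` {..<k}" by auto
  have ix: "inj_on x {..<k}" using x by (simp add: cycles_def)
  have "cyc_edge k y 0 \<in> cyc_edge k x ` {..<k}" using e k by auto
  then obtain b where b: "b < k" "y 0 = x b" by (auto simp: cyc_edge_def)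
  have yt: "y t = x ((b + t) mod k)" if "t < k" for t
    using that
  proof (induction t)
    case 0
    then show ?case using b by simp
  next
    case (Suc t)
    have "cyc_edge k y t \<in> cyc_edge k x ` {..<k}" using e Suc.prems by (metis Suc_lessD image_eqI lessThan_iff)
    then obtain c where c: "c < k" "y t = x c" "y (Suc t) = x (Suc c mod k)"
      using Suc.prems by (auto simp: cyc_edge_def)
    have "x c = x ((b + t) mod k)" using c Suc by simp
    then have "c = (b + t) mod k" using ix c k by (auto dest: inj_onD)
    then show ?case using c by (simp add: mod_Suc_eq)
  qed
  have "y = rotate_cycle k x b"
    using y yt by (auto simp: rotate_cycle_def cycles_def fun_eq_iff PiE_def extensional_def)
  then show "y \<in> rotate_cycle k x ` {..<k}" using b by auto
next
  fix y assume "y \<in> rotate_cycle k x ` {..<k}"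
  then obtain b where b: "b < k" "y = rotate_cycle k x b" by auto
  have yt: "y t = x ((b + t) mod k)" if "t < k" for t using b that by (simp add: rotate_cycle_def)
  have bij: "(\<lambda>t. (b + t) mod k) ` {..<k} = {..<k}"
    by (rule endo_inj_surj) (use k inj_on_add_mod in auto)
  have "inj_on (x \<circ> (\<lambda>t. (b + t) mod k)) {..<k}"
    using x inj_on_add_mod bij by (intro comp_inj_on) (auto simp: cycles_def)
  moreover have "inj_on y {..<k} = inj_on (x \<circ> (\<lambda>t. (b + t) mod k)) {..<k}"
    by (rule inj_on_cong) (simp add: yt)
  ultimately have "inj_on y {..<k}" by blast
  moreover have "y \<in> {..<k} \<rightarrow>\<^sub>E {..<N}"
  proof (rule PiE_I)
    fix t assume t: "t \<in> {..<k}"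
    have "(b + t) mod k < k" using k by simp
    then show "y t \<in> {..<N}" using x t yt by (auto simp: cycles_def PiE_def Pi_def)
  qed (use b in \<open>simp add: rotate_cycle_def\<close>)
  ultimately have y: "y \<in> cycles k N" by (simp add: cycles_def)
  have "cyc_edge k y t = cyc_edge k x ((b + t) mod k)" if "t < k" for t
    using that yt k by (simp add: cyc_edge_def mod_Suc_eq mod_add_right_eq flip: add_Suc_right)
  then have "cyc_edge k y ` {..<k} = cyc_edge k x ` ((\<lambda>t. (b + t) mod k) ` {..<k})"
    unfolding image_image by (intro image_cong) auto
  then show "y \<in> {y \<in> cycles k N. cyc_edge k y ` {..<k} = cyc_edge k x ` {..<k}}" using y bij by simp
qed

lemma card_cycles_same_edges:
  assumes x: "x \<in> cycles k N" and k: "k \<ge> 1"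
  shows "card {y \<in> cycles k N. cyc_edge k y ` {..<k} = cyc_edge k x ` {..<k}} = k"
proof -
  have "inj_on (rotate_cycle k x) {..<k}"
  proof (rule inj_onI)
    fix b c assume bc: "b \<in> {..<k}" "c \<in> {..<k}" "rotate_cycle k x b = rotate_cycle k x c"
    have "rotate_cycle k x b 0 = x b" "rotate_cycle k x c 0 = x c"
      using bc(1,2) k by (simp_all add: rotate_cycle_def)
    then have "x b = x c" by (simp add: bc(3))
    then show "b = c" using x bc by (auto simp: cycles_def dest: inj_onD)
  qed
  then show ?thesis using cycles_same_edges[OF assms] by (simp add: card_image)
qed

section \<open>Moments of monomials in independent entries\<close>

context prob_space
begin

text \<open>Random variables all of whose absolute moments are finite form an algebra, which settles
every integrability question about polynomials in the entries.\<close>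

definition all_moments :: "('a \<Rightarrow> real) \<Rightarrow> bool" where
  "all_moments f \<longleftrightarrow> f \<in> borel_measurable M \<and> (\<forall>n::nat. integrable M (\<lambda>\<omega>. \<bar>f \<omega>\<bar> ^ n))"

lemma all_moments_measurable: "all_moments f \<Longrightarrow> f \<in> borel_measurable M"
  by (simp add: all_moments_def)

lemma all_moments_integrable: "all_moments f \<Longrightarrow> integrable M f"
  unfolding all_moments_def using integrable_abs_iff[of f M] by (auto dest: spec[of _ 1])

lemma all_moments_const: "all_moments (\<lambda>_. c)"
  by (simp add: all_moments_def)

lemma all_moments_dominated:
  assumes "all_moments g" "f \<in> borel_measurable M" "\<And>\<omega>. \<bar>f \<omega>\<bar> \<le> g \<omega>"
  shows "all_moments f"
  unfolding all_moments_def
proof (intro conjI allI)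
  fix n :: nat
  have [measurable]: "f \<in> borel_measurable M" by fact
  show "integrable M (\<lambda>\<omega>. \<bar>f \<omega>\<bar> ^ n)"
  proof (rule Bochner_Integration.integrable_bound)
    show "integrable M (\<lambda>\<omega>. \<bar>g \<omega>\<bar> ^ n)" using assms(1) by (simp add: all_moments_def)
    have "\<bar>f \<omega>\<bar> ^ n \<le> \<bar>g \<omega>\<bar> ^ n" for \<omega>
      using assms(3)[of \<omega>] by (intro power_mono) auto
    then show "AE \<omega> in M. norm (\<bar>f \<omega>\<bar> ^ n) \<le> norm (\<bar>g \<omega>\<bar> ^ n)" by simp
  qed measurable
qed fact

lemma all_moments_mult:
  assumes "all_moments f" "all_moments g"
  shows "all_moments (\<lambda>\<omega>. f \<omega> * g \<omega>)"
  unfolding all_moments_def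
proof (intro conjI allI)
  have [measurable]: "f \<in> borel_measurable M" "g \<in> borel_measurable M"
    using assms by (auto simp: all_moments_def)
  show "(\<lambda>\<omega>. f \<omega> * g \<omega>) \<in> borel_measurable M" by measurable
  fix n :: nat
  show "integrable M (\<lambda>\<omega>. \<bar>f \<omega> * g \<omega>\<bar> ^ n)"
  proof (rule Bochner_Integration.integrable_bound)
    show "integrable M (\<lambda>\<omega>. \<bar>f \<omega>\<bar> ^ (2 * n) + \<bar>g \<omega>\<bar> ^ (2 * n))"
      using assms unfolding all_moments_def by (intro Bochner_Integration.integrable_add) auto
    have "\<bar>f \<omega> * g \<omega>\<bar> ^ n \<le> \<bar>f \<omega>\<bar> ^ (2 * n) + \<bar>g \<omega>\<bar> ^ (2 * n)" for \<omega>
    proof -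
      define p q where "p = \<bar>f \<omega>\<bar> ^ n" and "q = \<bar>g \<omega>\<bar> ^ n"
      have "p \<ge> 0" "q \<ge> 0" by (auto simp: p_def q_def)
      have "2 * (p * q) \<le> p\<^sup>2 + q\<^sup>2" using sum_squares_bound[of p q] by (simp add: mult.assoc)
      moreover have "0 \<le> p * q" using \<open>p \<ge> 0\<close> \<open>q \<ge> 0\<close> by simp
      ultimately have "p * q \<le> p\<^sup>2 + q\<^sup>2" by linarith
      then show ?thesis
        by (simp add: p_def q_def abs_mult power_mult_distrib mult.commute[of 2] power_mult)
    qed
    then show "AE \<omega> in M. norm (\<bar>f \<omega> * g \<omega>\<bar> ^ n) \<le> norm (\<bar>f \<omega>\<bar> ^ (2 * n) + \<bar>g \<omega>\<bar> ^ (2 * n))" by simp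
  qed measurable
qed

lemma all_moments_add:
  assumes "all_moments f" "all_moments g"
  shows "all_moments (\<lambda>\<omega>. f \<omega> + g \<omega>)"
  unfolding all_moments_def
proof (intro conjI allI)
  have [measurable]: "f \<in> borel_measurable M" "g \<in> borel_measurable M"
    using assms by (auto simp: all_moments_def)
  show "(\<lambda>\<omega>. f \<omega> + g \<omega>) \<in> borel_measurable M" by measurable
  fix n :: nat
  show "integrable M (\<lambda>\<omega>. \<bar>f \<omega> + g \<omega>\<bar> ^ n)"
  proof (rule Bochner_Integration.integrable_bound)
    show "integrable M (\<lambda>\<omega>. 2 ^ n * (\<bar>f \<omega>\<bar> ^ n + \<bar>g \<omega>\<bar> ^ n))"
      using assms unfolding all_moments_def
      by (intro integrable_mult_right Bochner_Integration.integrable_add) auto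
    have "\<bar>f \<omega> + g \<omega>\<bar> ^ n \<le> 2 ^ n * (\<bar>f \<omega>\<bar> ^ n + \<bar>g \<omega>\<bar> ^ n)" for \<omega>
    proof -
      define m where "m = max \<bar>f \<omega>\<bar> \<bar>g \<omega>\<bar>"
      have "\<bar>f \<omega> + g \<omega>\<bar> ^ n \<le> (2 * m) ^ n" by (rule power_mono) (auto simp: m_def)
      also have "\<dots> = 2 ^ n * m ^ n" by (rule power_mult_distrib)
      also have "m ^ n \<le> \<bar>f \<omega>\<bar> ^ n + \<bar>g \<omega>\<bar> ^ n" by (auto simp: m_def max_def)
      finally show ?thesis by simp
    qed
    then show "AE \<omega> in M. norm (\<bar>f \<omega> + g \<omega>\<bar> ^ n) \<le> norm (2 ^ n * (\<bar>f \<omega>\<bar> ^ n + \<bar>g \<omega>\<bar> ^ n))" by simp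
  qed measurable
qed

lemma all_moments_uminus: "all_moments f \<Longrightarrow> all_moments (\<lambda>\<omega>. - f \<omega>)"
  by (simp add: all_moments_def)

lemma all_moments_diff: "all_moments f \<Longrightarrow> all_moments g \<Longrightarrow> all_moments (\<lambda>\<omega>. f \<omega> - g \<omega>)"
  using all_moments_add[OF _ all_moments_uminus, of f g] by simp

lemma all_moments_abs: "all_moments f \<Longrightarrow> all_moments (\<lambda>\<omega>. \<bar>f \<omega>\<bar>)"
  by (auto simp: all_moments_def)

lemma all_moments_divide: "all_moments f \<Longrightarrow> all_moments (\<lambda>\<omega>. f \<omega> / c)"
  using all_moments_mult[OF _ all_moments_const[of "inverse c"], of f] by (simp add: divide_inverse)

lemma all_moments_sum: "(\<And>i. i \<in> I \<Longrightarrow> all_moments (f i)) \<Longrightarrow> all_moments (\<lambda>\<omega>. \<Sum>i\<in>I. f i \<omega>)"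
  by (induction I rule: infinite_finite_induct) (auto intro: all_moments_const all_moments_add)

lemma all_moments_prod: "(\<And>i. i \<in> I \<Longrightarrow> all_moments (f i)) \<Longrightarrow> all_moments (\<lambda>\<omega>. \<Prod>i\<in>I. f i \<omega>)"
  by (induction I rule: infinite_finite_induct) (auto intro: all_moments_const all_moments_mult)

lemma all_moments_power: "all_moments f \<Longrightarrow> all_moments (\<lambda>\<omega>. f \<omega> ^ n)"
  by (induction n) (auto intro: all_moments_const all_moments_mult)

lemmas all_moments_intros = all_moments_const all_moments_mult all_moments_add all_moments_uminus
  all_moments_diff all_moments_abs all_moments_divide all_moments_sum all_moments_prod all_moments_power

end

text \<open>The entries of the matrix without the factor \<open>1/sqrt N\<close>, as an independent family on pairs of indices
that start at 0, with common law \<open>D\<close>.\<close>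

locale iid_array = prob_space M for M :: "'a measure" +
  fixes A :: "nat \<times> nat \<Rightarrow> 'a \<Rightarrow> real" and D :: "real measure"
  assumes A_indep: "indep_vars (\<lambda>_. borel) A UNIV"
    and A_distr: "distr M borel (A e) = D"
    and A_moments: "integrable D (\<lambda>x. \<bar>x\<bar> ^ n)"
    and D_mean: "(\<integral>x. x \<partial>D) = 0" and D_square: "(\<integral>x. x\<^sup>2 \<partial>D) = 1"
begin

lemma A_measurable [measurable]: "A e \<in> borel_measurable M"
  using A_indep unfolding indep_vars_def by (cases e) auto

lemma A_all_moments: "all_moments (A e)"
  unfolding all_moments_def
proof (intro conjI allI)
  fix n :: nat
  have "integrable (distr M borel (A e)) (\<lambda>x. \<bar>x\<bar> ^ n)" using A_moments by (simp add: A_distr)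
  then show "integrable M (\<lambda>\<omega>. \<bar>A e \<omega>\<bar> ^ n)" by (subst (asm) integrable_distr_eq) auto
qed measurable

definition mom :: "nat \<Rightarrow> real" where "mom n = (\<integral>x. x ^ n \<partial>D)"

lemma mom_eq: "expectation (\<lambda>\<omega>. A e \<omega> ^ n) = mom n"
proof -
  have "mom n = (\<integral>x. x ^ n \<partial>distr M borel (A e))" by (simp add: mom_def A_distr)
  also have "\<dots> = expectation (\<lambda>\<omega>. A e \<omega> ^ n)" by (subst integral_distr) auto
  finally show ?thesis ..
qed

lemma mom_1 [simp]: "mom (Suc 0) = 0" and mom_2 [simp]: "mom 2 = 1"
  using D_mean D_square by (simp_all add: mom_def)

text \<open>A bound for the expectation of any product of at most \<open>n\<close> entries, repetitions allowed.\<close>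

definition mom_bound :: "nat \<Rightarrow> real" where
  "mom_bound n = (1 + (\<Sum>r\<le>n. \<bar>mom r\<bar>)) ^ n"

lemma mom_bound_nonneg: "mom_bound n \<ge> 0"
  unfolding mom_bound_def by (intro zero_le_power add_nonneg_nonneg sum_nonneg) auto

lemma mom_bound_mono: "m \<le> n \<Longrightarrow> mom_bound m \<le> mom_bound n"
proof -
  assume mn: "m \<le> n"
  have "(\<Sum>r\<le>m. \<bar>mom r\<bar>) \<le> (\<Sum>r\<le>n. \<bar>mom r\<bar>)" by (rule sum_mono2) (use mn in auto)
  then have "mom_bound m \<le> (1 + (\<Sum>r\<le>n. \<bar>mom r\<bar>)) ^ m"
    unfolding mom_bound_def by (intro power_mono) (auto intro: add_nonneg_nonneg sum_nonneg)
  also have "\<dots> \<le> mom_bound n"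
    unfolding mom_bound_def by (intro power_increasing mn) (auto intro: sum_nonneg)
  finally show ?thesis .
qed

text \<open>The product of the entries at the edges \<open>\<epsilon> c\<close>, for \<open>c\<close> in \<open>C\<close>; \<open>mult_at\<close> counts how often an edge
occurs.\<close>

definition monomial :: "'c set \<Rightarrow> ('c \<Rightarrow> nat \<times> nat) \<Rightarrow> 'a \<Rightarrow> real" where
  "monomial C \<epsilon> \<omega> = (\<Prod>c\<in>C. A (\<epsilon> c) \<omega>)"

lemma monomial_all_moments: "all_moments (monomial C \<epsilon>)"
proof -
  have "monomial C \<epsilon> = (\<lambda>\<omega>. \<Prod>c\<in>C. A (\<epsilon> c) \<omega>)" by (simp add: monomial_def fun_eq_iff)
  then show ?thesis using all_moments_prod[of C "\<lambda>c. A (\<epsilon> c)"] A_all_moments by simp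
qed

lemma monomial_Plus:
  "finite C \<Longrightarrow> finite C' \<Longrightarrow> monomial (C <+> C') (case_sum \<epsilon> \<epsilon>') \<omega> = monomial C \<epsilon> \<omega> * monomial C' \<epsilon>' \<omega>"
  by (simp add: monomial_def prod.Plus comp_def)

definition mult_at :: "'c set \<Rightarrow> ('c \<Rightarrow> nat \<times> nat) \<Rightarrow> nat \<times> nat \<Rightarrow> nat" where
  "mult_at C \<epsilon> e = card {c \<in> C. \<epsilon> c = e}"

lemma expectation_monomial:
  assumes "finite C"
  shows "expectation (monomial C \<epsilon>) = (\<Prod>e\<in>\<epsilon> ` C. mom (mult_at C \<epsilon> e))"
proof -
  have "monomial C \<epsilon> \<omega> = (\<Prod>e\<in>\<epsilon> ` C. A e \<omega> ^ mult_at C \<epsilon> e)" for \<omega>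
  proof -
    have "(\<Prod>c\<in>C. A (\<epsilon> c) \<omega>) = (\<Prod>e\<in>\<epsilon> ` C. \<Prod>c\<in>{c \<in> C. \<epsilon> c = e}. A (\<epsilon> c) \<omega>)"
      using assms by (rule prod.image_gen)
    also have "\<dots> = (\<Prod>e\<in>\<epsilon> ` C. A e \<omega> ^ mult_at C \<epsilon> e)"
      by (rule prod.cong) (auto simp: mult_at_def)
    finally show ?thesis by (simp add: monomial_def)
  qed
  then have "expectation (monomial C \<epsilon>) = expectation (\<lambda>\<omega>. \<Prod>e\<in>\<epsilon> ` C. A e \<omega> ^ mult_at C \<epsilon> e)" by presburger
  also have "\<dots> = (\<Prod>e\<in>\<epsilon> ` C. expectation (\<lambda>\<omega>. A e \<omega> ^ mult_at C \<epsilon> e))"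
  proof (rule indep_vars_lebesgue_integral)
    show "indep_vars (\<lambda>_. borel) (\<lambda>e \<omega>. A e \<omega> ^ mult_at C \<epsilon> e) (\<epsilon> ` C)"
      using indep_vars_compose2[OF indep_vars_subset[OF A_indep, of "\<epsilon> ` C"], of "\<lambda>e x. x ^ mult_at C \<epsilon> e" "\<lambda>_. borel"]
      by simp
  qed (use assms in \<open>auto intro!: all_moments_integrable all_moments_power A_all_moments\<close>)
  finally show ?thesis by (simp add: mom_eq)
qed

lemma expectation_monomial_bound:
  assumes "finite C" "card C \<le> n"
  shows "\<bar>expectation (monomial C \<epsilon>)\<bar> \<le> mom_bound n"
proof -
  let ?K = "1 + (\<Sum>r\<le>card C. \<bar>mom r\<bar>)"
  have "\<bar>expectation (monomial C \<epsilon>)\<bar> = (\<Prod>e\<in>\<epsilon> ` C. \<bar>mom (mult_at C \<epsilon> e)\<bar>)"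
    using assms by (simp add: expectation_monomial abs_prod)
  also have "\<dots> \<le> (\<Prod>e\<in>\<epsilon> ` C. ?K)"
  proof (rule prod_mono, intro conjI)
    fix e
    have "mult_at C \<epsilon> e \<le> card C" unfolding mult_at_def using assms by (intro card_mono) auto
    then have "\<bar>mom (mult_at C \<epsilon> e)\<bar> \<le> (\<Sum>r\<le>card C. \<bar>mom r\<bar>)"
      by (intro member_le_sum) auto
    then show "\<bar>mom (mult_at C \<epsilon> e)\<bar> \<le> ?K" by simp
  qed simp
  also have "\<dots> = ?K ^ card (\<epsilon> ` C)" by simp
  also have "\<dots> \<le> ?K ^ card C"
    using assms by (intro power_increasing card_image_le) (auto intro: sum_nonneg)
  also have "\<dots> = mom_bound (card C)" by (simp add: mom_bound_def)
  also have "\<dots> \<le> mom_bound n" by (rule mom_bound_mono) fact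
  finally show ?thesis .
qed

lemma expectation_monomial_uncovered:
  assumes "finite C" "\<not> covered C \<epsilon>"
  shows "expectation (monomial C \<epsilon>) = 0"
proof -
  obtain c where c: "c \<in> C" "\<And>c'. c' \<in> C \<Longrightarrow> \<epsilon> c' = \<epsilon> c \<Longrightarrow> c' = c"
    using assms(2) unfolding covered_def by blast
  then have "{c' \<in> C. \<epsilon> c' = \<epsilon> c} = {c}" by auto
  then have "mom (mult_at C \<epsilon> (\<epsilon> c)) = 0" by (simp add: mult_at_def)
  moreover have "\<epsilon> c \<in> \<epsilon> ` C" using c by blast
  ultimately show ?thesis using assms(1) by (auto simp: expectation_monomial prod_zero_iff)
qed

text \<open>Two monomials are uncorrelated unless their joint family of edges is covered and they have
an edge in common.\<close>

lemma covariance_monomial_zero: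
  assumes C: "finite C" "finite C'"
    and nb: "\<not> (covered (C <+> C') (case_sum \<epsilon> \<epsilon>') \<and> \<epsilon> ` C \<inter> \<epsilon>' ` C' \<noteq> {})"
  shows "expectation (\<lambda>\<omega>. monomial C \<epsilon> \<omega> * monomial C' \<epsilon>' \<omega>)
    = expectation (monomial C \<epsilon>) * expectation (monomial C' \<epsilon>')"
proof -
  let ?J = "C <+> C'" and ?\<eta> = "case_sum \<epsilon> \<epsilon>'"
  have J: "expectation (\<lambda>\<omega>. monomial C \<epsilon> \<omega> * monomial C' \<epsilon>' \<omega>) = expectation (monomial ?J ?\<eta>)"
    using C by (simp add: monomial_Plus[symmetric])
  show ?thesis
  proof (cases "covered ?J ?\<eta>")
    case False
    have "covered ?J ?\<eta>" if 1: "covered C \<epsilon>" and 2: "covered C' \<epsilon>'"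
      unfolding covered_def
    proof
      fix c assume "c \<in> ?J"
      then consider d where "c = Inl d" "d \<in> C" | d where "c = Inr d" "d \<in> C'" by blast
      then show "\<exists>c'\<in>?J. c' \<noteq> c \<and> ?\<eta> c' = ?\<eta> c"
      proof cases
        case 1
        then obtain d' where "d' \<in> C" "d' \<noteq> d" "\<epsilon> d' = \<epsilon> d" using \<open>covered C \<epsilon>\<close> unfolding covered_def by blast
        then show ?thesis using 1 by (intro bexI[of _ "Inl d'"]) auto
      next
        case 2
        then obtain d' where "d' \<in> C'" "d' \<noteq> d" "\<epsilon>' d' = \<epsilon>' d" using \<open>covered C' \<epsilon>'\<close> unfolding covered_def by blast
        then show ?thesis using 2 by (intro bexI[of _ "Inr d'"]) auto
      qed
    qed
    then have "\<not> covered C \<epsilon> \<or> \<not> covered C' \<epsilon>'" using False by blast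
    then have "expectation (monomial C \<epsilon>) = 0 \<or> expectation (monomial C' \<epsilon>') = 0"
      using expectation_monomial_uncovered[OF C(1), of \<epsilon>] expectation_monomial_uncovered[OF C(2), of \<epsilon>'] by blast
    moreover have "expectation (monomial ?J ?\<eta>) = 0"
      using expectation_monomial_uncovered[OF _ False] C by simp
    ultimately show ?thesis unfolding J by auto
  next
    case True
    then have dj: "\<epsilon> ` C \<inter> \<epsilon>' ` C' = {}" using nb by blast
    have im: "?\<eta> ` ?J = \<epsilon> ` C \<union> \<epsilon>' ` C'" by (auto simp: Plus_def image_Un image_image)
    have "mult_at ?J ?\<eta> e = mult_at C \<epsilon> e" if "e \<in> \<epsilon> ` C" for e
    proof -
      have "e \<notin> \<epsilon>' ` C'" using dj that by blast
      then have "{c \<in> ?J. ?\<eta> c = e} = Inl ` {c \<in> C. \<epsilon> c = e}" by (auto simp: Plus_def)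
      then show ?thesis by (simp add: mult_at_def card_image)
    qed
    moreover have "mult_at ?J ?\<eta> e = mult_at C' \<epsilon>' e" if "e \<in> \<epsilon>' ` C'" for e
    proof -
      have "e \<notin> \<epsilon> ` C" using dj that by blast
      then have "{c \<in> ?J. ?\<eta> c = e} = Inr ` {c \<in> C'. \<epsilon>' c = e}" by (auto simp: Plus_def)
      then show ?thesis by (simp add: mult_at_def card_image)
    qed
    ultimately show ?thesis unfolding J using C dj
      by (simp add: expectation_monomial im prod.union_disjoint)
  qed
qed

text \<open>The variance of a sum of monomials is bounded by the number of pairs that may be correlated.\<close>

lemma variance_monomial_sum:
  fixes C :: "'o \<Rightarrow> 'c set" and \<epsilon> :: "'o \<Rightarrow> 'c \<Rightarrow> nat \<times> nat"
  assumes O: "finite O'" and C: "\<And>p. p \<in> O' \<Longrightarrow> finite (C p) \<and> card (C p) \<le> n"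
    and bad: "\<And>p q. p \<in> O' \<Longrightarrow> q \<in> O' \<Longrightarrow> covered (C p <+> C q) (case_sum (\<epsilon> p) (\<epsilon> q)) \<Longrightarrow>
        \<epsilon> p ` C p \<inter> \<epsilon> q ` C q \<noteq> {} \<Longrightarrow> (p, q) \<in> bad"
    and fin: "finite bad"
  shows "variance (\<lambda>\<omega>. \<Sum>p\<in>O'. monomial (C p) (\<epsilon> p) \<omega>) \<le> (mom_bound (2 * n) + (mom_bound n)\<^sup>2) * card bad"
proof -
  let ?m = "\<lambda>p. monomial (C p) (\<epsilon> p)"
  let ?K = "mom_bound (2 * n) + (mom_bound n)\<^sup>2"
  have K: "?K \<ge> 0" using mom_bound_nonneg by simp
  have i: "integrable M (?m p)" "integrable M (\<lambda>\<omega>. ?m p \<omega> * ?m q \<omega>)" for p q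
    by (auto intro!: all_moments_integrable all_moments_intros monomial_all_moments)
  have sq: "(\<lambda>\<omega>. (\<Sum>p\<in>O'. ?m p \<omega>)\<^sup>2) = (\<lambda>\<omega>. \<Sum>p\<in>O'. \<Sum>q\<in>O'. ?m p \<omega> * ?m q \<omega>)"
    by (simp add: power2_eq_square sum_product)
  have "variance (\<lambda>\<omega>. \<Sum>p\<in>O'. ?m p \<omega>) = expectation (\<lambda>\<omega>. (\<Sum>p\<in>O'. ?m p \<omega>)\<^sup>2) - (expectation (\<lambda>\<omega>. \<Sum>p\<in>O'. ?m p \<omega>))\<^sup>2"
    by (rule variance_eq) (unfold sq, auto intro!: Bochner_Integration.integrable_sum i)
  also have "\<dots> = (\<Sum>p\<in>O'. \<Sum>q\<in>O'. expectation (\<lambda>\<omega>. ?m p \<omega> * ?m q \<omega>)) - (\<Sum>p\<in>O'. expectation (?m p))\<^sup>2"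
    unfolding sq by (simp add: i Bochner_Integration.integral_sum)
  also have "\<dots> = (\<Sum>(p,q)\<in>O' \<times> O'. expectation (\<lambda>\<omega>. ?m p \<omega> * ?m q \<omega>) - expectation (?m p) * expectation (?m q))"
    by (simp add: power2_eq_square sum_product sum_subtractf flip: sum.cartesian_product)
  also have "\<dots> \<le> (\<Sum>(p,q)\<in>O' \<times> O'. ?K * of_bool ((p, q) \<in> bad))"
  proof (rule sum_mono, clarify)
    fix p q assume pq: "p \<in> O'" "q \<in> O'"
    have fc: "finite (C p)" "finite (C q)" "card (C p) \<le> n" "card (C q) \<le> n" using C pq by auto
    show "expectation (\<lambda>\<omega>. ?m p \<omega> * ?m q \<omega>) - expectation (?m p) * expectation (?m q) \<le> ?K * of_bool ((p, q) \<in> bad)"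
    proof (cases "(p, q) \<in> bad")
      case True
      have "expectation (\<lambda>\<omega>. ?m p \<omega> * ?m q \<omega>) = expectation (monomial (C p <+> C q) (case_sum (\<epsilon> p) (\<epsilon> q)))"
        using fc by (simp add: monomial_Plus[symmetric])
      also have "\<dots> \<le> mom_bound (2 * n)"
        by (rule order.trans[OF abs_ge_self expectation_monomial_bound]) (use fc in \<open>auto simp: card_Plus\<close>)
      finally have 1: "expectation (\<lambda>\<omega>. ?m p \<omega> * ?m q \<omega>) \<le> mom_bound (2 * n)" .
      have "\<bar>expectation (?m p) * expectation (?m q)\<bar> \<le> mom_bound n * mom_bound n"
        unfolding abs_mult using fc by (intro mult_mono expectation_monomial_bound mom_bound_nonneg) auto
      then show ?thesis using 1 True by (simp add: power2_eq_square abs_le_iff)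
    next
      case False
      then show ?thesis
        using covariance_monomial_zero[OF fc(1,2), of "\<epsilon> p" "\<epsilon> q"] bad[OF pq] by fastforce
    qed
  qed
  also have "\<dots> = (\<Sum>pq\<in>O' \<times> O'. ?K * of_bool (pq \<in> bad))" by (simp add: case_prod_beta')
  also have "\<dots> = ?K * card ((O' \<times> O') \<inter> bad)"
    using O by (simp add: sum_distrib_left[symmetric] of_bool_def sum.If_cases Int_def)
  also have "\<dots> \<le> ?K * card bad"
    using K fin by (intro mult_left_mono) (auto intro!: card_mono)
  finally show ?thesis .
qed

end

section \<open>Cycle sums as polynomials in the entries\<close>

text \<open>The contribution of the cycles to the trace of the \<open>k\<close>-th power, as a polynomial in the array
\<open>a\<close>, and its partial derivative in the entry \<open>e\<close>. The edges of a cycle are distinct, so the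
polynomial is affine in each entry.\<close>

definition cycle_sum :: "nat \<Rightarrow> nat \<Rightarrow> (nat \<times> nat \<Rightarrow> real) \<Rightarrow> real" where
  "cycle_sum k N a = (\<Sum>x\<in>cycles k N. \<Prod>i<k. a (cyc_edge k x i)) / sqrt (real N) ^ k"

definition cycle_sum_deriv :: "nat \<Rightarrow> nat \<Rightarrow> nat \<times> nat \<Rightarrow> (nat \<times> nat \<Rightarrow> real) \<Rightarrow> real" where
  "cycle_sum_deriv k N e a =
     (\<Sum>x\<in>cycles k N. \<Sum>i | i < k \<and> cyc_edge k x i = e. \<Prod>j\<in>{..<k} - {i}. a (cyc_edge k x j)) / sqrt (real N) ^ k"

lemma cycle_prod_update:
  assumes x: "x \<in> cycles k N"
  shows "(\<Prod>i<k. (a(e := t)) (cyc_edge k x i)) = (\<Prod>i<k. (a(e := 0)) (cyc_edge k x i))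
    + t * (\<Sum>i | i < k \<and> cyc_edge k x i = e. \<Prod>j\<in>{..<k} - {i}. a (cyc_edge k x j) :: real)"
proof (cases "\<exists>i<k. cyc_edge k x i = e")
  case True
  then obtain i where i: "i < k" "cyc_edge k x i = e" by blast
  have neq: "cyc_edge k x j \<noteq> e" if "j < k" "j \<noteq> i" for j
    using inj_onD[OF cyc_edge_inj[OF x], of j i] i that by auto
  have "{i. i < k \<and> cyc_edge k x i = e} = {i}" using i neq by auto
  moreover have "(\<Prod>j<k. (a(e := u)) (cyc_edge k x j)) = u * (\<Prod>j\<in>{..<k} - {i}. a (cyc_edge k x j))" for u
  proof -
    have "(\<Prod>j<k. (a(e := u)) (cyc_edge k x j)) = u * (\<Prod>j\<in>{..<k} - {i}. (a(e := u)) (cyc_edge k x j))"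
      using i by (subst prod.remove[of _ i]) auto
    also have "(\<Prod>j\<in>{..<k} - {i}. (a(e := u)) (cyc_edge k x j)) = (\<Prod>j\<in>{..<k} - {i}. a (cyc_edge k x j))"
      using neq by (intro prod.cong) auto
    finally show ?thesis .
  qed
  ultimately show ?thesis by simp
next
  case False
  then have no: "{i. i < k \<and> cyc_edge k x i = e} = {}" by blast
  have "(\<Prod>i<k. (a(e := u)) (cyc_edge k x i)) = (\<Prod>i<k. a (cyc_edge k x i))" for u
    using False by (intro prod.cong) auto
  then show ?thesis by (simp add: no)
qed

lemma cycle_sum_update:
  "cycle_sum k N (a(e := t)) = cycle_sum k N (a(e := 0)) + t * cycle_sum_deriv k N e a"
proof -
  have "(\<Sum>x\<in>cycles k N. \<Prod>i<k. (a(e := t)) (cyc_edge k x i))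
      = (\<Sum>x\<in>cycles k N. (\<Prod>i<k. (a(e := 0)) (cyc_edge k x i))
         + t * (\<Sum>i | i < k \<and> cyc_edge k x i = e. \<Prod>j\<in>{..<k} - {i}. a (cyc_edge k x j)))"
    by (rule sum.cong[OF refl cycle_prod_update])
  then show ?thesis
    unfolding cycle_sum_def cycle_sum_deriv_def
    by (simp add: sum.distrib sum_distrib_left add_divide_distrib del: fun_upd_apply)
qed

lemma cycle_sum_deriv_update: "cycle_sum_deriv k N e (a(e := t)) = cycle_sum_deriv k N e a"
proof -
  have *: "(\<Prod>j\<in>{..<k} - {i}. (a(e := t)) (cyc_edge k x j)) = (\<Prod>j\<in>{..<k} - {i}. a (cyc_edge k x j))"
    if "x \<in> cycles k N" "i \<in> {i. i < k \<and> cyc_edge k x i = e}" for x i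
  proof (intro prod.cong refl)
    fix j assume "j \<in> {..<k} - {i}"
    then have "cyc_edge k x j \<noteq> e" using inj_onD[OF cyc_edge_inj[OF that(1)], of j i] that(2) by auto
    then show "(a(e := t)) (cyc_edge k x j) = a (cyc_edge k x j)" by simp
  qed
  show ?thesis unfolding cycle_sum_deriv_def
    by (intro arg_cong2[of _ _ _ _ "(/)"] sum.cong refl *)
qed

lemma cyc_edge_in_grid:
  assumes "x \<in> {..<k} \<rightarrow>\<^sub>E {..<N}" "i < k"
  shows "cyc_edge k x i \<in> {..<N} \<times> {..<N}"
proof -
  have "Suc i mod k < k" using assms by simp
  then show ?thesis using assms by (auto simp: cyc_edge_def PiE_def Pi_def)
qed

lemma sum_over_edges:
  fixes F :: "nat \<times> nat \<Rightarrow> (nat \<Rightarrow> nat) \<Rightarrow> nat \<Rightarrow> real"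
  shows "(\<Sum>e\<in>{..<N} \<times> {..<N}. \<Sum>x\<in>cycles k N. \<Sum>i | i < k \<and> cyc_edge k x i = e. F e x i)
    = (\<Sum>x\<in>cycles k N. \<Sum>i<k. F (cyc_edge k x i) x i)"
proof -
  have "(\<Sum>e\<in>{..<N} \<times> {..<N}. \<Sum>x\<in>cycles k N. \<Sum>i | i < k \<and> cyc_edge k x i = e. F e x i)
      = (\<Sum>x\<in>cycles k N. \<Sum>e\<in>{..<N} \<times> {..<N}. \<Sum>i | i < k \<and> cyc_edge k x i = e. F e x i)"
    by (rule sum.swap)
  also have "\<dots> = (\<Sum>x\<in>cycles k N. \<Sum>i<k. F (cyc_edge k x i) x i)"
  proof (rule sum.cong[OF refl])
    fix x assume x: "x \<in> cycles k N"
    have "(\<Sum>i<k. F (cyc_edge k x i) x i)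
        = (\<Sum>e\<in>{..<N} \<times> {..<N}. \<Sum>i\<in>{i \<in> {..<k}. cyc_edge k x i = e}. F (cyc_edge k x i) x i)"
    proof (rule sum.group[symmetric])
      show "cyc_edge k x ` {..<k} \<subseteq> {..<N} \<times> {..<N}"
        by (rule image_subsetI, rule cyc_edge_in_grid) (use x in \<open>auto simp: cycles_def\<close>)
    qed auto
    also have "\<dots> = (\<Sum>e\<in>{..<N} \<times> {..<N}. \<Sum>i | i < k \<and> cyc_edge k x i = e. F e x i)"
      by (intro sum.cong) auto
    finally show "(\<Sum>e\<in>{..<N} \<times> {..<N}. \<Sum>i | i < k \<and> cyc_edge k x i = e. F e x i) = (\<Sum>i<k. F (cyc_edge k x i) x i)" ..
  qed
  finally show ?thesis .
qed

text \<open>Euler's identity for a homogeneous polynomial of degree \<open>k\<close>.\<close>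

lemma cycle_sum_euler:
  "(\<Sum>e\<in>{..<N} \<times> {..<N}. a e * cycle_sum_deriv k N e a) = real k * cycle_sum k N a"
proof -
  have "(\<Sum>e\<in>{..<N} \<times> {..<N}. a e * cycle_sum_deriv k N e a)
      = (\<Sum>e\<in>{..<N} \<times> {..<N}. \<Sum>x\<in>cycles k N. \<Sum>i | i < k \<and> cyc_edge k x i = e.
          a e * (\<Prod>j\<in>{..<k} - {i}. a (cyc_edge k x j))) / sqrt (real N) ^ k"
    unfolding cycle_sum_deriv_def by (simp add: sum_distrib_left sum_divide_distrib)
  also have "\<dots> = (\<Sum>x\<in>cycles k N. \<Sum>i<k. a (cyc_edge k x i) * (\<Prod>j\<in>{..<k} - {i}. a (cyc_edge k x j))) / sqrt (real N) ^ k"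
    by (subst sum_over_edges) simp
  also have "\<dots> = (\<Sum>x\<in>cycles k N. \<Sum>i<k. (\<Prod>j<k. a (cyc_edge k x j))) / sqrt (real N) ^ k"
    by (intro arg_cong2[of _ _ _ _ "(/)"] sum.cong refl) (simp add: prod.remove)
  finally show ?thesis by (simp add: cycle_sum_def sum_distrib_left)
qed

lemma pair_base_in_grid:
  assumes "p \<in> edge_pairs k l N"
  shows "pair_base k p \<in> {..<N} \<times> {..<N}"
proof -
  obtain x i y j where p: "p = (x, i, y, j)" by (cases p) auto
  show ?thesis unfolding p pair_base.simps
    by (rule cyc_edge_in_grid) (use assms in \<open>auto simp: p edge_pairs_def cycles_def\<close>)
qed

lemma cycle_sum_deriv_mult:
  "cycle_sum_deriv k N e a * cycle_sum_deriv l N e a =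
     (\<Sum>p | p \<in> edge_pairs k l N \<and> pair_base k p = e. \<Prod>c\<in>pair_slots k l p. a (pair_edge k l p c)) / sqrt (real N) ^ (k + l)"
proof -
  let ?S = "\<lambda>k. Sigma (cycles k N) (\<lambda>x. {i. i < k \<and> cyc_edge k x i = e})"
  let ?f = "\<lambda>k (x, i). \<Prod>j\<in>{..<k} - {i}. a (cyc_edge k x j)"
  have eq: "cycle_sum_deriv k N e a = (\<Sum>z\<in>?S k. ?f k z) / sqrt (real N) ^ k" for k
    unfolding cycle_sum_deriv_def by (subst sum.Sigma) auto
  have "(\<Sum>z\<in>?S k. ?f k z) * (\<Sum>w\<in>?S l. ?f l w) = (\<Sum>(z, w)\<in>?S k \<times> ?S l. ?f k z * ?f l w)"
    by (simp add: sum_product sum.cartesian_product)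
  also have "\<dots> = (\<Sum>p | p \<in> edge_pairs k l N \<and> pair_base k p = e. \<Prod>c\<in>pair_slots k l p. a (pair_edge k l p c))"
    by (rule sum.reindex_bij_witness[of _ "\<lambda>(x, i, y, j). ((x, i), (y, j))" "\<lambda>((x, i), (y, j)). (x, i, y, j)"])
       (auto simp: edge_pairs_def prod.Plus comp_def)
  finally show ?thesis by (simp add: eq power_add)
qed

lemma cycle_sum_deriv_inner:
  "(\<Sum>e\<in>{..<N} \<times> {..<N}. cycle_sum_deriv k N e a * cycle_sum_deriv l N e a) =
     (\<Sum>p\<in>edge_pairs k l N. \<Prod>c\<in>pair_slots k l p. a (pair_edge k l p c)) / sqrt (real N) ^ (k + l)"
proof -
  have "(\<Sum>e\<in>{..<N} \<times> {..<N}. \<Sum>p\<in>{p \<in> edge_pairs k l N. pair_base k p = e}. \<Prod>c\<in>pair_slots k l p. a (pair_edge k l p c))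
     = (\<Sum>p\<in>edge_pairs k l N. \<Prod>c\<in>pair_slots k l p. a (pair_edge k l p c))"
    by (rule sum.group) (auto intro!: image_subsetI pair_base_in_grid)
  then show ?thesis by (simp add: cycle_sum_deriv_mult flip: sum_divide_distrib)
qed

lemma cycle_sum_deriv_fourth:
  "(\<Sum>e\<in>{..<N} \<times> {..<N}. cycle_sum_deriv k N e a ^ 4) =
     (\<Sum>(p, q) | p \<in> edge_pairs k k N \<and> q \<in> edge_pairs k k N \<and> pair_base k p = pair_base k q.
        (\<Prod>c\<in>pair_slots k k p. a (pair_edge k k p c)) * (\<Prod>c\<in>pair_slots k k q. a (pair_edge k k q c)))
      / sqrt (real N) ^ (4 * k)"
proof -
  let ?E = "edge_pairs k k N" and ?f = "\<lambda>p. \<Prod>c\<in>pair_slots k k p. a (pair_edge k k p c)"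
  let ?R = "{(p, q). p \<in> ?E \<and> q \<in> ?E \<and> pair_base k p = pair_base k q}"
  have fR: "finite ?R" by (rule finite_subset[of _ "?E \<times> ?E"]) auto
  have "cycle_sum_deriv k N e a ^ 4 = (\<Sum>(p, q)\<in>{z \<in> ?R. pair_base k (fst z) = e}. ?f p * ?f q) / sqrt (real N) ^ (4 * k)" for e
  proof -
    have "cycle_sum_deriv k N e a ^ 4 = (cycle_sum_deriv k N e a * cycle_sum_deriv k N e a)\<^sup>2"
      by (simp add: power2_eq_square power4_eq_xxxx)
    also have "\<dots> = (\<Sum>p | p \<in> ?E \<and> pair_base k p = e. ?f p)\<^sup>2 / sqrt (real N) ^ (4 * k)"
      unfolding cycle_sum_deriv_mult by (simp add: power_divide flip: power_mult)
    also have "(\<Sum>p | p \<in> ?E \<and> pair_base k p = e. ?f p)\<^sup>2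
        = (\<Sum>(p, q)\<in>{p. p \<in> ?E \<and> pair_base k p = e} \<times> {p. p \<in> ?E \<and> pair_base k p = e}. ?f p * ?f q)"
      by (simp add: power2_eq_square sum_product sum.cartesian_product)
    also have "{p. p \<in> ?E \<and> pair_base k p = e} \<times> {p. p \<in> ?E \<and> pair_base k p = e} = {z \<in> ?R. pair_base k (fst z) = e}"
      by auto
    finally show ?thesis .
  qed
  then have "(\<Sum>e\<in>{..<N} \<times> {..<N}. cycle_sum_deriv k N e a ^ 4)
      = (\<Sum>e\<in>{..<N} \<times> {..<N}. \<Sum>(p, q)\<in>{z \<in> ?R. pair_base k (fst z) = e}. ?f p * ?f q) / sqrt (real N) ^ (4 * k)"
    by (simp add: sum_divide_distrib)
  also have "(\<Sum>e\<in>{..<N} \<times> {..<N}. \<Sum>(p, q)\<in>{z \<in> ?R. pair_base k (fst z) = e}. ?f p * ?f q) = (\<Sum>(p, q)\<in>?R. ?f p * ?f q)"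
  proof (rule sum.group[OF fR])
    show "(\<lambda>z. pair_base k (fst z)) ` ?R \<subseteq> {..<N} \<times> {..<N}"
      by (rule image_subsetI, rule pair_base_in_grid) auto
  qed auto
  finally show ?thesis by simp
qed

lemma cycle_sum_measurable [measurable (raw)]:
  assumes "\<And>e. (\<lambda>r. f r e) \<in> borel_measurable M"
  shows "(\<lambda>r. cycle_sum k N (f r)) \<in> borel_measurable M"
  unfolding cycle_sum_def by (intro borel_measurable_divide borel_measurable_sum borel_measurable_prod assms) auto

lemma cycle_sum_deriv_measurable [measurable (raw)]:
  assumes "\<And>e. (\<lambda>r. f r e) \<in> borel_measurable M"
  shows "(\<lambda>r. cycle_sum_deriv k N e (f r)) \<in> borel_measurable M"
  unfolding cycle_sum_deriv_def by (intro borel_measurable_divide borel_measurable_sum borel_measurable_prod assms) auto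

section \<open>Second and fourth moments of cycle sums\<close>

lemma pair_edge_vert: "p \<in> edge_pairs k l N \<Longrightarrow> c \<in> pair_slots k l p \<Longrightarrow> fst (pair_edge k l p c) \<in> pair_verts k l p"
  by (cases p) (auto simp: cyc_edge_def)

lemma pair_base_vert: "p \<in> edge_pairs k l N \<Longrightarrow> fst (pair_base k p) \<in> pair_verts k l p"
  by (cases p) (auto simp: cyc_edge_def edge_pairs_def)

lemma sqrt_power_even: "sqrt (real N) ^ (2 * n) = real N ^ n"
  by (simp add: power_mult)

lemma power_ratio_le:
  assumes "N \<ge> 1" "n \<ge> 1" "x \<le> real N ^ (n - 1) * c"
  shows "x / real N ^ n \<le> c / real N"
proof -
  have "real N ^ n = real N * real N ^ (n - 1)" using assms(2) by (cases n) auto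
  then show ?thesis using assms by (simp add: divide_simps mult.commute mult.left_commute)
qed

lemma (in prob_space) variance_divide:
  fixes S :: "'a \<Rightarrow> real"
  shows "variance (\<lambda>\<omega>. S \<omega> / c) = variance S / c\<^sup>2"
proof -
  have "(S \<omega> / c - expectation (\<lambda>\<omega>. S \<omega> / c))\<^sup>2 = (S \<omega> - expectation S)\<^sup>2 / c\<^sup>2" for \<omega>
    by (simp add: power_divide flip: diff_divide_distrib)
  then show ?thesis by simp
qed

context iid_array
begin

abbreviation arr :: "'a \<Rightarrow> nat \<times> nat \<Rightarrow> real" where
  "arr \<omega> \<equiv> \<lambda>e. A e \<omega>"

lemma all_moments_cycle_sum:
  "(\<And>e. all_moments (\<lambda>\<omega>. f \<omega> e)) \<Longrightarrow> all_moments (\<lambda>\<omega>. cycle_sum k N (f \<omega>))"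
  unfolding cycle_sum_def by (intro all_moments_divide all_moments_sum all_moments_prod)

lemma all_moments_cycle_sum_deriv:
  "(\<And>e. all_moments (\<lambda>\<omega>. f \<omega> e)) \<Longrightarrow> all_moments (\<lambda>\<omega>. cycle_sum_deriv k N d (f \<omega>))"
  unfolding cycle_sum_deriv_def by (intro all_moments_divide all_moments_sum all_moments_prod)

lemma all_moments_update: "all_moments (\<lambda>\<omega>. ((arr \<omega>)(e := 0)) e')"
  by (cases "e' = e") (auto intro: all_moments_const A_all_moments)

text \<open>A function of one entry is independent of anything that does not involve this entry. Setting the
entry to zero is a convenient way to express the latter.\<close>

lemma resample:
  fixes f :: "real \<Rightarrow> real" and H :: "(nat \<times> nat \<Rightarrow> real) \<Rightarrow> real"
  assumes f [measurable]: "f \<in> borel_measurable borel" and fi: "integrable M (\<lambda>\<omega>. f (A e \<omega>))"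
    and H: "(\<lambda>r. H (r(e := 0))) \<in> borel_measurable (Pi\<^sub>M (- {e}) (\<lambda>_. borel))"
    and Hi: "integrable M (\<lambda>\<omega>. H ((arr \<omega>)(e := 0)))"
  shows "expectation (\<lambda>\<omega>. f (A e \<omega>) * H ((arr \<omega>)(e := 0)))
      = expectation (\<lambda>\<omega>. f (A e \<omega>)) * expectation (\<lambda>\<omega>. H ((arr \<omega>)(e := 0)))"
proof -
  have "indep_var borel ((\<lambda>r. f (r e)) \<circ> (\<lambda>\<omega>. restrict (\<lambda>d. A d \<omega>) {e}))
      borel ((\<lambda>r. H (r(e := 0))) \<circ> (\<lambda>\<omega>. restrict (\<lambda>d. A d \<omega>) (- {e})))"
  proof (rule indep_var_compose[OF indep_var_restrict[OF A_indep] _ H])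
    have "(\<lambda>r. r e) \<in> borel_measurable (Pi\<^sub>M {e} (\<lambda>_. borel :: real measure))"
      by (rule measurable_component_singleton) simp
    then show "(\<lambda>r. f (r e)) \<in> borel_measurable (Pi\<^sub>M {e} (\<lambda>_. borel))" by measurable
  qed auto
  also have "(\<lambda>r. f (r e)) \<circ> (\<lambda>\<omega>. restrict (\<lambda>d. A d \<omega>) {e}) = (\<lambda>\<omega>. f (A e \<omega>))" by auto
  also have "(\<lambda>r. H (r(e := 0))) \<circ> (\<lambda>\<omega>. restrict (\<lambda>d. A d \<omega>) (- {e})) = (\<lambda>\<omega>. H ((arr \<omega>)(e := 0)))"
    by (auto simp: fun_eq_iff intro!: arg_cong[of _ _ H])
  finally show ?thesis by (rule indep_var_lebesgue_integral[OF _ fi Hi])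
qed

lemma measurable_update:
  "(\<lambda>r. (r(e := 0)) d) \<in> borel_measurable (Pi\<^sub>M (- {e}) (\<lambda>_. borel :: real measure))"
  by (cases "d = e") (auto intro!: measurable_component_singleton)

lemma expectation_A: "expectation (A e) = 0" and expectation_A_square: "expectation (\<lambda>\<omega>. (A e \<omega>)\<^sup>2) = 1"
  using mom_eq[of e 1] mom_eq[of e 2] by simp_all

text \<open>The inner product of the gradients of two cycle sums.\<close>

definition gamma :: "nat \<Rightarrow> nat \<Rightarrow> nat \<Rightarrow> 'a \<Rightarrow> real" where
  "gamma k l N \<omega> = (\<Sum>e\<in>{..<N} \<times> {..<N}. cycle_sum_deriv k N e (arr \<omega>) * cycle_sum_deriv l N e (arr \<omega>))"

lemma all_moments_gamma: "all_moments (gamma k l N)"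
proof -
  have "all_moments (\<lambda>\<omega>. \<Sum>e\<in>{..<N} \<times> {..<N}. cycle_sum_deriv k N e (arr \<omega>) * cycle_sum_deriv l N e (arr \<omega>))"
    by (intro all_moments_sum all_moments_mult all_moments_cycle_sum_deriv A_all_moments)
  then show ?thesis by (simp add: gamma_def[abs_def])
qed

text \<open>This and the later constants depend on the lengths of the walks and on the moments of \<open>D\<close>, but not
on \<open>N\<close>.\<close>

definition gamma_const :: "nat \<Rightarrow> nat \<Rightarrow> real" where
  "gamma_const k l = (mom_bound (2 * (k + l)) + (mom_bound (k + l))\<^sup>2)
     * (real ((k + l - 1) ^ (2 * (k + l))) * real (k * l * (k * l)))"

lemma real_card_linked_pairs:
  assumes "k \<ge> 1" "l \<ge> 1"
  shows "real (card (linked_pairs k l N)) \<le> real N ^ (k + l - 1) * (real ((k + l - 1) ^ (2 * (k + l))) * real (k * l * (k * l)))"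
proof -
  have "real (card (linked_pairs k l N)) \<le> real ((N ^ (k + l - 1) * (k + l - 1) ^ (2 * (k + l))) * (k * l * (k * l)))"
    using card_linked_pairs[OF assms, of N] by (rule of_nat_mono)
  also have "\<dots> = real N ^ (k + l - 1) * (real ((k + l - 1) ^ (2 * (k + l))) * real (k * l * (k * l)))"
    by (simp only: of_nat_mult of_nat_power mult.assoc)
  finally show ?thesis .
qed

lemma variance_gamma:
  assumes N: "N \<ge> 1" and kl: "k \<ge> 1" "l \<ge> 1"
  shows "variance (gamma k l N) \<le> gamma_const k l / real N"
proof -
  define S where "S = (\<lambda>\<omega>. \<Sum>p\<in>edge_pairs k l N. monomial (pair_slots k l p) (pair_edge k l p) \<omega>)"
  let ?K = "mom_bound (2 * (k + l)) + (mom_bound (k + l))\<^sup>2"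
  have K: "?K \<ge> 0" using mom_bound_nonneg by simp
  have "gamma k l N = (\<lambda>\<omega>. S \<omega> / sqrt (real N) ^ (k + l))"
    by (simp add: fun_eq_iff gamma_def cycle_sum_deriv_inner S_def monomial_def)
  then have "variance (gamma k l N) = variance S / (sqrt (real N) ^ (k + l))\<^sup>2"
    by (simp only: variance_divide)
  also have "(sqrt (real N) ^ (k + l))\<^sup>2 = real N ^ (k + l)"
    using sqrt_power_even[of N "k + l"] by (simp only: power_mult[symmetric] mult.commute)
  also have "variance S / real N ^ (k + l) \<le> gamma_const k l / real N"
  proof (rule power_ratio_le[OF N])
    have "variance S \<le> ?K * card (linked_pairs k l N)"
      unfolding S_def
    proof (rule variance_monomial_sum)
      fix p q
      assume pq: "p \<in> edge_pairs k l N" "q \<in> edge_pairs k l N"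
        and cov: "covered (pair_slots k l p <+> pair_slots k l q) (case_sum (pair_edge k l p) (pair_edge k l q))"
        and meet: "pair_edge k l p ` pair_slots k l p \<inter> pair_edge k l q ` pair_slots k l q \<noteq> {}"
      obtain c d where "c \<in> pair_slots k l p" "d \<in> pair_slots k l q" "pair_edge k l p c = pair_edge k l q d"
      proof -
        from meet obtain z where "z \<in> pair_edge k l p ` pair_slots k l p" "z \<in> pair_edge k l q ` pair_slots k l q" by blast
        then show ?thesis using that by (elim imageE) simp
      qed
      then have "pair_verts k l p \<inter> pair_verts k l q \<noteq> {}"
        using pair_edge_vert[OF pq(1)] pair_edge_vert[OF pq(2)] by (metis disjoint_iff)
      then show "(p, q) \<in> linked_pairs k l N" using pq cov by (simp add: linked_pairs_def)
    next
      fix p assume "p \<in> edge_pairs k l N"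
      then show "finite (pair_slots k l p) \<and> card (pair_slots k l p) \<le> k + l"
        by (simp add: pair_slots_finite pair_slots_card)
    qed simp_all
    also have "\<dots> \<le> ?K * (real N ^ (k + l - 1) * (real ((k + l - 1) ^ (2 * (k + l))) * real (k * l * (k * l))))"
      by (intro mult_left_mono real_card_linked_pairs kl K)
    also have "\<dots> = real N ^ (k + l - 1) * gamma_const k l"
      unfolding gamma_const_def by (simp only: mult_ac)
    finally show "variance S \<le> real N ^ (k + l - 1) * gamma_const k l" .
  qed (use kl in simp)
  finally show ?thesis .
qed

definition fourth_const :: "nat \<Rightarrow> real" where
  "fourth_const k = mom_bound (4 * k) * (real ((k + k - 1) ^ (2 * (k + k))) * real (k * k * (k * k)))"

text \<open>The fourth powers are indexed by two pairs of cycles with the same base edge; so the graphs that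
contribute are among those counted for the variance of \<open>gamma\<close>.\<close>

lemma expectation_fourth:
  assumes N: "N \<ge> 1" and k: "k \<ge> 1"
  shows "expectation (\<lambda>\<omega>. \<Sum>e\<in>{..<N} \<times> {..<N}. cycle_sum_deriv k N e (arr \<omega>) ^ 4) \<le> fourth_const k / real N"
proof -
  let ?m = "\<lambda>p. monomial (pair_slots k k p) (pair_edge k k p)"
  define R where "R = {(p, q). p \<in> edge_pairs k k N \<and> q \<in> edge_pairs k k N \<and> pair_base k p = pair_base k q}"
  have fR: "finite R" unfolding R_def by (rule finite_subset[of _ "edge_pairs k k N \<times> edge_pairs k k N"]) auto
  have i: "integrable M (\<lambda>\<omega>. ?m p \<omega> * ?m q \<omega>)" for p q
    by (auto intro!: all_moments_integrable all_moments_intros monomial_all_moments)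
  have eq: "(\<lambda>\<omega>. \<Sum>e\<in>{..<N} \<times> {..<N}. cycle_sum_deriv k N e (arr \<omega>) ^ 4)
      = (\<lambda>\<omega>. (\<Sum>z\<in>R. ?m (fst z) \<omega> * ?m (snd z) \<omega>) / sqrt (real N) ^ (4 * k))"
    by (simp add: fun_eq_iff cycle_sum_deriv_fourth monomial_def R_def case_prod_beta')
  have "expectation (\<lambda>\<omega>. \<Sum>e\<in>{..<N} \<times> {..<N}. cycle_sum_deriv k N e (arr \<omega>) ^ 4)
     = (\<Sum>z\<in>R. expectation (\<lambda>\<omega>. ?m (fst z) \<omega> * ?m (snd z) \<omega>)) / sqrt (real N) ^ (4 * k)"
    unfolding eq by (simp add: Bochner_Integration.integral_sum i)
  also have "sqrt (real N) ^ (4 * k) = real N ^ (k + k)"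
    using sqrt_power_even[of N "k + k"] by (simp add: mult_2[symmetric])
  also have "(\<Sum>z\<in>R. expectation (\<lambda>\<omega>. ?m (fst z) \<omega> * ?m (snd z) \<omega>)) / real N ^ (k + k) \<le> fourth_const k / real N"
  proof (rule power_ratio_le[OF N])
    have "(\<Sum>z\<in>R. expectation (\<lambda>\<omega>. ?m (fst z) \<omega> * ?m (snd z) \<omega>)) \<le> (\<Sum>z\<in>R. mom_bound (4 * k) * of_bool (z \<in> linked_pairs k k N))"
    proof (rule sum_mono)
      fix z assume z: "z \<in> R"
      obtain p q where pq: "z = (p, q)" by (cases z) auto
      have pqE: "p \<in> edge_pairs k k N" "q \<in> edge_pairs k k N" "pair_base k p = pair_base k q"
        using z by (auto simp: R_def pq)
      let ?J = "pair_slots k k p <+> pair_slots k k q" and ?\<eta> = "case_sum (pair_edge k k p) (pair_edge k k q)"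
      have fin: "finite ?J" by (simp add: pair_slots_finite)
      have J: "expectation (\<lambda>\<omega>. ?m p \<omega> * ?m q \<omega>) = expectation (monomial ?J ?\<eta>)"
        by (simp add: monomial_Plus[symmetric] pair_slots_finite)
      show "expectation (\<lambda>\<omega>. ?m (fst z) \<omega> * ?m (snd z) \<omega>) \<le> mom_bound (4 * k) * of_bool (z \<in> linked_pairs k k N)"
      proof (cases "covered ?J ?\<eta>")
        case True
        have "fst (pair_base k p) \<in> pair_verts k k p \<inter> pair_verts k k q"
          using pair_base_vert[OF pqE(1)] pair_base_vert[OF pqE(2)] pqE(3) by simp
        then have "z \<in> linked_pairs k k N" using True pqE by (auto simp: linked_pairs_def pq)
        moreover have "card ?J \<le> 4 * k"
          by (simp add: card_Plus pair_slots_finite pair_slots_card[OF pqE(1)] pair_slots_card[OF pqE(2)])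
        then have "expectation (monomial ?J ?\<eta>) \<le> mom_bound (4 * k)"
          using expectation_monomial_bound[OF fin, of "4 * k" ?\<eta>] by linarith
        ultimately show ?thesis by (simp add: pq J)
      next
        case False
        then show ?thesis using expectation_monomial_uncovered[OF fin False] mom_bound_nonneg
          by (simp add: pq J)
      qed
    qed
    also have "\<dots> = mom_bound (4 * k) * card (R \<inter> linked_pairs k k N)"
      using fR by (simp add: sum_distrib_left[symmetric] of_bool_def sum.If_cases Int_def)
    also have "\<dots> \<le> mom_bound (4 * k) * card (linked_pairs k k N)"
      by (intro mult_left_mono mom_bound_nonneg) (auto intro!: card_mono)
    also have "\<dots> \<le> mom_bound (4 * k) * (real N ^ (k + k - 1) * (real ((k + k - 1) ^ (2 * (k + k))) * real (k * k * (k * k))))"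
      by (intro mult_left_mono real_card_linked_pairs k mom_bound_nonneg)
    also have "\<dots> = real N ^ (k + k - 1) * fourth_const k"
      unfolding fourth_const_def by (simp only: mult_ac)
    finally show "(\<Sum>z\<in>R. expectation (\<lambda>\<omega>. ?m (fst z) \<omega> * ?m (snd z) \<omega>)) \<le> real N ^ (k + k - 1) * fourth_const k" .
  qed (use k in simp)
  finally show ?thesis .
qed

lemma cycle_sum_monomial: "cycle_sum k N (arr \<omega>) = (\<Sum>x\<in>cycles k N. monomial {..<k} (cyc_edge k x) \<omega>) / sqrt (real N) ^ k"
  by (simp add: cycle_sum_def monomial_def)

lemma expectation_cycle_sum:
  assumes "k \<ge> 1"
  shows "expectation (\<lambda>\<omega>. cycle_sum k N (arr \<omega>)) = 0"
proof -
  have i: "integrable M (monomial C \<epsilon>)" for C and \<epsilon> :: "nat \<Rightarrow> nat \<times> nat"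
    by (intro all_moments_integrable monomial_all_moments)
  have "\<not> covered {..<k} (cyc_edge k x)" if "x \<in> cycles k N" for x
    using inj_onD[OF cyc_edge_inj[OF that], of _ 0] assms unfolding covered_def by fastforce
  then have "expectation (monomial {..<k} (cyc_edge k x)) = 0" if "x \<in> cycles k N" for x
    using that expectation_monomial_uncovered[of "{..<k}" "cyc_edge k x"] by simp
  then show ?thesis
    unfolding cycle_sum_monomial by (simp add: Bochner_Integration.integral_sum i)
qed

lemma expectation_cycle_monomials:
  assumes x: "x \<in> cycles k N" and y: "y \<in> cycles l N"
  shows "expectation (\<lambda>\<omega>. monomial {..<k} (cyc_edge k x) \<omega> * monomial {..<l} (cyc_edge l y) \<omega>)
    = of_bool (cyc_edge k x ` {..<k} = cyc_edge l y ` {..<l})"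
proof -
  let ?J = "{..<k} <+> {..<l}" and ?\<eta> = "case_sum (cyc_edge k x) (cyc_edge l y)"
  have J: "expectation (\<lambda>\<omega>. monomial {..<k} (cyc_edge k x) \<omega> * monomial {..<l} (cyc_edge l y) \<omega>) = expectation (monomial ?J ?\<eta>)"
    by (simp add: monomial_Plus[symmetric])
  note ix = cyc_edge_inj[OF x] and iy = cyc_edge_inj[OF y]
  show ?thesis
  proof (cases "cyc_edge k x ` {..<k} = cyc_edge l y ` {..<l}")
    case True
    have "mom (mult_at ?J ?\<eta> e) = 1" if "e \<in> ?\<eta> ` ?J" for e
    proof -
      have "?\<eta> ` ?J = cyc_edge k x ` {..<k} \<union> cyc_edge l y ` {..<l}"
        by (auto simp: Plus_def image_Un image_image)
      then have "e \<in> cyc_edge k x ` {..<k}" "e \<in> cyc_edge l y ` {..<l}" using that True by auto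
      obtain i where i: "i < k" "cyc_edge k x i = e" using \<open>e \<in> cyc_edge k x ` {..<k}\<close> by auto
      obtain j where j: "j < l" "cyc_edge l y j = e" using \<open>e \<in> cyc_edge l y ` {..<l}\<close> by auto
      have "c = Inl i \<or> c = Inr j" if "c \<in> ?J" "?\<eta> c = e" for c
      proof (cases c)
        case (Inl a)
        then have "a = i" using that i by (intro inj_onD[OF ix]) auto
        then show ?thesis using Inl by simp
      next
        case (Inr a)
        then have "a = j" using that j by (intro inj_onD[OF iy]) auto
        then show ?thesis using Inr by simp
      qed
      then have "{c \<in> ?J. ?\<eta> c = e} = {Inl i, Inr j}" using i j by (intro equalityI subsetI) auto
      then show ?thesis by (simp add: mult_at_def numeral_2_eq_2[symmetric])
    qed
    then show ?thesis using True by (simp add: J expectation_monomial)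
  next
    case False
    have "\<not> covered ?J ?\<eta>"
    proof
      assume cov: "covered ?J ?\<eta>"
      have "cyc_edge k x i \<in> cyc_edge l y ` {..<l}" if i: "i < k" for i
      proof -
        obtain c where c: "c \<in> ?J" "c \<noteq> Inl i" "?\<eta> c = cyc_edge k x i"
          using i bspec[OF cov[unfolded covered_def], of "Inl i"] by auto
        show ?thesis
        proof (cases c)
          case (Inl a)
          then have "a = i" using c i by (intro inj_onD[OF ix]) auto
          then show ?thesis using Inl c by simp
        next
          case (Inr a)
          then show ?thesis using c by (intro image_eqI[of _ _ a]) auto
        qed
      qed
      moreover have "cyc_edge l y j \<in> cyc_edge k x ` {..<k}" if j: "j < l" for j
      proof -
        obtain c where c: "c \<in> ?J" "c \<noteq> Inr j" "?\<eta> c = cyc_edge l y j"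
          using j bspec[OF cov[unfolded covered_def], of "Inr j"] by auto
        show ?thesis
        proof (cases c)
          case (Inl a)
          then show ?thesis using c by (intro image_eqI[of _ _ a]) auto
        next
          case (Inr a)
          then have "a = j" using c j by (intro inj_onD[OF iy]) auto
          then show ?thesis using Inr c by simp
        qed
      qed
      ultimately show False using False by blast
    qed
    then show ?thesis using False expectation_monomial_uncovered[of ?J ?\<eta>] by (simp add: J)
  qed
qed

text \<open>Products of two cycles have expectation one if the cycles are rotations of each other and
zero otherwise, which gives the exact covariances.\<close>

lemma expectation_cycle_sum_mult:
  assumes k: "k \<ge> 1" and N: "N \<ge> 1"
  shows "expectation (\<lambda>\<omega>. cycle_sum k N (arr \<omega>) * cycle_sum l N (arr \<omega>))
     = (if k = l then real k * real (card (cycles k N)) / real N ^ k else 0)"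
proof -
  let ?m = "\<lambda>k x. monomial {..<k} (cyc_edge k x)"
  have i: "integrable M (\<lambda>\<omega>. ?m k x \<omega> * ?m l y \<omega>)" for x y
    by (auto intro!: all_moments_integrable all_moments_intros monomial_all_moments)
  have "(\<lambda>\<omega>. cycle_sum k N (arr \<omega>) * cycle_sum l N (arr \<omega>))
      = (\<lambda>\<omega>. (\<Sum>x\<in>cycles k N. \<Sum>y\<in>cycles l N. ?m k x \<omega> * ?m l y \<omega>) / sqrt (real N) ^ (k + l))"
    by (simp add: cycle_sum_monomial sum_product power_add)
  then have "expectation (\<lambda>\<omega>. cycle_sum k N (arr \<omega>) * cycle_sum l N (arr \<omega>))
      = (\<Sum>x\<in>cycles k N. \<Sum>y\<in>cycles l N. expectation (\<lambda>\<omega>. ?m k x \<omega> * ?m l y \<omega>)) / sqrt (real N) ^ (k + l)"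
    by (simp add: Bochner_Integration.integral_sum i)
  also have "\<dots> = (\<Sum>x\<in>cycles k N. \<Sum>y\<in>cycles l N. of_bool (cyc_edge k x ` {..<k} = cyc_edge l y ` {..<l})) / sqrt (real N) ^ (k + l)"
    by (intro arg_cong2[of _ _ _ _ "(/)"] sum.cong refl expectation_cycle_monomials)
  also have "\<dots> = (if k = l then real k * real (card (cycles k N)) / real N ^ k else 0)"
  proof (cases "k = l")
    case True
    have "(\<Sum>y\<in>cycles k N. of_bool (cyc_edge k x ` {..<k} = cyc_edge k y ` {..<k})) = real k" if "x \<in> cycles k N" for x
    proof -
      have "(\<Sum>y\<in>cycles k N. of_bool (cyc_edge k x ` {..<k} = cyc_edge k y ` {..<k}))
          = real (card {y \<in> cycles k N. cyc_edge k y ` {..<k} = cyc_edge k x ` {..<k}})"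
        by (simp add: of_bool_def sum.If_cases Int_def eq_commute)
      then show ?thesis using card_cycles_same_edges[OF that k] by simp
    qed
    then show ?thesis using True sqrt_power_even[of N k, unfolded mult_2] by simp
  next
    case False
    have "cyc_edge k x ` {..<k} \<noteq> cyc_edge l y ` {..<l}" if "x \<in> cycles k N" "y \<in> cycles l N" for x y
    proof -
      have "card (cyc_edge k x ` {..<k}) = k" "card (cyc_edge l y ` {..<l}) = l"
        using that cyc_edge_inj by (auto simp: card_image)
      then show ?thesis using False by metis
    qed
    then show ?thesis using False by simp
  qed
  finally show ?thesis .
qed

lemma expectation_cycle_sum_square:
  assumes k: "k \<ge> 1" and N: "N \<ge> 1"
  shows "expectation (\<lambda>\<omega>. (cycle_sum k N (arr \<omega>))\<^sup>2) \<le> real k"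
    and "real k - real k * real ((k - 1) ^ k) / real N \<le> expectation (\<lambda>\<omega>. (cycle_sum k N (arr \<omega>))\<^sup>2)"
proof -
  have c: "real (card (cycles k N)) + real (card (degenerate k N)) = real N ^ k"
    using arg_cong[OF card_cycles_degenerate[of k N], of real] by simp
  have eq: "expectation (\<lambda>\<omega>. (cycle_sum k N (arr \<omega>))\<^sup>2) = real k * (real (card (cycles k N)) / real N ^ k)"
    using expectation_cycle_sum_mult[OF k N, of k] by (simp add: power2_eq_square)
  have "real (card (cycles k N)) \<le> real N ^ k"
    using c of_nat_0_le_iff[of "card (degenerate k N)"] by linarith
  then have "real (card (cycles k N)) / real N ^ k \<le> 1"
    using N by (subst divide_le_eq_1_pos) auto
  then show "expectation (\<lambda>\<omega>. (cycle_sum k N (arr \<omega>))\<^sup>2) \<le> real k"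
    unfolding eq using mult_left_mono[of "real (card (cycles k N)) / real N ^ k" 1 "real k"] by simp
  have "real (card (degenerate k N)) \<le> real (N ^ (k - 1) * (k - 1) ^ k)"
    using card_degenerate[OF k, of N] by (rule of_nat_mono)
  then have "real (card (degenerate k N)) / real N ^ k \<le> real ((k - 1) ^ k) / real N"
    by (intro power_ratio_le[OF N k]) simp
  moreover have "real (card (cycles k N)) / real N ^ k = 1 - real (card (degenerate k N)) / real N ^ k"
    using c N by (simp add: field_simps)
  ultimately have "1 - real ((k - 1) ^ k) / real N \<le> real (card (cycles k N)) / real N ^ k" by simp
  from mult_left_mono[OF this, of "real k"]
  show "real k - real k * real ((k - 1) ^ k) / real N \<le> expectation (\<lambda>\<omega>. (cycle_sum k N (arr \<omega>))\<^sup>2)"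
    unfolding eq by (simp add: algebra_simps)
qed

text \<open>Both sides are the expectation of the sum over \<open>e\<close> of \<open>A e\<close> times the derivative of the first cycle sum times the
second cycle sum.\<close>

lemma expectation_gamma:
  "expectation (gamma k l N) = real k * expectation (\<lambda>\<omega>. cycle_sum k N (arr \<omega>) * cycle_sum l N (arr \<omega>))"
proof -
  let ?E = "{..<N} \<times> {..<N}"
  let ?d = "\<lambda>k e \<omega>. cycle_sum_deriv k N e (arr \<omega>)"
  let ?R = "\<lambda>l e \<omega>. cycle_sum l N ((arr \<omega>)(e := 0))"
  have am: "all_moments (\<lambda>\<omega>. ?d k e \<omega>)" "all_moments (\<lambda>\<omega>. cycle_sum k N (arr \<omega>))" "all_moments (\<lambda>\<omega>. ?R l e \<omega>)" for k l e
    by (intro all_moments_cycle_sum_deriv all_moments_cycle_sum A_all_moments all_moments_update)+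
  have split: "cycle_sum l N (arr \<omega>) = ?R l e \<omega> + A e \<omega> * ?d l e \<omega>" for l e \<omega>
    using cycle_sum_update[of l N "arr \<omega>" e "A e \<omega>"] by (simp add: fun_upd_idem)
  have step: "expectation (\<lambda>\<omega>. A e \<omega> * ?d k e \<omega> * cycle_sum l N (arr \<omega>)) = expectation (\<lambda>\<omega>. ?d k e \<omega> * ?d l e \<omega>)" for e
  proof -
    have d0: "?d k e \<omega> = cycle_sum_deriv k N e ((arr \<omega>)(e := 0))" for k \<omega>
      by (simp add: cycle_sum_deriv_update)
    have 1: "expectation (\<lambda>\<omega>. A e \<omega> * (cycle_sum_deriv k N e ((arr \<omega>)(e := 0)) * cycle_sum l N ((arr \<omega>)(e := 0))))
       = expectation (A e) * expectation (\<lambda>\<omega>. cycle_sum_deriv k N e ((arr \<omega>)(e := 0)) * cycle_sum l N ((arr \<omega>)(e := 0)))"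
      by (rule resample[where f = "\<lambda>x. x" and H = "\<lambda>r. cycle_sum_deriv k N e r * cycle_sum l N r"])
        (auto intro!: borel_measurable_times cycle_sum_deriv_measurable cycle_sum_measurable measurable_update
           all_moments_integrable all_moments_mult all_moments_cycle_sum_deriv all_moments_cycle_sum all_moments_update A_all_moments simp del: fun_upd_apply)
    have 2: "expectation (\<lambda>\<omega>. (A e \<omega>)\<^sup>2 * (cycle_sum_deriv k N e ((arr \<omega>)(e := 0)) * cycle_sum_deriv l N e ((arr \<omega>)(e := 0))))
       = expectation (\<lambda>\<omega>. (A e \<omega>)\<^sup>2) * expectation (\<lambda>\<omega>. cycle_sum_deriv k N e ((arr \<omega>)(e := 0)) * cycle_sum_deriv l N e ((arr \<omega>)(e := 0)))"
      by (rule resample[where f = "\<lambda>x. x\<^sup>2" and H = "\<lambda>r. cycle_sum_deriv k N e r * cycle_sum_deriv l N e r"])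
        (auto intro!: borel_measurable_times cycle_sum_deriv_measurable measurable_update all_moments_power
           all_moments_integrable all_moments_mult all_moments_cycle_sum_deriv all_moments_update A_all_moments simp del: fun_upd_apply)
    have "expectation (\<lambda>\<omega>. A e \<omega> * ?d k e \<omega> * cycle_sum l N (arr \<omega>))
        = expectation (\<lambda>\<omega>. A e \<omega> * (?d k e \<omega> * ?R l e \<omega>) + (A e \<omega>)\<^sup>2 * (?d k e \<omega> * ?d l e \<omega>))"
      by (simp add: split[of l _ e] algebra_simps power2_eq_square)
    also have "\<dots> = expectation (\<lambda>\<omega>. A e \<omega> * (?d k e \<omega> * ?R l e \<omega>)) + expectation (\<lambda>\<omega>. (A e \<omega>)\<^sup>2 * (?d k e \<omega> * ?d l e \<omega>))"
      by (intro Bochner_Integration.integral_add all_moments_integrable all_moments_mult all_moments_power am A_all_moments)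
    also have "\<dots> = expectation (\<lambda>\<omega>. ?d k e \<omega> * ?d l e \<omega>)"
      using 1 2 by (simp add: expectation_A expectation_A_square cycle_sum_deriv_update)
    finally show ?thesis .
  qed
  have "real k * expectation (\<lambda>\<omega>. cycle_sum k N (arr \<omega>) * cycle_sum l N (arr \<omega>))
      = expectation (\<lambda>\<omega>. (\<Sum>e\<in>?E. A e \<omega> * ?d k e \<omega>) * cycle_sum l N (arr \<omega>))"
    by (simp add: cycle_sum_euler mult.assoc)
  also have "\<dots> = (\<Sum>e\<in>?E. expectation (\<lambda>\<omega>. A e \<omega> * ?d k e \<omega> * cycle_sum l N (arr \<omega>)))"
    unfolding sum_distrib_right
    by (intro Bochner_Integration.integral_sum all_moments_integrable all_moments_mult am A_all_moments)
  also have "\<dots> = (\<Sum>e\<in>?E. expectation (\<lambda>\<omega>. ?d k e \<omega> * ?d l e \<omega>))" by (simp only: step)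
  also have "\<dots> = expectation (gamma k l N)"
    unfolding gamma_def
    by (intro Bochner_Integration.integral_sum[symmetric] all_moments_integrable all_moments_mult am)
  finally show ?thesis ..
qed

end

section \<open>The approximate Stein identity for cycle sums\<close>

text \<open>The vector of cycle sums, divided by their limiting standard deviations, and its derivative in the
entry \<open>e\<close>.\<close>

definition cycle_vec :: "('m::finite \<Rightarrow> nat) \<Rightarrow> nat \<Rightarrow> (nat \<times> nat \<Rightarrow> real) \<Rightarrow> real^'m" where
  "cycle_vec k N a = (\<chi> b. cycle_sum (k b) N a / sqrt (real (k b)))"

definition cycle_vec_deriv :: "('m::finite \<Rightarrow> nat) \<Rightarrow> nat \<Rightarrow> nat \<times> nat \<Rightarrow> (nat \<times> nat \<Rightarrow> real) \<Rightarrow> real^'m" where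
  "cycle_vec_deriv k N e a = (\<chi> b. cycle_sum_deriv (k b) N e a / sqrt (real (k b)))"

lemma cycle_vec_update:
  "cycle_vec k N a = cycle_vec k N (a(e := 0)) + a e *\<^sub>R cycle_vec_deriv k N e a"
proof -
  have "cycle_sum l N a = cycle_sum l N (a(e := 0)) + a e * cycle_sum_deriv l N e a" for l
    using cycle_sum_update[of l N a e "a e"] by simp
  then show ?thesis
    by (simp add: Finite_Cartesian_Product.vec_eq_iff cycle_vec_def cycle_vec_deriv_def add_divide_distrib)
qed

lemma cycle_vec_deriv_update: "cycle_vec_deriv k N e (a(e := t)) = cycle_vec_deriv k N e a"
  by (simp add: cycle_vec_deriv_def cycle_sum_deriv_update)

lemma cycle_vec_measurable [measurable (raw)]:
  "(\<And>e. (\<lambda>r. f r e) \<in> borel_measurable M) \<Longrightarrow> (\<lambda>r. cycle_vec k N (f r)) \<in> borel_measurable M"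
  unfolding cycle_vec_def
  by (intro measurable_vec_lambda borel_measurable_divide cycle_sum_measurable borel_measurable_const) auto

lemma cycle_vec_deriv_measurable [measurable (raw)]:
  "(\<And>e. (\<lambda>r. f r e) \<in> borel_measurable M) \<Longrightarrow> (\<lambda>r. cycle_vec_deriv k N e (f r)) \<in> borel_measurable M"
  unfolding cycle_vec_deriv_def
  by (intro measurable_vec_lambda borel_measurable_divide cycle_sum_deriv_measurable borel_measurable_const) auto

context prob_space
begin

lemma all_moments_vec_nth: "(\<And>b. all_moments (\<lambda>\<omega>. f \<omega> $ b)) \<Longrightarrow> all_moments (\<lambda>\<omega>. norm (f \<omega> :: real^'m))"
proof -
  assume f: "\<And>b. all_moments (\<lambda>\<omega>. f \<omega> $ b)"
  have "(\<lambda>\<omega>. \<chi> b. f \<omega> $ b) \<in> borel_measurable M"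
    by (rule measurable_vec_lambda) (rule all_moments_measurable[OF f])
  then have [measurable]: "f \<in> borel_measurable M" by simp
  show ?thesis
  proof (rule all_moments_dominated)
    show "all_moments (\<lambda>\<omega>. \<Sum>b\<in>UNIV. \<bar>f \<omega> $ b\<bar>)" by (intro all_moments_sum all_moments_abs f)
    show "\<bar>norm (f \<omega>)\<bar> \<le> (\<Sum>b\<in>UNIV. \<bar>f \<omega> $ b\<bar>)" for \<omega> by (simp add: norm_le_l1_cart)
  qed measurable
qed

lemma all_moments_C1:
  assumes g: "C1_with L g g'" and f: "\<And>b. all_moments (\<lambda>\<omega>. f \<omega> $ b)"
  shows "all_moments (\<lambda>\<omega>. g (f \<omega> :: real^'m))" and "all_moments (\<lambda>\<omega>. g' b (f \<omega>))"
proof -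
  have "(\<lambda>\<omega>. \<chi> b. f \<omega> $ b) \<in> borel_measurable M"
    by (rule measurable_vec_lambda) (rule all_moments_measurable[OF f])
  then have [measurable]: "f \<in> borel_measurable M" by simp
  have [measurable]: "g \<in> borel_measurable borel" "g' b \<in> borel_measurable borel" for b
    using C1_with_continuous[OF g] by (auto intro: continuous_imp_measurable)
  show "all_moments (\<lambda>\<omega>. g (f \<omega>))"
  proof (rule all_moments_dominated)
    show "all_moments (\<lambda>\<omega>. \<bar>g 0\<bar> + L * real CARD('m) * norm (f \<omega>))"
      by (intro all_moments_add all_moments_const all_moments_mult all_moments_vec_nth f)
    fix \<omega>
    have "\<bar>g (f \<omega>) - g 0\<bar> \<le> L * real CARD('m) * norm (f \<omega> - 0)"
      by (rule lipschitz_partials_norm[of g g']) (use g in \<open>auto simp: C1_with_def\<close>)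
    then show "\<bar>g (f \<omega>)\<bar> \<le> \<bar>g 0\<bar> + L * real CARD('m) * norm (f \<omega>)" by simp
  qed measurable
  show "all_moments (\<lambda>\<omega>. g' b (f \<omega>))"
    by (rule all_moments_dominated[OF all_moments_const[of L]]) (use g in \<open>auto simp: C1_with_def\<close>)
qed

end

text \<open>Taylor expansion in one entry \<open>x\<close>, where \<open>v0\<close> and \<open>d\<close> do not depend on \<open>x\<close>: by centring and unit
variance, the subtracted bracket in the second line has expectation zero.\<close>

lemma edge_remainder:
  fixes v v0 d :: "real^'m"
  assumes g: "C1_with L g g'" and v: "v = v0 + x *\<^sub>R d"
  shows "\<bar>x * d $ a * g v - (\<Sum>b\<in>UNIV. d $ a * d $ b * g' b v)
      - (x * (d $ a * g v0) + (\<Sum>b\<in>UNIV. x\<^sup>2 * (d $ a * d $ b * g' b v0) - d $ a * d $ b * g' b v0))\<bar>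
    \<le> L * real CARD('m) * ((\<bar>x\<bar> ^ 3 + \<bar>x\<bar>) * norm d ^ 3)"
proof -
  let ?n = "real CARD('m)"
  have L: "L \<ge> 0" by (rule C1_with_nonneg[OF g])
  define \<rho> where "\<rho> = g v - g v0 - (\<Sum>b\<in>UNIV. g' b v0 * (v - v0) $ b)"
  have "\<bar>\<rho>\<bar> \<le> L * norm (v - v0) * (\<Sum>b\<in>UNIV. \<bar>(v - v0) $ b\<bar>)"
    unfolding \<rho>_def by (rule taylor_partials) (use g L in \<open>auto simp: C1_with_def\<close>)
  also have "\<dots> \<le> L * norm (v - v0) * (?n * norm (v - v0))"
    using L by (intro mult_left_mono sum_abs_component_le) auto
  also have "\<dots> = L * ?n * (\<bar>x\<bar>\<^sup>2 * (norm d)\<^sup>2)" by (simp add: v power2_eq_square)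
  finally have \<rho>: "\<bar>\<rho>\<bar> \<le> L * ?n * (\<bar>x\<bar>\<^sup>2 * (norm d)\<^sup>2)" .
  have da: "\<bar>d $ b\<bar> \<le> norm d" for b by (rule component_le_norm_cart)
  have "x * d $ a * g v - (\<Sum>b\<in>UNIV. d $ a * d $ b * g' b v)
      - (x * (d $ a * g v0) + (\<Sum>b\<in>UNIV. x\<^sup>2 * (d $ a * d $ b * g' b v0) - d $ a * d $ b * g' b v0))
    = x * d $ a * \<rho> + (\<Sum>b\<in>UNIV. d $ a * d $ b * (g' b v0 - g' b v))"
    by (simp add: \<rho>_def v algebra_simps sum_distrib_left sum_subtractf power2_eq_square)
  also have "\<bar>\<dots>\<bar> \<le> \<bar>x * d $ a * \<rho>\<bar> + (\<Sum>b\<in>UNIV. \<bar>d $ a * d $ b * (g' b v0 - g' b v)\<bar>)"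
    by (rule order.trans[OF abs_triangle_ineq add_mono[OF order.refl sum_abs]])
  also have "\<dots> \<le> \<bar>x\<bar> * norm d * (L * ?n * (\<bar>x\<bar>\<^sup>2 * (norm d)\<^sup>2)) + (\<Sum>b\<in>(UNIV :: 'm set). norm d * norm d * (L * (\<bar>x\<bar> * norm d)))"
  proof (intro add_mono sum_mono)
    show "\<bar>x * d $ a * \<rho>\<bar> \<le> \<bar>x\<bar> * norm d * (L * ?n * (\<bar>x\<bar>\<^sup>2 * (norm d)\<^sup>2))"
      unfolding abs_mult using da \<rho> by (intro mult_mono) auto
    fix b
    have "\<bar>g' b v0 - g' b v\<bar> \<le> L * norm (v0 - v)" using g unfolding C1_with_def by blast
    then have "\<bar>g' b v0 - g' b v\<bar> \<le> L * (\<bar>x\<bar> * norm d)" by (simp add: v)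
    then show "\<bar>d $ a * d $ b * (g' b v0 - g' b v)\<bar> \<le> norm d * norm d * (L * (\<bar>x\<bar> * norm d))"
      unfolding abs_mult using da by (intro mult_mono) auto
  qed
  also have "\<dots> = L * ?n * ((\<bar>x\<bar> ^ 3 + \<bar>x\<bar>) * norm d ^ 3)"
    by (simp add: power3_eq_cube power2_eq_square algebra_simps)
  finally show ?thesis .
qed

lemma cube_le_square_fourth:
  assumes "(x :: real) \<ge> 0" "s > 0"
  shows "x ^ 3 \<le> s * x\<^sup>2 + x ^ 4 / s"
proof -
  have "0 \<le> s * x" using assms by simp
  then have "s * x \<le> s\<^sup>2 + x\<^sup>2" using sum_squares_bound[of s x] by linarith
  then have "x\<^sup>2 * (s * x) \<le> x\<^sup>2 * (s\<^sup>2 + x\<^sup>2)" by (intro mult_left_mono) auto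
  also have "x\<^sup>2 * (s\<^sup>2 + x\<^sup>2) = (s * x\<^sup>2 + x ^ 4 / s) * s"
    using assms by (simp add: field_simps power2_eq_square power4_eq_xxxx)
  also have "x\<^sup>2 * (s * x) = x ^ 3 * s" by (simp add: power2_eq_square power3_eq_cube)
  finally show ?thesis using assms by simp
qed

lemma norm_fourth_le: "norm (d :: real^'m) ^ 4 \<le> real CARD('m) * (\<Sum>b\<in>UNIV. (d $ b) ^ 4)"
proof -
  have "norm d ^ 4 = ((norm d)\<^sup>2)\<^sup>2" by simp
  also have "(norm d)\<^sup>2 = (\<Sum>b\<in>UNIV. (d $ b)\<^sup>2)" by (simp add: norm_vec_def L2_set_def sum_nonneg)
  also have "\<dots>\<^sup>2 \<le> real CARD('m) * (\<Sum>b\<in>UNIV. ((d $ b)\<^sup>2)\<^sup>2)"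
    using sum_squared_le_sum_of_squares[of "\<lambda>b. (d $ b)\<^sup>2" UNIV] by (simp add: mult.commute)
  finally show ?thesis by simp
qed

context iid_array
begin

definition abs_mom :: "nat \<Rightarrow> real" where "abs_mom n = (\<integral>x. \<bar>x\<bar> ^ n \<partial>D)"

lemma abs_mom_eq: "expectation (\<lambda>\<omega>. \<bar>A e \<omega>\<bar> ^ n) = abs_mom n"
proof -
  have "abs_mom n = (\<integral>x. \<bar>x\<bar> ^ n \<partial>distr M borel (A e))" by (simp add: abs_mom_def A_distr)
  also have "\<dots> = expectation (\<lambda>\<omega>. \<bar>A e \<omega>\<bar> ^ n)" by (subst integral_distr) auto
  finally show ?thesis ..
qed

lemma abs_mom_nonneg: "abs_mom n \<ge> 0"
  unfolding abs_mom_def by (rule Bochner_Integration.integral_nonneg) auto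

lemma all_moments_cycle_vec:
  "(\<And>e. all_moments (\<lambda>\<omega>. f \<omega> e)) \<Longrightarrow> all_moments (\<lambda>\<omega>. cycle_vec k N (f \<omega>) $ b)"
  unfolding cycle_vec_def by (simp add: all_moments_divide all_moments_cycle_sum)

lemma all_moments_cycle_vec_deriv:
  "(\<And>e. all_moments (\<lambda>\<omega>. f \<omega> e)) \<Longrightarrow> all_moments (\<lambda>\<omega>. cycle_vec_deriv k N d (f \<omega>) $ b)"
  unfolding cycle_vec_deriv_def by (simp add: all_moments_divide all_moments_cycle_sum_deriv)

lemma stein_edge:
  fixes k :: "'m::finite \<Rightarrow> nat" and N :: nat and e :: "nat \<times> nat"
  assumes g: "C1_with L g g'"
  defines "V \<equiv> \<lambda>\<omega>. cycle_vec k N (arr \<omega>)" and "d \<equiv> \<lambda>\<omega>. cycle_vec_deriv k N e (arr \<omega>)"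
  shows "\<bar>expectation (\<lambda>\<omega>. A e \<omega> * d \<omega> $ a * g (V \<omega>)) - expectation (\<lambda>\<omega>. \<Sum>b\<in>UNIV. d \<omega> $ a * d \<omega> $ b * g' b (V \<omega>))\<bar>
    \<le> L * real CARD('m) * ((abs_mom 3 + abs_mom 1) * expectation (\<lambda>\<omega>. norm (d \<omega>) ^ 3))"
proof -
  define V0 where "V0 = (\<lambda>\<omega>. cycle_vec k N ((arr \<omega>)(e := 0)))"
  have V0: "V0 \<omega> = cycle_vec k N ((arr \<omega>)(e := 0))" for \<omega>
    by (simp add: V0_def)
  have d0: "d \<omega> = cycle_vec_deriv k N e ((arr \<omega>)(e := 0))" for \<omega>
    by (simp add: d_def cycle_vec_deriv_update)
  have V: "V \<omega> = V0 \<omega> + A e \<omega> *\<^sub>R d \<omega>" for \<omega>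
    unfolding V_def V0_def d_def by (rule cycle_vec_update)
  have amV: "all_moments (\<lambda>\<omega>. V \<omega> $ b)" "all_moments (\<lambda>\<omega>. V0 \<omega> $ b)" "all_moments (\<lambda>\<omega>. d \<omega> $ b)" for b
    unfolding V_def V0_def d_def
    by (intro all_moments_cycle_vec all_moments_cycle_vec_deriv A_all_moments all_moments_update)+
  note am = amV all_moments_C1[OF g amV(1)] all_moments_C1[OF g amV(2)] all_moments_vec_nth[of d, OF amV(3)] A_all_moments
  note intros = all_moments_integrable all_moments_mult all_moments_sum all_moments_power all_moments_diff all_moments_add all_moments_abs am
  have [measurable]: "g \<in> borel_measurable borel" "g' b \<in> borel_measurable borel" for b
    using C1_with_continuous[OF g] by (auto intro: continuous_imp_measurable)
  have upd [measurable]: "(\<lambda>r. (r(e := 0)) c) \<in> borel_measurable (Pi\<^sub>M (- {e}) (\<lambda>_. borel :: real measure))" for c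
    by (rule measurable_update)
  have Vm [measurable]: "(\<lambda>r. cycle_vec k N (r(e := 0))) \<in> borel_measurable (Pi\<^sub>M (- {e}) (\<lambda>_. borel))"
       "(\<lambda>r. cycle_vec_deriv k N e (r(e := 0))) \<in> borel_measurable (Pi\<^sub>M (- {e}) (\<lambda>_. borel))"
    by (rule cycle_vec_measurable cycle_vec_deriv_measurable, rule upd)+
  have 1: "expectation (\<lambda>\<omega>. A e \<omega> * (d \<omega> $ a * g (V0 \<omega>))) = 0"
  proof -
    have "expectation (\<lambda>\<omega>. A e \<omega> * (d \<omega> $ a * g (V0 \<omega>))) = expectation (\<lambda>\<omega>. A e \<omega>) * expectation (\<lambda>\<omega>. d \<omega> $ a * g (V0 \<omega>))"
      unfolding d0 V0
      by (rule resample[where f = "\<lambda>x. x" and H = "\<lambda>r. cycle_vec_deriv k N e r $ a * g (cycle_vec k N r)"], unfold d0[symmetric] V0[symmetric])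
        (measurable, auto intro!: intros)
    then show ?thesis by (simp add: expectation_A)
  qed
  have 2: "expectation (\<lambda>\<omega>. (A e \<omega>)\<^sup>2 * (d \<omega> $ a * d \<omega> $ b * g' b (V0 \<omega>))) = expectation (\<lambda>\<omega>. d \<omega> $ a * d \<omega> $ b * g' b (V0 \<omega>))" for b
  proof -
    have "expectation (\<lambda>\<omega>. (A e \<omega>)\<^sup>2 * (d \<omega> $ a * d \<omega> $ b * g' b (V0 \<omega>)))
        = expectation (\<lambda>\<omega>. (A e \<omega>)\<^sup>2) * expectation (\<lambda>\<omega>. d \<omega> $ a * d \<omega> $ b * g' b (V0 \<omega>))"
      unfolding d0 V0
      by (rule resample[where f = "\<lambda>x. x\<^sup>2" and H = "\<lambda>r. cycle_vec_deriv k N e r $ a * cycle_vec_deriv k N e r $ b * g' b (cycle_vec k N r)"], unfold d0[symmetric] V0[symmetric])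
        (measurable, auto intro!: intros)
    then show ?thesis by (simp add: expectation_A_square)
  qed
  have 3: "expectation (\<lambda>\<omega>. (\<bar>A e \<omega>\<bar> ^ 3 + \<bar>A e \<omega>\<bar>) * norm (d \<omega>) ^ 3) = (abs_mom 3 + abs_mom 1) * expectation (\<lambda>\<omega>. norm (d \<omega>) ^ 3)"
  proof -
    have "expectation (\<lambda>\<omega>. (\<bar>A e \<omega>\<bar> ^ 3 + \<bar>A e \<omega>\<bar>) * norm (d \<omega>) ^ 3)
        = expectation (\<lambda>\<omega>. \<bar>A e \<omega>\<bar> ^ 3 + \<bar>A e \<omega>\<bar>) * expectation (\<lambda>\<omega>. norm (d \<omega>) ^ 3)"
      unfolding d0
      by (rule resample[where f = "\<lambda>x. \<bar>x\<bar> ^ 3 + \<bar>x\<bar>" and H = "\<lambda>r. norm (cycle_vec_deriv k N e r) ^ 3"], unfold d0[symmetric])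
        (measurable, auto intro!: intros)
    also have "expectation (\<lambda>\<omega>. \<bar>A e \<omega>\<bar> ^ 3 + \<bar>A e \<omega>\<bar>) = abs_mom 3 + abs_mom 1"
      using abs_mom_eq[of e 3] abs_mom_eq[of e 1]
      by (subst Bochner_Integration.integral_add) (auto intro!: intros)
    finally show ?thesis .
  qed
  let ?F1 = "\<lambda>\<omega>. A e \<omega> * d \<omega> $ a * g (V \<omega>)" and ?F2 = "\<lambda>\<omega>. \<Sum>b\<in>UNIV. d \<omega> $ a * d \<omega> $ b * g' b (V \<omega>)"
  let ?G1 = "\<lambda>\<omega>. A e \<omega> * (d \<omega> $ a * g (V0 \<omega>))"
  let ?G2 = "\<lambda>\<omega>. \<Sum>b\<in>UNIV. (A e \<omega>)\<^sup>2 * (d \<omega> $ a * d \<omega> $ b * g' b (V0 \<omega>)) - d \<omega> $ a * d \<omega> $ b * g' b (V0 \<omega>)"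
  have iF: "integrable M ?F1" "integrable M ?F2" "integrable M ?G1" "integrable M ?G2"
    by (auto intro!: intros)
  have G2: "expectation ?G2 = 0"
  proof -
    have "expectation ?G2 = (\<Sum>b\<in>UNIV. expectation (\<lambda>\<omega>. (A e \<omega>)\<^sup>2 * (d \<omega> $ a * d \<omega> $ b * g' b (V0 \<omega>)) - d \<omega> $ a * d \<omega> $ b * g' b (V0 \<omega>)))"
      by (intro Bochner_Integration.integral_sum) (auto intro!: intros)
    also have "\<dots> = (\<Sum>b\<in>UNIV. expectation (\<lambda>\<omega>. (A e \<omega>)\<^sup>2 * (d \<omega> $ a * d \<omega> $ b * g' b (V0 \<omega>))) - expectation (\<lambda>\<omega>. d \<omega> $ a * d \<omega> $ b * g' b (V0 \<omega>)))"
      by (intro sum.cong refl Bochner_Integration.integral_diff) (auto intro!: intros)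
    also have "\<dots> = 0" using 2 by simp
    finally show ?thesis .
  qed
  define R where "R = (\<lambda>\<omega>. ?F1 \<omega> - ?F2 \<omega> - (?G1 \<omega> + ?G2 \<omega>))"
  define S where "S = (\<lambda>\<omega>. (\<bar>A e \<omega>\<bar> ^ 3 + \<bar>A e \<omega>\<bar>) * norm (d \<omega>) ^ 3)"
  have iR: "integrable M R" unfolding R_def by (intro Bochner_Integration.integrable_diff Bochner_Integration.integrable_add iF)
  have iS: "integrable M S" unfolding S_def by (auto intro!: intros)
  have R: "expectation R = expectation ?F1 - expectation ?F2"
  proof -
    have "expectation R = expectation ?F1 - expectation ?F2 - (expectation ?G1 + expectation ?G2)"
      unfolding R_def by (simp only: iF Bochner_Integration.integral_diff Bochner_Integration.integral_add
        Bochner_Integration.integrable_diff Bochner_Integration.integrable_add)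
    then show ?thesis unfolding 1 G2 by simp
  qed
  have "\<bar>R \<omega>\<bar> \<le> L * real CARD('m) * S \<omega>" for \<omega>
    unfolding R_def S_def by (rule edge_remainder[OF g V])
  then have "expectation (\<lambda>\<omega>. \<bar>R \<omega>\<bar>) \<le> expectation (\<lambda>\<omega>. L * real CARD('m) * S \<omega>)"
    using iR iS by (intro integral_mono) auto
  then have "expectation (\<lambda>\<omega>. \<bar>R \<omega>\<bar>) \<le> L * real CARD('m) * expectation S" by simp
  then have "\<bar>expectation R\<bar> \<le> L * real CARD('m) * expectation S"
    using integral_abs_bound[of M R] by linarith
  then show ?thesis unfolding R 3[folded S_def] .
qed

definition stein_const :: "('m::finite \<Rightarrow> nat) \<Rightarrow> real" where
  "stein_const k = real CARD('m) * ((abs_mom 3 + abs_mom 1)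
       * ((\<Sum>b\<in>UNIV. (real (k b))\<^sup>2) + real CARD('m) * (\<Sum>b\<in>UNIV. fourth_const (k b))))
     + (\<Sum>a\<in>UNIV. \<Sum>b\<in>UNIV. sqrt (gamma_const (k a) (k b) + (real (k a) * (real (k a) * real ((k a - 1) ^ k a)))\<^sup>2))"

lemma fourth_const_nonneg: "fourth_const k \<ge> 0"
  unfolding fourth_const_def using mom_bound_nonneg by (intro mult_nonneg_nonneg) auto

lemma gamma_const_nonneg: "gamma_const k l \<ge> 0"
  unfolding gamma_const_def using mom_bound_nonneg by (intro mult_nonneg_nonneg add_nonneg_nonneg) auto

text \<open>The cubes are interpolated between the squares, whose sum has bounded expectation, and the fourth
powers, whose sum is of order \<open>1/N\<close>; the weight \<open>s = 1/sqrt N\<close> balances the two.\<close>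

lemma sum_norm_deriv_cube:
  fixes k :: "'m::finite \<Rightarrow> nat"
  assumes k: "\<And>b. k b \<ge> 1" and N: "N \<ge> 1"
  shows "(\<Sum>e\<in>{..<N} \<times> {..<N}. expectation (\<lambda>\<omega>. norm (cycle_vec_deriv k N e (arr \<omega>)) ^ 3))
    \<le> ((\<Sum>b\<in>UNIV. (real (k b))\<^sup>2) + real CARD('m) * (\<Sum>b\<in>UNIV. fourth_const (k b))) / sqrt (real N)"
proof -
  let ?E = "{..<N} \<times> {..<N}" and ?n = "real CARD('m)"
  let ?d = "\<lambda>e \<omega>. cycle_vec_deriv k N e (arr \<omega>)" and ?D = "\<lambda>b e \<omega>. cycle_sum_deriv (k b) N e (arr \<omega>)"
  define s where "s = 1 / sqrt (real N)"
  have s: "s > 0" using N by (simp add: s_def)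
  have am: "all_moments (\<lambda>\<omega>. ?D b e \<omega>)" "all_moments (\<lambda>\<omega>. norm (?d e \<omega>))" for b e
    by (intro all_moments_vec_nth all_moments_cycle_vec_deriv all_moments_cycle_sum_deriv A_all_moments)+
  note intros = all_moments_integrable all_moments_mult all_moments_sum all_moments_power all_moments_add all_moments_divide all_moments_const am
  have pt: "norm (?d e \<omega>) ^ 3 \<le> s * (\<Sum>b\<in>UNIV. (?D b e \<omega>)\<^sup>2) + ?n / s * (\<Sum>b\<in>UNIV. (?D b e \<omega>) ^ 4)" for e \<omega>
  proof -
    have comp: "\<bar>?d e \<omega> $ b\<bar> \<le> \<bar>?D b e \<omega>\<bar>" for b
      using k[of b] by (simp add: cycle_vec_deriv_def divide_le_eq mult_le_cancel_left1)
    have "norm (?d e \<omega>) ^ 3 \<le> s * (norm (?d e \<omega>))\<^sup>2 + norm (?d e \<omega>) ^ 4 / s"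
      by (rule cube_le_square_fourth) (use s in auto)
    also have "\<dots> \<le> s * (\<Sum>b\<in>UNIV. (?D b e \<omega>)\<^sup>2) + (?n * (\<Sum>b\<in>UNIV. (?D b e \<omega>) ^ 4)) / s"
    proof (intro add_mono mult_left_mono divide_right_mono)
      have "(norm (?d e \<omega>))\<^sup>2 = (\<Sum>b\<in>UNIV. (?d e \<omega> $ b)\<^sup>2)" by (simp add: norm_vec_def L2_set_def sum_nonneg)
      also have "\<dots> \<le> (\<Sum>b\<in>UNIV. (?D b e \<omega>)\<^sup>2)" by (intro sum_mono) (simp add: abs_le_square_iff[symmetric] comp)
      finally show "(norm (?d e \<omega>))\<^sup>2 \<le> (\<Sum>b\<in>UNIV. (?D b e \<omega>)\<^sup>2)" .
      have "(?d e \<omega> $ b) ^ 4 \<le> (?D b e \<omega>) ^ 4" for b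
        using power_mono[OF comp[of b], of 4] by simp
      then have "?n * (\<Sum>b\<in>UNIV. (?d e \<omega> $ b) ^ 4) \<le> ?n * (\<Sum>b\<in>UNIV. (?D b e \<omega>) ^ 4)"
        by (intro mult_left_mono sum_mono) auto
      then show "norm (?d e \<omega>) ^ 4 \<le> ?n * (\<Sum>b\<in>UNIV. (?D b e \<omega>) ^ 4)"
        using norm_fourth_le[of "?d e \<omega>"] by linarith
    qed (use s in auto)
    finally show ?thesis by simp
  qed
  have "(\<Sum>e\<in>?E. expectation (\<lambda>\<omega>. norm (?d e \<omega>) ^ 3))
      \<le> (\<Sum>e\<in>?E. expectation (\<lambda>\<omega>. s * (\<Sum>b\<in>UNIV. (?D b e \<omega>)\<^sup>2) + ?n / s * (\<Sum>b\<in>UNIV. (?D b e \<omega>) ^ 4)))"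
    by (intro sum_mono integral_mono pt) (auto intro!: intros)
  also have "\<dots> = s * (\<Sum>b\<in>UNIV. expectation (\<lambda>\<omega>. \<Sum>e\<in>?E. (?D b e \<omega>)\<^sup>2)) + ?n / s * (\<Sum>b\<in>UNIV. expectation (\<lambda>\<omega>. \<Sum>e\<in>?E. (?D b e \<omega>) ^ 4))"
  proof -
    have "(\<Sum>e\<in>?E. expectation (\<lambda>\<omega>. s * (\<Sum>b\<in>UNIV. (?D b e \<omega>)\<^sup>2) + ?n / s * (\<Sum>b\<in>UNIV. (?D b e \<omega>) ^ 4)))
        = (\<Sum>e\<in>?E. s * (\<Sum>b\<in>UNIV. expectation (\<lambda>\<omega>. (?D b e \<omega>)\<^sup>2)) + ?n / s * (\<Sum>b\<in>UNIV. expectation (\<lambda>\<omega>. (?D b e \<omega>) ^ 4)))"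
    proof (rule sum.cong[OF refl])
      fix e
      have i: "integrable M (\<lambda>\<omega>. (?D b e \<omega>) ^ p)" for b p by (auto intro!: intros)
      show "expectation (\<lambda>\<omega>. s * (\<Sum>b\<in>UNIV. (?D b e \<omega>)\<^sup>2) + ?n / s * (\<Sum>b\<in>UNIV. (?D b e \<omega>) ^ 4))
          = s * (\<Sum>b\<in>UNIV. expectation (\<lambda>\<omega>. (?D b e \<omega>)\<^sup>2)) + ?n / s * (\<Sum>b\<in>UNIV. expectation (\<lambda>\<omega>. (?D b e \<omega>) ^ 4))"
        by (simp add: i Bochner_Integration.integral_sum)
    qed
    also have "\<dots> = s * (\<Sum>b\<in>UNIV. \<Sum>e\<in>?E. expectation (\<lambda>\<omega>. (?D b e \<omega>)\<^sup>2)) + ?n / s * (\<Sum>b\<in>UNIV. \<Sum>e\<in>?E. expectation (\<lambda>\<omega>. (?D b e \<omega>) ^ 4))"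
    proof -
      have sw: "(\<Sum>e\<in>?E. \<Sum>b\<in>UNIV. expectation (\<lambda>\<omega>. (?D b e \<omega>) ^ p)) = (\<Sum>b\<in>UNIV. \<Sum>e\<in>?E. expectation (\<lambda>\<omega>. (?D b e \<omega>) ^ p))" for p
        by (rule sum.swap)
      show ?thesis by (simp only: sum.distrib sum_distrib_left[symmetric] sw)
    qed
    also have "\<dots> = s * (\<Sum>b\<in>UNIV. expectation (\<lambda>\<omega>. \<Sum>e\<in>?E. (?D b e \<omega>)\<^sup>2)) + ?n / s * (\<Sum>b\<in>UNIV. expectation (\<lambda>\<omega>. \<Sum>e\<in>?E. (?D b e \<omega>) ^ 4))"
    proof -
      have "expectation (\<lambda>\<omega>. \<Sum>e\<in>?E. (?D b e \<omega>) ^ p) = (\<Sum>e\<in>?E. expectation (\<lambda>\<omega>. (?D b e \<omega>) ^ p))" for b p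
        by (intro Bochner_Integration.integral_sum) (auto intro!: intros)
      then show ?thesis by simp
    qed
    finally show ?thesis .
  qed
  also have "\<dots> \<le> s * (\<Sum>b\<in>UNIV. (real (k b))\<^sup>2) + ?n / s * (\<Sum>b\<in>UNIV. fourth_const (k b) / real N)"
  proof (intro add_mono mult_left_mono sum_mono)
    fix b
    show "expectation (\<lambda>\<omega>. \<Sum>e\<in>?E. (?D b e \<omega>) ^ 4) \<le> fourth_const (k b) / real N"
      by (rule expectation_fourth[OF N k])
    have "expectation (\<lambda>\<omega>. \<Sum>e\<in>?E. (?D b e \<omega>)\<^sup>2) = expectation (gamma (k b) (k b) N)"
      by (simp add: gamma_def[abs_def] power2_eq_square)
    also have "\<dots> \<le> real (k b) * real (k b)"
      unfolding expectation_gamma using expectation_cycle_sum_square(1)[OF k N, of b]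
      by (intro mult_left_mono) (auto simp: power2_eq_square)
    finally show "expectation (\<lambda>\<omega>. \<Sum>e\<in>?E. (?D b e \<omega>)\<^sup>2) \<le> (real (k b))\<^sup>2" by (simp add: power2_eq_square)
  qed (use s in auto)
  also have "\<dots> = ((\<Sum>b\<in>UNIV. (real (k b))\<^sup>2) + ?n * (\<Sum>b\<in>UNIV. fourth_const (k b))) / sqrt (real N)"
  proof -
    have "?n / s * (\<Sum>b\<in>UNIV. fourth_const (k b) / real N) = ?n * (\<Sum>b\<in>UNIV. fourth_const (k b)) * (sqrt (real N) / real N)"
      by (simp add: s_def sum_divide_distrib[symmetric])
    also have "sqrt (real N) / real N = 1 / sqrt (real N)" using N by (simp add: real_div_sqrt divide_simps)
    finally show ?thesis by (simp add: s_def add_divide_distrib)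
  qed
  finally show ?thesis .
qed

lemma expectation_abs_le_sqrt:
  assumes "all_moments Y"
  shows "expectation (\<lambda>\<omega>. \<bar>Y \<omega>\<bar>) \<le> sqrt (expectation (\<lambda>\<omega>. (Y \<omega>)\<^sup>2))"
proof (rule real_le_rsqrt)
  have "variance (\<lambda>\<omega>. \<bar>Y \<omega>\<bar>) = expectation (\<lambda>\<omega>. \<bar>Y \<omega>\<bar>\<^sup>2) - (expectation (\<lambda>\<omega>. \<bar>Y \<omega>\<bar>))\<^sup>2"
    by (rule variance_eq) (intro all_moments_integrable all_moments_power all_moments_abs assms)+
  then show "(expectation (\<lambda>\<omega>. \<bar>Y \<omega>\<bar>))\<^sup>2 \<le> expectation (\<lambda>\<omega>. (Y \<omega>)\<^sup>2)"
    using variance_positive[of "\<lambda>\<omega>. \<bar>Y \<omega>\<bar>"] by simp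
qed

lemma expectation_square_shift:
  assumes "all_moments Y"
  shows "expectation (\<lambda>\<omega>. (Y \<omega> - c)\<^sup>2) = variance Y + (expectation Y - c)\<^sup>2"
proof -
  have i: "integrable M Y" "integrable M (\<lambda>\<omega>. (Y \<omega>)\<^sup>2)"
    by (intro all_moments_integrable all_moments_power assms)+
  have "expectation (\<lambda>\<omega>. (Y \<omega> - c)\<^sup>2) = expectation (\<lambda>\<omega>. (Y \<omega>)\<^sup>2 - 2 * c * Y \<omega> + c\<^sup>2)"
    by (simp add: power2_diff algebra_simps)
  also have "\<dots> = expectation (\<lambda>\<omega>. (Y \<omega>)\<^sup>2) - 2 * c * expectation Y + c\<^sup>2"
    using i by (simp add: prob_space)
  finally show ?thesis unfolding variance_eq[OF i] by (simp add: power2_diff)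
qed

lemma gamma_mean_deviation:
  assumes k: "k \<ge> 1" and l: "l \<ge> 1" and N: "N \<ge> 1"
  shows "expectation (\<lambda>\<omega>. \<bar>gamma k l N \<omega> - of_bool (k = l) * (real k)\<^sup>2\<bar>)
    \<le> sqrt (gamma_const k l + (real k * (real k * real ((k - 1) ^ k)))\<^sup>2) / sqrt (real N)"
proof -
  let ?c = "of_bool (k = l) * (real k)\<^sup>2" and ?r = "real k * (real k * real ((k - 1) ^ k))"
  have dev: "\<bar>expectation (gamma k l N) - ?c\<bar> \<le> ?r / real N"
  proof (cases "k = l")
    case True
    let ?t = "expectation (\<lambda>\<omega>. (cycle_sum k N (arr \<omega>))\<^sup>2)"
    have "\<bar>?t - real k\<bar> \<le> real k * real ((k - 1) ^ k) / real N"
      using expectation_cycle_sum_square[OF k N] by linarith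
    then have "real k * \<bar>?t - real k\<bar> \<le> real k * (real k * real ((k - 1) ^ k) / real N)"
      by (intro mult_left_mono) auto
    moreover have "expectation (gamma k l N) - ?c = real k * (?t - real k)"
      using True by (simp add: expectation_gamma power2_eq_square algebra_simps)
    ultimately show ?thesis by (simp add: abs_mult)
  next
    case False
    then show ?thesis using expectation_cycle_sum_mult[OF k N, of l] by (simp add: expectation_gamma)
  qed
  have "expectation (\<lambda>\<omega>. (gamma k l N \<omega> - ?c)\<^sup>2) = variance (gamma k l N) + (expectation (gamma k l N) - ?c)\<^sup>2"
    by (rule expectation_square_shift[OF all_moments_gamma])
  also have "\<dots> \<le> gamma_const k l / real N + ?r\<^sup>2 / real N"
  proof (intro add_mono variance_gamma N k l)
    have "(expectation (gamma k l N) - ?c)\<^sup>2 \<le> (?r / real N)\<^sup>2"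
      using power_mono[OF dev, of 2] by simp
    also have "\<dots> = ?r\<^sup>2 / (real N)\<^sup>2" by (rule power_divide)
    also have "\<dots> \<le> ?r\<^sup>2 / real N"
      using N by (intro divide_left_mono) (auto simp: power2_eq_square)
    finally show "(expectation (gamma k l N) - ?c)\<^sup>2 \<le> ?r\<^sup>2 / real N" .
  qed
  finally have "sqrt (expectation (\<lambda>\<omega>. (gamma k l N \<omega> - ?c)\<^sup>2)) \<le> sqrt ((gamma_const k l + ?r\<^sup>2) / real N)"
    by (simp add: add_divide_distrib)
  moreover have "expectation (\<lambda>\<omega>. \<bar>gamma k l N \<omega> - ?c\<bar>) \<le> sqrt (expectation (\<lambda>\<omega>. (gamma k l N \<omega> - ?c)\<^sup>2))"
    by (intro expectation_abs_le_sqrt all_moments_diff all_moments_gamma all_moments_const)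
  ultimately show ?thesis by (simp add: real_sqrt_divide)
qed

lemma stein_const_nonneg: "stein_const k \<ge> 0"
  unfolding stein_const_def using abs_mom_nonneg gamma_const_nonneg fourth_const_nonneg
  by (intro add_nonneg_nonneg mult_nonneg_nonneg sum_nonneg real_sqrt_ge_zero) auto

text \<open>The expectation \<open>k E[V\<^sub>a g(V)]\<close> is expanded edge by edge with Euler's identity. The result is the
expectation of \<open>F\<close>, in which the derivatives of \<open>g\<close> are weighted by the inner products \<open>gamma\<close>;
these are then replaced by their limits.\<close>

theorem cycle_vec_approx_stein:
  fixes k :: "'m::finite \<Rightarrow> nat"
  assumes k: "\<And>b. k b \<ge> 1" and inj: "inj k" and N: "N \<ge> 1"
  shows "approx_stein M (\<lambda>\<omega>. cycle_vec k N (arr \<omega>)) (stein_const k / sqrt (real N))"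
  unfolding approx_stein_def
proof (intro allI impI)
  fix g :: "real^'m \<Rightarrow> real" and g' L and a :: 'm
  assume g: "C1_with L g g'"
  let ?E = "{..<N} \<times> {..<N}" and ?n = "real CARD('m)" and ?m = "abs_mom 3 + abs_mom 1"
  define V where "V = (\<lambda>\<omega>. cycle_vec k N (arr \<omega>))"
  define d where "d = (\<lambda>e \<omega>. cycle_vec_deriv k N e (arr \<omega>))"
  let ?q = "\<lambda>b. sqrt (real (k a)) * sqrt (real (k b))"
  have L: "L \<ge> 0" by (rule C1_with_nonneg[OF g])
  have amV: "all_moments (\<lambda>\<omega>. V \<omega> $ b)" "all_moments (\<lambda>\<omega>. d e \<omega> $ b)" for b e
    unfolding V_def d_def by (intro all_moments_cycle_vec all_moments_cycle_vec_deriv A_all_moments)+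
  note am = amV all_moments_C1[OF g amV(1)] A_all_moments all_moments_gamma
  note intros = all_moments_integrable all_moments_mult all_moments_sum all_moments_power all_moments_diff
    all_moments_abs all_moments_divide all_moments_const am
  have euler: "real (k a) * (V \<omega> $ a * g (V \<omega>)) = (\<Sum>e\<in>?E. A e \<omega> * d e \<omega> $ a * g (V \<omega>))" for \<omega>
  proof -
    have "real (k a) * V \<omega> $ a = (\<Sum>e\<in>?E. A e \<omega> * d e \<omega> $ a)"
      using cycle_sum_euler[of "arr \<omega>" "k a" N]
      by (simp add: V_def d_def cycle_vec_def cycle_vec_deriv_def flip: sum_divide_distrib)
    then show ?thesis by (simp add: sum_distrib_right mult.assoc[symmetric])
  qed
  have gam: "(\<Sum>e\<in>?E. d e \<omega> $ a * d e \<omega> $ b * g' b (V \<omega>)) = gamma (k a) (k b) N \<omega> / ?q b * g' b (V \<omega>)" for \<omega> b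
    by (simp add: d_def cycle_vec_deriv_def gamma_def sum_distrib_right sum_divide_distrib)
  define F where "F = (\<lambda>\<omega>. \<Sum>b\<in>UNIV. gamma (k a) (k b) N \<omega> / ?q b * g' b (V \<omega>))"
  have EF: "expectation F = (\<Sum>e\<in>?E. expectation (\<lambda>\<omega>. \<Sum>b\<in>UNIV. d e \<omega> $ a * d e \<omega> $ b * g' b (V \<omega>)))"
  proof -
    have "F = (\<lambda>\<omega>. \<Sum>e\<in>?E. \<Sum>b\<in>UNIV. d e \<omega> $ a * d e \<omega> $ b * g' b (V \<omega>))"
    proof
      fix \<omega>
      have "(\<Sum>e\<in>?E. \<Sum>b\<in>UNIV. d e \<omega> $ a * d e \<omega> $ b * g' b (V \<omega>)) = (\<Sum>b\<in>UNIV. \<Sum>e\<in>?E. d e \<omega> $ a * d e \<omega> $ b * g' b (V \<omega>))"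
        by (rule sum.swap)
      then show "F \<omega> = (\<Sum>e\<in>?E. \<Sum>b\<in>UNIV. d e \<omega> $ a * d e \<omega> $ b * g' b (V \<omega>))"
        by (simp only: gam F_def)
    qed
    moreover have "expectation (\<lambda>\<omega>. \<Sum>e\<in>?E. \<Sum>b\<in>UNIV. d e \<omega> $ a * d e \<omega> $ b * g' b (V \<omega>))
      = (\<Sum>e\<in>?E. expectation (\<lambda>\<omega>. \<Sum>b\<in>UNIV. d e \<omega> $ a * d e \<omega> $ b * g' b (V \<omega>)))"
      by (intro Bochner_Integration.integral_sum) (auto intro!: intros)
    ultimately show ?thesis by simp
  qed
  have EV: "real (k a) * expectation (\<lambda>\<omega>. V \<omega> $ a * g (V \<omega>)) = (\<Sum>e\<in>?E. expectation (\<lambda>\<omega>. A e \<omega> * d e \<omega> $ a * g (V \<omega>)))"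
  proof -
    have "real (k a) * expectation (\<lambda>\<omega>. V \<omega> $ a * g (V \<omega>)) = expectation (\<lambda>\<omega>. \<Sum>e\<in>?E. A e \<omega> * d e \<omega> $ a * g (V \<omega>))"
      by (simp flip: euler)
    also have "\<dots> = (\<Sum>e\<in>?E. expectation (\<lambda>\<omega>. A e \<omega> * d e \<omega> $ a * g (V \<omega>)))"
      by (intro Bochner_Integration.integral_sum) (auto intro!: intros)
    finally show ?thesis .
  qed
  define C3 where "C3 = (\<Sum>b\<in>UNIV. (real (k b))\<^sup>2) + ?n * (\<Sum>b\<in>UNIV. fourth_const (k b))"
  have part1: "\<bar>real (k a) * expectation (\<lambda>\<omega>. V \<omega> $ a * g (V \<omega>)) - expectation F\<bar> \<le> L * (?n * (?m * (C3 / sqrt (real N))))"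
  proof -
    have "\<bar>real (k a) * expectation (\<lambda>\<omega>. V \<omega> $ a * g (V \<omega>)) - expectation F\<bar>
       \<le> (\<Sum>e\<in>?E. \<bar>expectation (\<lambda>\<omega>. A e \<omega> * d e \<omega> $ a * g (V \<omega>)) - expectation (\<lambda>\<omega>. \<Sum>b\<in>UNIV. d e \<omega> $ a * d e \<omega> $ b * g' b (V \<omega>))\<bar>)"
      unfolding EF EV sum_subtractf[symmetric] by (rule sum_abs)
    also have "\<dots> \<le> (\<Sum>e\<in>?E. L * ?n * (?m * expectation (\<lambda>\<omega>. norm (d e \<omega>) ^ 3)))"
      unfolding V_def d_def by (intro sum_mono stein_edge g)
    also have "\<dots> = L * ?n * (?m * (\<Sum>e\<in>?E. expectation (\<lambda>\<omega>. norm (d e \<omega>) ^ 3)))"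
      by (simp only: sum_distrib_left)
    also have "\<dots> \<le> L * ?n * (?m * (C3 / sqrt (real N)))"
      unfolding d_def C3_def using L abs_mom_nonneg by (intro mult_left_mono sum_norm_deriv_cube k N) auto
    finally show ?thesis by (simp only: mult.assoc)
  qed
  define C4 where "C4 = (\<lambda>b. sqrt (gamma_const (k a) (k b) + (real (k a) * (real (k a) * real ((k a - 1) ^ k a)))\<^sup>2))"
  have part2: "\<bar>expectation F - real (k a) * expectation (\<lambda>\<omega>. g' a (V \<omega>))\<bar> \<le> L * ((\<Sum>b\<in>UNIV. C4 b) / sqrt (real N))"
  proof -
    define Y where "Y = (\<lambda>b \<omega>. gamma (k a) (k b) N \<omega> - of_bool (k a = k b) * (real (k a))\<^sup>2)"
    have amY: "all_moments (Y b)" for b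
      unfolding Y_def by (intro all_moments_diff all_moments_const all_moments_gamma)
    have kg: "real (k a) * g' a v = (\<Sum>b\<in>UNIV. of_bool (k a = k b) * (real (k a))\<^sup>2 / ?q b * g' b v)" for v
    proof -
      have "(\<Sum>b\<in>UNIV. of_bool (k a = k b) * (real (k a))\<^sup>2 / ?q b * g' b v)
          = (\<Sum>b\<in>{a}. of_bool (k a = k b) * (real (k a))\<^sup>2 / ?q b * g' b v)"
        by (rule sum.mono_neutral_right) (use inj in \<open>auto simp: inj_eq\<close>)
      then show ?thesis using k[of a] by (simp add: power2_eq_square)
    qed
    have FY: "(\<Sum>b\<in>UNIV. Y b \<omega> / ?q b * g' b (V \<omega>)) = F \<omega> - real (k a) * g' a (V \<omega>)" for \<omega>
      unfolding F_def kg sum_subtractf[symmetric]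
      by (simp add: Y_def diff_divide_distrib left_diff_distrib)
    have "all_moments F" unfolding F_def by (auto intro!: intros)
    then have EY: "expectation (\<lambda>\<omega>. \<Sum>b\<in>UNIV. Y b \<omega> / ?q b * g' b (V \<omega>)) = expectation F - real (k a) * expectation (\<lambda>\<omega>. g' a (V \<omega>))"
      using all_moments_integrable[OF am(4)[of a]] unfolding FY by (simp add: all_moments_integrable)
    have "\<bar>expectation F - real (k a) * expectation (\<lambda>\<omega>. g' a (V \<omega>))\<bar> \<le> expectation (\<lambda>\<omega>. \<Sum>b\<in>UNIV. L * \<bar>Y b \<omega>\<bar>)"
      unfolding EY[symmetric]
    proof (rule order.trans[OF integral_abs_bound integral_mono])
      show "integrable M (\<lambda>\<omega>. \<bar>\<Sum>b\<in>UNIV. Y b \<omega> / ?q b * g' b (V \<omega>)\<bar>)"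
        using amY by (auto intro!: intros)
      show "integrable M (\<lambda>\<omega>. \<Sum>b\<in>UNIV. L * \<bar>Y b \<omega>\<bar>)" using amY by (auto intro!: intros)
      fix \<omega>
      show "\<bar>\<Sum>b\<in>UNIV. Y b \<omega> / ?q b * g' b (V \<omega>)\<bar> \<le> (\<Sum>b\<in>UNIV. L * \<bar>Y b \<omega>\<bar>)"
      proof (rule order.trans[OF sum_abs sum_mono])
        fix b
        have "1 * 1 \<le> ?q b" using k[of a] k[of b] by (intro mult_mono) auto
        then have "\<bar>Y b \<omega>\<bar> / ?q b \<le> \<bar>Y b \<omega>\<bar> / 1" by (intro divide_left_mono) auto
        moreover have "\<bar>g' b (V \<omega>)\<bar> \<le> L" using g unfolding C1_with_def by blast
        ultimately have "\<bar>Y b \<omega>\<bar> / ?q b * \<bar>g' b (V \<omega>)\<bar> \<le> \<bar>Y b \<omega>\<bar> * L"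
          by (intro mult_mono) auto
        then show "\<bar>Y b \<omega> / ?q b * g' b (V \<omega>)\<bar> \<le> L * \<bar>Y b \<omega>\<bar>"
          by (simp add: abs_mult mult.commute)
      qed
    qed
    also have "\<dots> = L * (\<Sum>b\<in>UNIV. expectation (\<lambda>\<omega>. \<bar>Y b \<omega>\<bar>))"
      using all_moments_integrable[OF all_moments_abs[OF amY]]
      by (simp add: Bochner_Integration.integral_sum sum_distrib_left)
    also have "\<dots> \<le> L * (\<Sum>b\<in>UNIV. C4 b / sqrt (real N))"
      unfolding Y_def C4_def by (intro mult_left_mono sum_mono gamma_mean_deviation k N L)
    finally show ?thesis by (simp add: sum_divide_distrib)
  qed
  let ?\<Delta> = "expectation (\<lambda>\<omega>. V \<omega> $ a * g (V \<omega>)) - expectation (\<lambda>\<omega>. g' a (V \<omega>))"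
  have "\<bar>?\<Delta>\<bar> \<le> real (k a) * \<bar>?\<Delta>\<bar>" using k[of a] by (simp add: mult_le_cancel_right1)
  also have "\<dots> = \<bar>real (k a) * expectation (\<lambda>\<omega>. V \<omega> $ a * g (V \<omega>)) - real (k a) * expectation (\<lambda>\<omega>. g' a (V \<omega>))\<bar>"
    by (simp add: abs_mult flip: right_diff_distrib)
  also have "\<dots> \<le> L * (?n * (?m * (C3 / sqrt (real N)))) + L * ((\<Sum>b\<in>UNIV. C4 b) / sqrt (real N))"
    using part1 part2 by linarith
  also have "\<dots> = ((?n * (?m * C3) + (\<Sum>b\<in>UNIV. C4 b)) / sqrt (real N)) * L"
    by (simp add: add_divide_distrib algebra_simps)
  also have "\<dots> \<le> stein_const k / sqrt (real N) * L"
  proof (intro mult_right_mono divide_right_mono L)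
    have "(\<Sum>b\<in>UNIV. C4 b) \<le> (\<Sum>a\<in>UNIV. \<Sum>b\<in>UNIV. sqrt (gamma_const (k a) (k b) + (real (k a) * (real (k a) * real ((k a - 1) ^ k a)))\<^sup>2))"
      unfolding C4_def
      by (rule member_le_sum[of a UNIV "\<lambda>a. \<Sum>b\<in>UNIV. sqrt (gamma_const (k a) (k b) + (real (k a) * (real (k a) * real ((k a - 1) ^ k a)))\<^sup>2)"])
        (auto intro!: sum_nonneg add_nonneg_nonneg gamma_const_nonneg)
    then show "?n * (?m * C3) + (\<Sum>b\<in>UNIV. C4 b) \<le> stein_const k"
      unfolding stein_const_def C3_def by linarith
  qed simp
  finally show "\<bar>expectation (\<lambda>\<omega>. cycle_vec k N (arr \<omega>) $ a * g (cycle_vec k N (arr \<omega>))) - expectation (\<lambda>\<omega>. g' a (cycle_vec k N (arr \<omega>)))\<bar>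
     \<le> stein_const k / sqrt (real N) * L"
    unfolding V_def .
qed

end

section \<open>The trace of a power as a sum over closed walks\<close>

text \<open>The contribution of the degenerate closed walks to the trace of the \<open>k\<close>-th power.\<close>

definition degenerate_sum :: "nat \<Rightarrow> nat \<Rightarrow> (nat \<times> nat \<Rightarrow> real) \<Rightarrow> real" where
  "degenerate_sum k N a = (\<Sum>x\<in>degenerate k N. \<Prod>i<k. a (cyc_edge k x i)) / sqrt (real N) ^ k"

lemma sum_of_bool_mult:
  fixes f :: "'b \<Rightarrow> real"
  assumes "finite S" "u \<in> S"
  shows "(\<Sum>w\<in>S. of_bool (u = w) * f w) = f u"
  using assms by (subst sum.remove[of S u]) (auto intro!: sum.neutral)

text \<open>The exponent is \<open>k + 1\<close> so that a walk has a last free vertex \<open>x k\<close>, from which the final edge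
leads to \<open>v\<close>.\<close>

lemma mat_power_entry:
  fixes b :: "nat \<times> nat \<Rightarrow> real"
  assumes "u < N" "v < N"
  shows "(mat N N b ^\<^sub>m Suc k) $$ (u, v) =
    (\<Sum>x\<in>{..<Suc k} \<rightarrow>\<^sub>E {..<N}. of_bool (x 0 = u) * ((\<Prod>i<k. b (x i, x (Suc i))) * b (x k, v)))"
  using assms
proof (induction k arbitrary: v)
  case 0
  have "{..<Suc 0} \<rightarrow>\<^sub>E {..<N} = (\<lambda>w. (\<lambda>_. undefined)(0 := w)) ` {..<N}"
  proof -
    have "{..<Suc 0} = insert 0 ({} :: nat set)" by auto
    then show ?thesis by (simp add: PiE_insert_eq image_image PiE_empty_domain) (auto simp: image_iff)
  qed
  moreover have "inj_on (\<lambda>w. (\<lambda>_. undefined)(0 := w)) {..<N}"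
    by (rule inj_onI) (metis fun_upd_same)
  ultimately have "(\<Sum>x\<in>{..<Suc 0} \<rightarrow>\<^sub>E {..<N}. of_bool (x 0 = u) * ((\<Prod>i<0. b (x i, x (Suc i))) * b (x 0, v)))
    = (\<Sum>w<N. of_bool (u = w) * b (w, v))"
    by (simp only:) (subst sum.reindex, auto intro!: sum.cong)
  also have "\<dots> = b (u, v)" using 0 by (intro sum_of_bool_mult) auto
  finally show ?case using 0 by simp
next
  case (Suc k)
  let ?B = "mat N N b" and ?X = "{..<Suc k} \<rightarrow>\<^sub>E {..<N}"
  have inj: "inj_on (\<lambda>(w, x). x(Suc k := w)) ({..<N} \<times> ?X)"
    using inj_combinator[of "Suc k" "{..<Suc k}" "\<lambda>_. {..<N}"] by simp
  have "(?B ^\<^sub>m Suc (Suc k)) $$ (u, v) = (\<Sum>w<N. (?B ^\<^sub>m Suc k) $$ (u, w) * b (w, v))"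
    using Suc.prems by (simp add: scalar_prod_def lessThan_atLeast0)
  also have "\<dots> = (\<Sum>w<N. \<Sum>x\<in>?X. of_bool (x 0 = u) * ((\<Prod>i<k. b (x i, x (Suc i))) * b (x k, w)) * b (w, v))"
    using Suc by (simp add: sum_distrib_right del: pow_mat.simps)
  also have "\<dots> = (\<Sum>(w, x)\<in>{..<N} \<times> ?X. of_bool (x 0 = u) * ((\<Prod>i<k. b (x i, x (Suc i))) * b (x k, w)) * b (w, v))"
    by (simp add: sum.cartesian_product)
  also have "\<dots> = (\<Sum>(w, x)\<in>{..<N} \<times> ?X. (\<lambda>y. of_bool (y 0 = u) * ((\<Prod>i<Suc k. b (y i, y (Suc i))) * b (y (Suc k), v))) (x(Suc k := w)))"
    by (intro sum.cong refl) (auto simp: mult.assoc)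
  also have "\<dots> = (\<Sum>y\<in>(\<lambda>(w, x). x(Suc k := w)) ` ({..<N} \<times> ?X). of_bool (y 0 = u) * ((\<Prod>i<Suc k. b (y i, y (Suc i))) * b (y (Suc k), v)))"
    by (subst sum.reindex[OF inj]) (simp add: case_prod_beta')
  also have "(\<lambda>(w, x). x(Suc k := w)) ` ({..<N} \<times> ?X) = {..<Suc (Suc k)} \<rightarrow>\<^sub>E {..<N}"
    by (simp add: lessThan_Suc[of "Suc k"] PiE_insert_eq)
  finally show ?case .
qed

lemma trace_power_closed_walks:
  assumes "k \<ge> 1"
  shows "trace_power Y N k \<omega> = cycle_sum k N (\<lambda>(i, j). Y (Suc i) (Suc j) \<omega>) + degenerate_sum k N (\<lambda>(i, j). Y (Suc i) (Suc j) \<omega>)"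
proof -
  obtain l where k: "k = Suc l" using assms by (cases k) auto
  define a where "a = (\<lambda>(i, j). Y (Suc i) (Suc j) \<omega>)"
  let ?b = "\<lambda>e. a e / sqrt (real N)" and ?X = "{..<k} \<rightarrow>\<^sub>E {..<N}"
  have X: "random_mat Y N \<omega> = mat N N ?b"
    by (simp add: random_mat_def a_def case_prod_beta')
  have "trace_power Y N k \<omega> = (\<Sum>u<N. (mat N N ?b ^\<^sub>m k) $$ (u, u))"
    by (simp add: trace_power_def mat_trace_def X)
  also have "\<dots> = (\<Sum>u<N. \<Sum>x\<in>?X. of_bool (x 0 = u) * ((\<Prod>i<l. ?b (x i, x (Suc i))) * ?b (x l, u)))"
    unfolding k by (intro sum.cong refl mat_power_entry) auto
  also have "\<dots> = (\<Sum>x\<in>?X. \<Sum>u<N. of_bool (x 0 = u) * ((\<Prod>i<l. ?b (x i, x (Suc i))) * ?b (x l, u)))"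
    by (rule sum.swap)
  also have "\<dots> = (\<Sum>x\<in>?X. (\<Prod>i<k. a (cyc_edge k x i)) / sqrt (real N) ^ k)"
  proof (rule sum.cong[OF refl])
    fix x assume "x \<in> ?X"
    then have x0: "x 0 < N" using k by (auto simp: PiE_def Pi_def)
    have "(\<Sum>u<N. of_bool (x 0 = u) * ((\<Prod>i<l. ?b (x i, x (Suc i))) * ?b (x l, u))) = (\<Prod>i<l. ?b (x i, x (Suc i))) * ?b (x l, x 0)"
      using x0 by (intro sum_of_bool_mult) auto
    also have "\<dots> = (\<Prod>i<k. ?b (cyc_edge k x i))"
      by (simp add: k cyc_edge_def)
    also have "\<dots> = (\<Prod>i<k. a (cyc_edge k x i)) / sqrt (real N) ^ k"
      by (simp add: prod_dividef)
    finally show "(\<Sum>u<N. of_bool (x 0 = u) * ((\<Prod>i<l. ?b (x i, x (Suc i))) * ?b (x l, u))) = (\<Prod>i<k. a (cyc_edge k x i)) / sqrt (real N) ^ k" .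
  qed
  also have "?X = cycles k N \<union> degenerate k N"
    by (auto simp: cycles_def degenerate_def)
  also have "(\<Sum>x\<in>cycles k N \<union> degenerate k N. (\<Prod>i<k. a (cyc_edge k x i)) / sqrt (real N) ^ k) = cycle_sum k N a + degenerate_sum k N a"
    unfolding cycle_sum_def degenerate_sum_def sum_divide_distrib
    by (rule sum.union_disjoint) (auto simp: cycles_def[of k] degenerate_def[of k] finite_cycles[unfolded cycles_def] finite_degenerate[unfolded degenerate_def])
  finally show ?thesis unfolding a_def .
qed

context iid_array
begin

lemma all_moments_degenerate_sum: "all_moments (\<lambda>\<omega>. degenerate_sum k N (arr \<omega>))"
  unfolding degenerate_sum_def by (intro all_moments_divide all_moments_sum all_moments_prod A_all_moments)

definition degenerate_const :: "nat \<Rightarrow> real" where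
  "degenerate_const k = (mom_bound (2 * k) + (mom_bound k)\<^sup>2) * real ((k - 1) ^ (2 * k))"

lemma degenerate_const_nonneg: "degenerate_const k \<ge> 0"
  unfolding degenerate_const_def using mom_bound_nonneg by (intro mult_nonneg_nonneg add_nonneg_nonneg) auto

lemma variance_degenerate_sum:
  assumes N: "N \<ge> 1" and k: "k \<ge> 1"
  shows "variance (\<lambda>\<omega>. degenerate_sum k N (arr \<omega>)) \<le> degenerate_const k / real N"
proof -
  define S where "S = (\<lambda>\<omega>. \<Sum>x\<in>degenerate k N. monomial {..<k} (cyc_edge k x) \<omega>)"
  let ?K = "mom_bound (2 * k) + (mom_bound k)\<^sup>2"
  have K: "?K \<ge> 0" using mom_bound_nonneg by simp
  have "degenerate_sum k N (arr \<omega>) = S \<omega> / sqrt (real N) ^ k" for \<omega>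
    by (simp add: degenerate_sum_def S_def monomial_def)
  then have "variance (\<lambda>\<omega>. degenerate_sum k N (arr \<omega>)) = variance S / (sqrt (real N) ^ k)\<^sup>2"
    by (simp only: variance_divide)
  also have "(sqrt (real N) ^ k)\<^sup>2 = real N ^ k"
    using sqrt_power_even[of N k] by (simp only: power_mult[symmetric] mult.commute)
  also have "variance S / real N ^ k \<le> degenerate_const k / real N"
  proof (rule power_ratio_le[OF N k])
    have "variance S \<le> ?K * card (linked_degenerate k N)"
      unfolding S_def
    proof (rule variance_monomial_sum)
      show "finite (linked_degenerate k N)" by simp
    qed (auto simp: linked_degenerate_def)
    also have "\<dots> \<le> ?K * real (N ^ (k - 1) * (k - 1) ^ (2 * k))"
      by (intro mult_left_mono K of_nat_mono card_linked_degenerate k)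
    also have "\<dots> = real N ^ (k - 1) * degenerate_const k"
      unfolding degenerate_const_def by (simp only: mult_ac of_nat_mult of_nat_power)
    finally show "variance S \<le> real N ^ (k - 1) * degenerate_const k" .
  qed
  finally show ?thesis .
qed

end

section \<open>Bounded partial derivatives and smooth approximation\<close>

lemma partial_deriv_eq:
  fixes f :: "real^'n \<Rightarrow> real"
  assumes "(f has_derivative f') (at x)"
  shows "partial_deriv b f x = f' (axis b 1)"
proof -
  have "((\<lambda>t. x + t *\<^sub>R axis b 1) has_derivative (\<lambda>t. t *\<^sub>R axis b 1)) (at 0)"
    by (auto intro!: derivative_eq_intros)
  moreover have "(f has_derivative f') (at (x + 0 *\<^sub>R axis b 1))" using assms by simp
  ultimately have "((\<lambda>t. f (x + t *\<^sub>R axis b 1)) has_derivative (\<lambda>t. f' (t *\<^sub>R axis b 1))) (at 0)"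
    by (rule has_derivative_compose)
  moreover have "f' (t *\<^sub>R axis b 1) = f' (axis b 1) * t" for t
    using has_derivative_linear[OF assms] by (simp add: linear_scale mult.commute)
  ultimately have "((\<lambda>t. f (x + t *\<^sub>R axis b 1)) has_real_derivative f' (axis b 1)) (at 0)"
    unfolding has_field_derivative_def by simp
  then show ?thesis unfolding partial_deriv_def by (rule DERIV_imp_deriv)
qed

lemma differentiable_partials:
  fixes f :: "real^'n \<Rightarrow> real"
  assumes "f differentiable (at x)"
  shows "(f has_derivative (\<lambda>h. \<Sum>b\<in>UNIV. partial_deriv b f x * h $ b)) (at x)"
proof -
  obtain f' where f': "(f has_derivative f') (at x)" using assms unfolding differentiable_def by blast
  have "f' h = (\<Sum>b\<in>UNIV. partial_deriv b f x * h $ b)" for h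
  proof -
    have lin: "linear f'" using f' by (rule has_derivative_linear)
    have "h = (\<Sum>b\<in>UNIV. h $ b *\<^sub>R axis b 1)"
      using basis_expansion[of h] by (simp add: scalar_mult_eq_scaleR)
    then have "f' h = f' (\<Sum>b\<in>UNIV. h $ b *\<^sub>R axis b 1)" by simp
    also have "\<dots> = (\<Sum>b\<in>UNIV. h $ b * f' (axis b 1))"
      by (simp add: linear_sum[OF lin] linear_scale[OF lin])
    finally show ?thesis by (simp add: partial_deriv_eq[OF f'] mult.commute)
  qed
  then have "f' = (\<lambda>h. \<Sum>b\<in>UNIV. partial_deriv b f x * h $ b)" by blast
  then show ?thesis using f' by simp
qed

text \<open>The third partial derivatives enter only as Lipschitz constants of the second ones.\<close>

lemma C2_with_of_partials:
  fixes \<phi> :: "real^'n \<Rightarrow> real"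
  assumes d: "times_differentiable 3 \<phi>" and b: "partials_bounded 3 B \<phi>"
  shows "C2_with (B * real CARD('n)) \<phi> (\<lambda>a. partial_deriv a \<phi>) (\<lambda>a b. partial_deriv b (partial_deriv a \<phi>))"
proof -
  let ?n = "real CARD('n)"
  have d: "iter_partial is \<phi> differentiable (at x)" if "length is < 3" for "is" x
    using d that unfolding times_differentiable_def by blast
  have b: "\<bar>iter_partial is \<phi> x\<bar> \<le> B" if "1 \<le> length is" "length is \<le> 3" for "is" x
    using b that unfolding partials_bounded_def by blast
  have b1: "\<bar>partial_deriv a \<phi> x\<bar> \<le> B" for a x using b[of "[a]" x] by (simp add: iter_partial_def)
  then have B: "B \<ge> 0" using abs_ge_zero order.trans by blast
  then have BB: "B \<le> B * ?n" using mult_left_mono[of 1 ?n B] by simp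
  have der: "(\<phi> has_derivative (\<lambda>h. \<Sum>b\<in>UNIV. partial_deriv b \<phi> x * h $ b)) (at x)" for x
    using d[of "[]" x] by (intro differentiable_partials) (simp add: iter_partial_def)
  have der1: "(partial_deriv a \<phi> has_derivative (\<lambda>h. \<Sum>b\<in>UNIV. partial_deriv b (partial_deriv a \<phi>) x * h $ b)) (at x)" for a x
    using d[of "[a]" x] by (intro differentiable_partials) (simp add: iter_partial_def)
  have der2: "(partial_deriv b (partial_deriv a \<phi>) has_derivative
      (\<lambda>h. \<Sum>c\<in>UNIV. partial_deriv c (partial_deriv b (partial_deriv a \<phi>)) x * h $ c)) (at x)" for a b x
    using d[of "[b, a]" x] by (intro differentiable_partials) (simp add: iter_partial_def)
  have b2: "\<bar>partial_deriv c (partial_deriv a \<phi>) x\<bar> \<le> B" for a c x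
    using b[of "[c, a]" x] by (simp add: iter_partial_def)
  have b3: "\<bar>partial_deriv e (partial_deriv c (partial_deriv a \<phi>)) x\<bar> \<le> B" for a c e x
    using b[of "[e, c, a]" x] by (simp add: iter_partial_def)
  show ?thesis
    unfolding C2_with_def C1_with_def
    using der der1 order.trans[OF b1 BB] order.trans[OF b2 BB] lipschitz_partials_norm[OF der2 b3] by blast
qed

text \<open>Functions that are bounded together with \<open>r\<close> rounds of partial derivatives. This class is an algebra that
contains the sines and cosines of the coordinates.\<close>

fun bounded_smooth :: "nat \<Rightarrow> (real^'n \<Rightarrow> real) \<Rightarrow> bool" where
  "bounded_smooth 0 f \<longleftrightarrow> bounded (range f)"
| "bounded_smooth (Suc r) f \<longleftrightarrow> bounded (range f) \<and>
     (\<exists>f'. (\<forall>x. (f has_derivative (\<lambda>h. \<Sum>b\<in>UNIV. f' b x * h $ b)) (at x)) \<and> (\<forall>b. bounded_smooth r (f' b)))"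

lemma bounded_smooth_bounded: "bounded_smooth r f \<Longrightarrow> bounded (range f)"
  by (cases r) auto

lemma bounded_smooth_Suc: "bounded_smooth (Suc r) f \<Longrightarrow> bounded_smooth r f"
proof (induction r arbitrary: f)
  case (Suc r)
  from Suc.prems obtain f' where "\<forall>x. (f has_derivative (\<lambda>h. \<Sum>b\<in>UNIV. f' b x * h $ b)) (at x)"
    "\<forall>b. bounded_smooth (Suc r) (f' b)" and "bounded (range f)"
    unfolding bounded_smooth.simps(2)[of "Suc r"] by blast
  then show ?case using Suc.IH unfolding bounded_smooth.simps(2)[of r] by blast
qed simp

lemma bounded_range_real: "bounded (range (f :: 'b \<Rightarrow> real)) \<longleftrightarrow> (\<exists>B. \<forall>x. \<bar>f x\<bar> \<le> B)"
  by (auto simp: bounded_iff)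

lemma bounded_smooth_const: "bounded_smooth r (\<lambda>_. c)"
proof (induction r arbitrary: c)
  case (Suc r)
  show ?case
    unfolding bounded_smooth.simps using Suc
    by (intro conjI exI[of _ "\<lambda>_ _. 0"]) (auto simp: bounded_range_real)
qed (auto simp: bounded_range_real)

lemma bounded_range_add: "bounded (range f) \<Longrightarrow> bounded (range g) \<Longrightarrow> bounded (range (\<lambda>x. f x + g x :: real))"
  unfolding bounded_range_real
proof (elim exE)
  fix B C assume "\<forall>x. \<bar>f x\<bar> \<le> B" "\<forall>x. \<bar>g x\<bar> \<le> C"
  then have "\<bar>f x + g x\<bar> \<le> B + C" for x by (intro order.trans[OF abs_triangle_ineq] add_mono) auto
  then show "\<exists>D. \<forall>x. \<bar>f x + g x\<bar> \<le> D" by blast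
qed

lemma bounded_range_mult: "bounded (range f) \<Longrightarrow> bounded (range g) \<Longrightarrow> bounded (range (\<lambda>x. f x * g x :: real))"
  unfolding bounded_range_real abs_mult
proof (elim exE)
  fix B C assume "\<forall>x. \<bar>f x\<bar> \<le> B" "\<forall>x. \<bar>g x\<bar> \<le> C"
  then have "\<bar>f x\<bar> * \<bar>g x\<bar> \<le> B * C" for x
    using abs_ge_zero[of "f x"] by (intro mult_mono) (auto intro: order.trans)
  then show "\<exists>D. \<forall>x. \<bar>f x\<bar> * \<bar>g x\<bar> \<le> D" by blast
qed

lemma bounded_smooth_add: "bounded_smooth r f \<Longrightarrow> bounded_smooth r g \<Longrightarrow> bounded_smooth r (\<lambda>x. f x + g x)"
proof (induction r arbitrary: f g)
  case 0
  then show ?case by (simp add: bounded_range_add)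
next
  case (Suc r)
  obtain f' g' where f: "\<And>x. (f has_derivative (\<lambda>h. \<Sum>b\<in>UNIV. f' b x * h $ b)) (at x)" "\<And>b. bounded_smooth r (f' b)"
    and g: "\<And>x. (g has_derivative (\<lambda>h. \<Sum>b\<in>UNIV. g' b x * h $ b)) (at x)" "\<And>b. bounded_smooth r (g' b)"
    using Suc.prems unfolding bounded_smooth.simps by blast
  have "((\<lambda>x. f x + g x) has_derivative (\<lambda>h. \<Sum>b\<in>UNIV. (f' b x + g' b x) * h $ b)) (at x)" for x
    using has_derivative_add[OF f(1) g(1)] by (simp add: sum.distrib distrib_right)
  moreover have "bounded_smooth r (\<lambda>x. f' b x + g' b x)" for b using Suc.IH f g by blast
  ultimately show ?case
    using Suc.prems unfolding bounded_smooth.simps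
    by (intro conjI bounded_range_add exI[of _ "\<lambda>b x. f' b x + g' b x"]) auto
qed

lemma bounded_smooth_mult: "bounded_smooth r f \<Longrightarrow> bounded_smooth r g \<Longrightarrow> bounded_smooth r (\<lambda>x. f x * g x)"
proof (induction r arbitrary: f g)
  case 0
  then show ?case by (simp add: bounded_range_mult)
next
  case (Suc r)
  obtain f' g' where f: "\<And>x. (f has_derivative (\<lambda>h. \<Sum>b\<in>UNIV. f' b x * h $ b)) (at x)" "\<And>b. bounded_smooth r (f' b)"
    and g: "\<And>x. (g has_derivative (\<lambda>h. \<Sum>b\<in>UNIV. g' b x * h $ b)) (at x)" "\<And>b. bounded_smooth r (g' b)"
    using Suc.prems unfolding bounded_smooth.simps by blast
  have "((\<lambda>x. f x * g x) has_derivative (\<lambda>h. \<Sum>b\<in>UNIV. (f x * g' b x + f' b x * g x) * h $ b)) (at x)" for x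
  proof -
    have "(\<lambda>h. f x * (\<Sum>b\<in>UNIV. g' b x * h $ b) + (\<Sum>b\<in>UNIV. f' b x * h $ b) * g x)
        = (\<lambda>h. \<Sum>b\<in>UNIV. (f x * g' b x + f' b x * g x) * h $ b)"
      by (simp add: fun_eq_iff sum_distrib_left sum_distrib_right algebra_simps flip: sum.distrib)
    then show ?thesis using has_derivative_mult[OF f(1) g(1), of x] by simp
  qed
  moreover have "bounded_smooth r (\<lambda>x. f x * g' b x + f' b x * g x)" for b
    by (intro bounded_smooth_add Suc.IH f g bounded_smooth_Suc[OF Suc.prems(1)] bounded_smooth_Suc[OF Suc.prems(2)])
  ultimately show ?case
    using Suc.prems unfolding bounded_smooth.simps
    by (intro conjI bounded_range_mult exI[of _ "\<lambda>b x. f x * g' b x + f' b x * g x"]) auto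
qed

lemma has_derivative_coordinate:
  fixes u :: "real \<Rightarrow> real"
  assumes "\<And>t. (u has_real_derivative u' t) (at t)"
  shows "((\<lambda>x :: real^'n. u (c * x $ i)) has_derivative (\<lambda>h. \<Sum>b\<in>UNIV. (if b = i then c else 0) * u' (c * x $ i) * h $ b)) (at x)"
proof -
  have "((\<lambda>x :: real^'n. c * x $ i) has_derivative (\<lambda>h. c * h $ i)) (at x)"
    by (intro has_derivative_mult_right bounded_linear_imp_has_derivative bounded_linear_vec_nth)
  moreover have "(u has_derivative (\<lambda>t. u' (c * x $ i) * t)) (at (c * x $ i))"
    using assms[of "c * x $ i"] unfolding has_field_derivative_def .
  ultimately have "((\<lambda>x :: real^'n. u (c * x $ i)) has_derivative (\<lambda>h. u' (c * x $ i) * (c * h $ i))) (at x)"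
    by (rule has_derivative_compose)
  also have "(\<lambda>h. u' (c * x $ i) * (c * h $ i)) = (\<lambda>h. \<Sum>b\<in>UNIV. (if b = i then c else 0) * u' (c * x $ i) * h $ b)"
  proof
    fix h :: "real^'n"
    have "(\<Sum>b\<in>UNIV. (if b = i then c else 0) * u' (c * x $ i) * h $ b) = (\<Sum>b\<in>{i}. (if b = i then c else 0) * u' (c * x $ i) * h $ b)"
      by (rule sum.mono_neutral_right) auto
    then show "u' (c * x $ i) * (c * h $ i) = (\<Sum>b\<in>UNIV. (if b = i then c else 0) * u' (c * x $ i) * h $ b)" by simp
  qed
  finally show ?thesis .
qed

lemma bounded_smooth_sin_cos:
  "bounded_smooth r (\<lambda>x :: real^'n. sin (c * x $ i)) \<and> bounded_smooth r (\<lambda>x :: real^'n. cos (c * x $ i))"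
proof (induction r)
  case 0
  show ?case by (auto simp: bounded_range_real intro!: exI[of _ 1])
next
  case (Suc r)
  have s: "bounded_smooth r (\<lambda>x :: real^'n. (if b = i then c else 0) * cos (c * x $ i))"
      "bounded_smooth r (\<lambda>x :: real^'n. (if b = i then c else 0) * - sin (c * x $ i))" for b
    using bounded_smooth_mult[OF bounded_smooth_const[of r "if b = i then c else 0"], of "\<lambda>x. cos (c * x $ i)"]
      bounded_smooth_mult[OF bounded_smooth_const[of r "- (if b = i then c else 0)"], of "\<lambda>x. sin (c * x $ i)"] Suc
    by auto
  show ?case
    unfolding bounded_smooth.simps
  proof (intro conjI)
    show "\<exists>f'. (\<forall>x. ((\<lambda>x :: real^'n. sin (c * x $ i)) has_derivative (\<lambda>h. \<Sum>b\<in>UNIV. f' b x * h $ b)) (at x)) \<and> (\<forall>b. bounded_smooth r (f' b))"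
      by (intro exI[of _ "\<lambda>b x. (if b = i then c else 0) * cos (c * x $ i)"] conjI allI has_derivative_coordinate s DERIV_sin)
    show "\<exists>f'. (\<forall>x. ((\<lambda>x :: real^'n. cos (c * x $ i)) has_derivative (\<lambda>h. \<Sum>b\<in>UNIV. f' b x * h $ b)) (at x)) \<and> (\<forall>b. bounded_smooth r (f' b))"
      by (intro exI[of _ "\<lambda>b x. (if b = i then c else 0) * - sin (c * x $ i)"] conjI allI has_derivative_coordinate s DERIV_cos)
  qed (auto simp: bounded_range_real intro!: exI[of _ 1])
qed

lemma uniform_bound:
  fixes f :: "'n::finite \<Rightarrow> 'b \<Rightarrow> real"
  assumes "\<And>a. bounded (range (f a))"
  shows "\<exists>B. \<forall>a x. \<bar>f a x\<bar> \<le> B"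
proof -
  obtain B where B: "\<And>a x. \<bar>f a x\<bar> \<le> B a" using assms unfolding bounded_range_real by metis
  have "\<bar>f a x\<bar> \<le> (\<Sum>a\<in>UNIV. \<bar>B a\<bar>)" for a x
  proof -
    have "\<bar>B a\<bar> \<le> (\<Sum>a\<in>UNIV. \<bar>B a\<bar>)" by (rule member_le_sum) auto
    then show ?thesis using B[of a x] by linarith
  qed
  then show ?thesis by blast
qed

lemma bounded_smooth_C2:
  fixes f :: "real^'n \<Rightarrow> real"
  assumes "bounded_smooth 3 f"
  shows "\<exists>B f1 f2. C2_with B f f1 f2"
proof -
  have step: "\<exists>g'. (\<forall>x. (g has_derivative (\<lambda>h. \<Sum>b\<in>UNIV. g' b x * h $ b)) (at x)) \<and> (\<forall>b. bounded_smooth r (g' b))"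
    if "bounded_smooth (Suc r) g" for g :: "real^'n \<Rightarrow> real" and r
    using that by simp
  have "bounded_smooth (Suc (Suc (Suc 0))) f" using assms by (simp only: numeral_3_eq_3)
  from step[OF this] obtain f1 where f1: "\<forall>x. (f has_derivative (\<lambda>h. \<Sum>b\<in>UNIV. f1 b x * h $ b)) (at x)"
    "\<forall>b. bounded_smooth (Suc (Suc 0)) (f1 b)"
    by (elim exE conjE)
  note f = f1[rule_format]
  have "\<forall>a. \<exists>f2. (\<forall>x. (f1 a has_derivative (\<lambda>h. \<Sum>b\<in>UNIV. f2 b x * h $ b)) (at x)) \<and> (\<forall>b. bounded_smooth (Suc 0) (f2 b))"
    by (intro allI step f)
  from choice[OF this] obtain f2 where f2': "\<forall>a. (\<forall>x. (f1 a has_derivative (\<lambda>h. \<Sum>b\<in>UNIV. f2 a b x * h $ b)) (at x)) \<and> (\<forall>b. bounded_smooth (Suc 0) (f2 a b))" ..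
  have f2: "(f1 a has_derivative (\<lambda>h. \<Sum>b\<in>UNIV. f2 a b x * h $ b)) (at x)" "bounded_smooth (Suc 0) (f2 a b)" for a b x
    using f2' by simp_all
  have "\<forall>p. \<exists>f3. (\<forall>x. (f2 (fst p) (snd p) has_derivative (\<lambda>h. \<Sum>c\<in>UNIV. f3 c x * h $ c)) (at x)) \<and> (\<forall>c. bounded_smooth 0 (f3 c))"
    by (intro allI step f2)
  from choice[OF this] obtain f3 where f3': "\<forall>p. (\<forall>x. (f2 (fst p) (snd p) has_derivative (\<lambda>h. \<Sum>c\<in>UNIV. f3 p c x * h $ c)) (at x)) \<and> (\<forall>c. bounded_smooth 0 (f3 p c))" ..
  have f3: "(f2 a b has_derivative (\<lambda>h. \<Sum>c\<in>UNIV. f3 (a, b) c x * h $ c)) (at x)" "bounded_smooth 0 (f3 p c)" for a b c p x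
    using f3'[rule_format, of "(a, b)"] f3'[rule_format, of p] by simp_all
  have "\<exists>B. \<forall>a x. \<bar>f1 a x\<bar> \<le> B" by (rule uniform_bound) (rule bounded_smooth_bounded[OF f(2)])
  then obtain B1 where B1: "\<bar>f1 a x\<bar> \<le> B1" for a x by blast
  have "\<exists>B. \<forall>p x. \<bar>f2 (fst p) (snd p) x\<bar> \<le> B"
    by (rule uniform_bound) (rule bounded_smooth_bounded[OF f2(2)])
  then obtain B2 where "\<forall>p x. \<bar>f2 (fst p) (snd p) x\<bar> \<le> B2" ..
  then have B2: "\<bar>f2 a b x\<bar> \<le> B2" for a b x by (metis fst_conv snd_conv)
  have "\<exists>B. \<forall>p x. \<bar>f3 (fst p) (snd p) x\<bar> \<le> B"
    by (rule uniform_bound) (rule bounded_smooth_bounded[OF f3(2)])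
  then obtain B3 where "\<forall>p x. \<bar>f3 (fst p) (snd p) x\<bar> \<le> B3" ..
  then have B3: "\<bar>f3 p c x\<bar> \<le> B3" for p c x by (metis fst_conv snd_conv)
  define B where "B = max B1 (max B2 (B3 * real CARD('n)))"
  have B: "B1 \<le> B" "B2 \<le> B" "B3 * real CARD('n) \<le> B" by (auto simp: B_def)
  have "\<bar>f2 a b x - f2 a b y\<bar> \<le> B * norm (x - y)" for a b x y
    by (rule order.trans[OF lipschitz_partials_norm[OF f3(1) B3] mult_right_mono[OF B(3) norm_ge_zero]])
  then have "C2_with B f f1 f2"
    unfolding C2_with_def C1_with_def
    by (intro conjI allI f(1) f2(1) order.trans[OF B1 B(1)] order.trans[OF B2 B(2)])
  then show ?thesis by blast
qed

text \<open>The substitution \<open>y\<^sub>i = sin (x\<^sub>i / R)\<close> is injective on the box \<open>\<bar>x\<^sub>i\<bar> \<le> R\<close> and maps the whole space into the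
compact cube \<open>S\<close>. The function \<open>f\<close>, transported to the cube by the arcsine, is approximated there by
Stone-Weierstrass, within the ring of functions whose pullback is bounded and smooth. Outside the ball of
radius \<open>R\<close> only the bound \<open>C\<close> is used, absorbed in the quadratic term.\<close>

lemma bounded_smooth_approximation:
  fixes f :: "real^'n \<Rightarrow> real"
  assumes f: "continuous_on UNIV f" and C: "\<And>x. \<bar>f x\<bar> \<le> C" and \<epsilon>: "\<epsilon> > 0" and R: "R > 0"
  shows "\<exists>q. bounded_smooth 3 q \<and> (\<forall>x. \<bar>f x - q x\<bar> \<le> \<epsilon> + 2 * C * (norm x / R)\<^sup>2)"
proof -
  define S where "S = (cbox (\<chi> i. -1) (\<chi> i. 1) :: (real^'n) set)"
  have S: "y \<in> S \<longleftrightarrow> (\<forall>i. -1 \<le> y $ i \<and> y $ i \<le> 1)" for y by (simp add: S_def mem_box_cart)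
  define wrap where "wrap = (\<lambda>x :: real^'n. (\<chi> i. sin (inverse R * x $ i)) :: real^'n)"
  define F where "F = (\<lambda>y :: real^'n. f (\<chi> i. R * arcsin (y $ i)))"
  define A where "A = {p. continuous_on S p \<and> bounded_smooth 3 (\<lambda>x. p (wrap x))}"
  have wS: "wrap x \<in> S" for x by (simp add: S wrap_def)
  interpret function_ring_on A S
  proof
    show "compact S" by (simp add: S_def)
    fix p q assume pq: "p \<in> A" "q \<in> A"
    show "(\<lambda>x. p x + q x) \<in> A" using pq by (auto simp: A_def intro!: continuous_intros bounded_smooth_add)
    show "(\<lambda>x. p x * q x) \<in> A" using pq by (auto simp: A_def intro!: continuous_intros bounded_smooth_mult)
  next
    fix c show "(\<lambda>_. c) \<in> A" by (auto simp: A_def intro!: bounded_smooth_const)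
  next
    fix x y :: "real^'n" assume "x \<noteq> y"
    then obtain i where "x $ i \<noteq> y $ i" by (auto simp: Finite_Cartesian_Product.vec_eq_iff)
    moreover have "(\<lambda>x. x $ i) \<in> A"
      using bounded_smooth_sin_cos[of 3 "inverse R" i] by (auto simp: A_def wrap_def intro!: continuous_intros)
    ultimately show "\<exists>p\<in>A. p x \<noteq> p y" by (intro bexI[of _ "\<lambda>x. x $ i"])
  next
    fix p assume "p \<in> A"
    then show "continuous_on S p" unfolding A_def by (elim CollectE conjE)
  qed
  have "continuous_on S F"
  proof -
    have "continuous_on S (\<lambda>y. y $ i)" for i by (intro continuous_intros)
    then have "continuous_on S (\<lambda>y. arcsin (y $ i))" for i
      by (rule continuous_on_arcsin) (use S in blast)
    then have "continuous_on S (\<lambda>y. (\<chi> i. R * arcsin (y $ i)) :: real^'n)"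
      by (intro continuous_on_vec_lambda continuous_on_mult continuous_on_const)
    then show ?thesis unfolding F_def by (rule continuous_on_compose2[OF f]) simp
  qed
  then obtain p where p: "p \<in> A" "\<And>y. y \<in> S \<Longrightarrow> \<bar>F y - p y\<bar> < \<epsilon>"
    using Stone_Weierstrass_basic[of F \<epsilon>] \<epsilon> by blast
  have "\<bar>f x - p (wrap x)\<bar> \<le> \<epsilon> + 2 * C * (norm x / R)\<^sup>2" for x
  proof -
    have C0: "C \<ge> 0" using C[of 0] by linarith
    have "\<bar>F (wrap x) - p (wrap x)\<bar> < \<epsilon>" using p wS by blast
    moreover have "\<bar>f x - F (wrap x)\<bar> \<le> 2 * C * (norm x / R)\<^sup>2"
    proof (cases "norm x \<le> R")
      case True
      have "R * arcsin (sin (inverse R * x $ i)) = x $ i" for i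
      proof -
        have "\<bar>x $ i\<bar> \<le> R" using True component_le_norm_cart[of x i] by linarith
        then have "\<bar>inverse R * x $ i\<bar> \<le> 1" using R by (simp add: abs_mult field_simps)
        moreover have "1 \<le> pi / 2" using pi_ge_two by simp
        ultimately show ?thesis using R by (subst arcsin_sin) (auto simp: abs_le_iff)
      qed
      then have "F (wrap x) = f x" by (simp add: F_def wrap_def)
      then show ?thesis using C0 by simp
    next
      case False
      have "\<bar>f x - F (wrap x)\<bar> \<le> 2 * C * 1"
        using C[of x] C[of "\<chi> i. R * arcsin (wrap x $ i)"] by (simp add: F_def)
      also have "\<dots> \<le> 2 * C * (norm x / R)\<^sup>2"
        using False R C0 by (intro mult_left_mono) (auto simp: one_le_power)
      finally show ?thesis .
    qed
    ultimately show ?thesis by linarith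
  qed
  then show ?thesis using p(1) by (intro exI[of _ "\<lambda>x. p (wrap x)"]) (auto simp: A_def)
qed

section \<open>Normal approximation of the traces\<close>

lemma expectation_approx:
  fixes U :: "'a \<Rightarrow> real^'n"
  assumes M: "prob_space M" and [measurable]: "U \<in> borel_measurable M"
    and i2: "integrable M (\<lambda>\<omega>. (norm (U \<omega>))\<^sup>2)" and K: "(\<integral>\<omega>. (norm (U \<omega>))\<^sup>2 \<partial>M) \<le> K"
    and f: "f \<in> borel_measurable borel" "\<And>x. \<bar>f x\<bar> \<le> C" and q: "q \<in> borel_measurable borel" "\<And>x. \<bar>q x\<bar> \<le> D"
    and ap: "\<And>x. \<bar>f x - q x\<bar> \<le> \<delta> + c * (norm x)\<^sup>2" and c: "c \<ge> 0"
  shows "\<bar>(\<integral>\<omega>. f (U \<omega>) \<partial>M) - (\<integral>\<omega>. q (U \<omega>) \<partial>M)\<bar> \<le> \<delta> + c * K"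
proof -
  interpret prob_space M by fact
  note [measurable] = f(1) q(1)
  have i: "integrable M (\<lambda>\<omega>. f (U \<omega>))" "integrable M (\<lambda>\<omega>. q (U \<omega>))"
    by (rule integrable_const_bound[of _ C] integrable_const_bound[of _ D]; auto intro: f q)+
  have "\<bar>(\<integral>\<omega>. f (U \<omega>) \<partial>M) - (\<integral>\<omega>. q (U \<omega>) \<partial>M)\<bar> = \<bar>\<integral>\<omega>. f (U \<omega>) - q (U \<omega>) \<partial>M\<bar>"
    using i by simp
  also have "\<dots> \<le> (\<integral>\<omega>. \<delta> + c * (norm (U \<omega>))\<^sup>2 \<partial>M)"
    by (rule order.trans[OF integral_abs_bound integral_mono]) (use i i2 ap in auto)
  also have "\<dots> = \<delta> + c * (\<integral>\<omega>. (norm (U \<omega>))\<^sup>2 \<partial>M)" using i2 by (simp add: prob_space)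
  also have "\<dots> \<le> \<delta> + c * K" using K c by (intro add_left_mono mult_left_mono)
  finally show ?thesis .
qed

text \<open>With bounded second moments, convergence of expectations for smooth test functions suffices.\<close>

theorem weak_convergence_from_C2:
  fixes U :: "nat \<Rightarrow> 'a \<Rightarrow> real^'n" and G :: "'q \<Rightarrow> real^'n" and f :: "real^'n \<Rightarrow> real"
  assumes M: "prob_space M" and Q: "prob_space Q"
    and U: "\<And>n. U n \<in> borel_measurable M" and G: "G \<in> borel_measurable Q"
    and iU: "\<And>n. n \<ge> n0 \<Longrightarrow> integrable M (\<lambda>\<omega>. (norm (U n \<omega>))\<^sup>2)"
    and KU: "\<And>n. n \<ge> n0 \<Longrightarrow> (\<integral>\<omega>. (norm (U n \<omega>))\<^sup>2 \<partial>M) \<le> K"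
    and iG: "integrable Q (\<lambda>\<omega>. (norm (G \<omega>))\<^sup>2)" and KG: "(\<integral>\<omega>. (norm (G \<omega>))\<^sup>2 \<partial>Q) \<le> K"
    and conv: "\<And>B \<phi> \<phi>1 \<phi>2. C2_with B \<phi> \<phi>1 \<phi>2 \<Longrightarrow> (\<lambda>n. \<integral>\<omega>. \<phi> (U n \<omega>) \<partial>M) \<longlonglongrightarrow> (\<integral>\<omega>. \<phi> (G \<omega>) \<partial>Q)"
    and f: "continuous_on UNIV f" and C: "\<And>x. \<bar>f x\<bar> \<le> C"
  shows "(\<lambda>n. \<integral>\<omega>. f (U n \<omega>) \<partial>M) \<longlonglongrightarrow> (\<integral>\<omega>. f (G \<omega>) \<partial>Q)"
proof (rule LIMSEQ_I)
  fix \<epsilon> :: real assume \<epsilon>: "\<epsilon> > 0"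
  have C0: "C \<ge> 0" using C[of 0] by linarith
  have "0 \<le> (\<integral>\<omega>. (norm (G \<omega>))\<^sup>2 \<partial>Q)" by (rule Bochner_Integration.integral_nonneg) simp
  then have K0: "K \<ge> 0" using KG by linarith
  \<comment> \<open>chosen such that the quadratic error term has expectation at most \<open>\<epsilon> / 6\<close>\<close>
  define R where "R = sqrt ((2 * C * K + 1) / (\<epsilon> / 6))"
  have R2: "R\<^sup>2 = (2 * C * K + 1) / (\<epsilon> / 6)" unfolding R_def using C0 K0 \<epsilon> by simp
  have Rpos: "R > 0" unfolding R_def using C0 K0 \<epsilon> by (simp add: add_nonneg_pos)
  define c where "c = 2 * C / R\<^sup>2"
  have c: "c \<ge> 0" "c * K \<le> \<epsilon> / 6"
  proof -
    show "c \<ge> 0" using C0 by (simp add: c_def)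
    have "2 * C * K \<le> (\<epsilon> / 6) * R\<^sup>2" unfolding R2 using \<epsilon> by simp
    then show "c * K \<le> \<epsilon> / 6" using Rpos by (simp add: c_def divide_le_eq)
  qed
  obtain q where q: "bounded_smooth 3 q" "\<And>x. \<bar>f x - q x\<bar> \<le> \<epsilon> / 6 + 2 * C * (norm x / R)\<^sup>2"
    using bounded_smooth_approximation[OF f C _ Rpos, of "\<epsilon> / 6"] \<epsilon> by auto
  have ap: "\<bar>f x - q x\<bar> \<le> \<epsilon> / 6 + c * (norm x)\<^sup>2" for x
    using q(2)[of x] by (simp add: c_def power_divide)
  obtain B q1 q2 where q': "C2_with B q q1 q2" using bounded_smooth_C2[OF q(1)] by blast
  obtain D where D: "\<And>x. \<bar>q x\<bar> \<le> D" using bounded_smooth_bounded[OF q(1)] unfolding bounded_range_real by blast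
  have m: "f \<in> borel_measurable borel" "q \<in> borel_measurable borel"
    using f C2_with_continuous[OF q'] by (auto intro: continuous_imp_measurable)
  obtain n1 where n1: "\<And>n. n \<ge> n1 \<Longrightarrow> \<bar>(\<integral>\<omega>. q (U n \<omega>) \<partial>M) - (\<integral>\<omega>. q (G \<omega>) \<partial>Q)\<bar> < \<epsilon> / 6"
    using LIMSEQ_D[OF conv[OF q'], of "\<epsilon> / 6"] \<epsilon> by auto
  have "\<bar>(\<integral>\<omega>. f (U n \<omega>) \<partial>M) - (\<integral>\<omega>. f (G \<omega>) \<partial>Q)\<bar> < \<epsilon>" if n: "n \<ge> max n0 n1" for n
  proof -
    have nn: "n \<ge> n0" "n \<ge> n1" using n by auto
    have "\<bar>(\<integral>\<omega>. f (U n \<omega>) \<partial>M) - (\<integral>\<omega>. q (U n \<omega>) \<partial>M)\<bar> \<le> \<epsilon> / 6 + c * K"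
      by (rule expectation_approx[OF M U iU[OF nn(1)] KU[OF nn(1)] m(1) C m(2) D ap c(1)])
    moreover have "\<bar>(\<integral>\<omega>. f (G \<omega>) \<partial>Q) - (\<integral>\<omega>. q (G \<omega>) \<partial>Q)\<bar> \<le> \<epsilon> / 6 + c * K"
      by (rule expectation_approx[OF Q G iG KG m(1) C m(2) D ap c(1)])
    ultimately show ?thesis using n1[OF nn(2)] c(2) \<epsilon> by linarith
  qed
  then show "\<exists>n0. \<forall>n\<ge>n0. norm ((\<integral>\<omega>. f (U n \<omega>) \<partial>M) - (\<integral>\<omega>. f (G \<omega>) \<partial>Q)) < \<epsilon>"
    unfolding real_norm_def by blast
qed

context prob_space
begin

lemma C2_with_expectation_diff:
  fixes U V :: "'a \<Rightarrow> real^'n"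
  assumes \<phi>: "C2_with B \<phi> \<phi>1 \<phi>2" and U: "\<And>b. all_moments (\<lambda>\<omega>. U \<omega> $ b)" and V: "\<And>b. all_moments (\<lambda>\<omega>. V \<omega> $ b)"
  shows "\<bar>expectation (\<lambda>\<omega>. \<phi> (U \<omega>)) - expectation (\<lambda>\<omega>. \<phi> (V \<omega>))\<bar> \<le> B * (\<Sum>b\<in>UNIV. expectation (\<lambda>\<omega>. \<bar>U \<omega> $ b - V \<omega> $ b\<bar>))"
proof -
  have d: "\<And>x. (\<phi> has_derivative (\<lambda>h. \<Sum>b\<in>UNIV. \<phi>1 b x * h $ b)) (at x)" and b: "\<And>a x. \<bar>\<phi>1 a x\<bar> \<le> B"
    using \<phi> unfolding C2_with_def by blast+
  have [measurable]: "\<phi> \<in> borel_measurable borel"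
    using C2_with_continuous[OF \<phi>] by (rule continuous_imp_measurable)
  have am: "integrable M (\<lambda>\<omega>. \<phi> (W \<omega>))" if W: "\<And>b. all_moments (\<lambda>\<omega>. W \<omega> $ b)" for W
  proof -
    have "(\<lambda>\<omega>. \<chi> b. W \<omega> $ b) \<in> borel_measurable M"
      by (rule measurable_vec_lambda) (rule all_moments_measurable[OF W])
    then have [measurable]: "W \<in> borel_measurable M" by simp
    show ?thesis
    proof (rule all_moments_integrable, rule all_moments_dominated)
      show "all_moments (\<lambda>\<omega>. \<bar>\<phi> 0\<bar> + B * real CARD('n) * norm (W \<omega>))"
        by (intro all_moments_add all_moments_const all_moments_mult all_moments_vec_nth W)
      show "\<bar>\<phi> (W \<omega>)\<bar> \<le> \<bar>\<phi> 0\<bar> + B * real CARD('n) * norm (W \<omega>)" for \<omega> by (rule C2_with_grow[OF \<phi>])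
    qed measurable
  qed
  have "\<bar>expectation (\<lambda>\<omega>. \<phi> (U \<omega>)) - expectation (\<lambda>\<omega>. \<phi> (V \<omega>))\<bar> = \<bar>expectation (\<lambda>\<omega>. \<phi> (U \<omega>) - \<phi> (V \<omega>))\<bar>"
    using am[OF U] am[OF V] by simp
  also have "\<dots> \<le> expectation (\<lambda>\<omega>. B * (\<Sum>b\<in>UNIV. \<bar>U \<omega> $ b - V \<omega> $ b\<bar>))"
  proof (rule order.trans[OF integral_abs_bound integral_mono])
    show "integrable M (\<lambda>\<omega>. B * (\<Sum>b\<in>UNIV. \<bar>U \<omega> $ b - V \<omega> $ b\<bar>))"
      by (intro integrable_mult_right all_moments_integrable all_moments_sum all_moments_abs all_moments_diff U V)
    show "\<bar>\<phi> (U \<omega>) - \<phi> (V \<omega>)\<bar> \<le> B * (\<Sum>b\<in>UNIV. \<bar>U \<omega> $ b - V \<omega> $ b\<bar>)" for \<omega>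
      using lipschitz_partials[OF d b, of "U \<omega>" "V \<omega>"] by simp
  qed (use am[OF U] am[OF V] in simp)
  also have "\<dots> = B * (\<Sum>b\<in>UNIV. expectation (\<lambda>\<omega>. \<bar>U \<omega> $ b - V \<omega> $ b\<bar>))"
  proof -
    have "expectation (\<lambda>\<omega>. \<Sum>b\<in>UNIV. \<bar>U \<omega> $ b - V \<omega> $ b\<bar>) = (\<Sum>b\<in>UNIV. expectation (\<lambda>\<omega>. \<bar>U \<omega> $ b - V \<omega> $ b\<bar>))"
      by (intro Bochner_Integration.integral_sum all_moments_integrable all_moments_abs all_moments_diff U V)
    then show ?thesis by simp
  qed
  finally show ?thesis .
qed

end

context iid_array
begin

text \<open>The trace of the \<open>k\<close>-th power, as a sum over all closed walks, and its centred version.\<close>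

definition walk_sum :: "nat \<Rightarrow> nat \<Rightarrow> 'a \<Rightarrow> real" where
  "walk_sum k N \<omega> = cycle_sum k N (arr \<omega>) + degenerate_sum k N (arr \<omega>)"

definition centered_walk_sum :: "nat \<Rightarrow> nat \<Rightarrow> 'a \<Rightarrow> real" where
  "centered_walk_sum k N \<omega> = walk_sum k N \<omega> - expectation (walk_sum k N)"

lemma all_moments_cycle: "all_moments (\<lambda>\<omega>. cycle_sum k N (arr \<omega>))"
  by (intro all_moments_cycle_sum A_all_moments)

lemma all_moments_walk_sum: "all_moments (walk_sum k N)"
proof -
  have "all_moments (\<lambda>\<omega>. cycle_sum k N (arr \<omega>) + degenerate_sum k N (arr \<omega>))"
    by (intro all_moments_add all_moments_cycle all_moments_degenerate_sum)
  then show ?thesis by (simp add: walk_sum_def[abs_def])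
qed

lemma all_moments_centered: "all_moments (centered_walk_sum k N)"
proof -
  have "all_moments (\<lambda>\<omega>. walk_sum k N \<omega> - expectation (walk_sum k N))"
    by (intro all_moments_diff all_moments_walk_sum all_moments_const)
  then show ?thesis by (simp add: centered_walk_sum_def[abs_def])
qed

lemma centered_walk_sum_split:
  assumes "k \<ge> 1"
  shows "centered_walk_sum k N \<omega> = cycle_sum k N (arr \<omega>)
    + (degenerate_sum k N (arr \<omega>) - expectation (\<lambda>\<omega>. degenerate_sum k N (arr \<omega>)))"
proof -
  have "expectation (walk_sum k N) = expectation (\<lambda>\<omega>. cycle_sum k N (arr \<omega>)) + expectation (\<lambda>\<omega>. degenerate_sum k N (arr \<omega>))"
    unfolding walk_sum_def[abs_def]
    by (intro Bochner_Integration.integral_add all_moments_integrable all_moments_cycle all_moments_degenerate_sum)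
  then show ?thesis by (simp add: centered_walk_sum_def walk_sum_def expectation_cycle_sum[OF assms])
qed

definition dev_const :: "nat \<Rightarrow> real" where
  "dev_const k = real k * real ((k - 1) ^ k) + real k + 2 * degenerate_const k"

lemma dev_const_nonneg: "dev_const k \<ge> 0"
  unfolding dev_const_def using degenerate_const_nonneg by (intro add_nonneg_nonneg mult_nonneg_nonneg) auto

lemma inverse_le_inverse_sqrt: "N \<ge> 1 \<Longrightarrow> 1 / real N \<le> 1 / sqrt (real N)"
  by (intro divide_left_mono real_le_lsqrt) (auto simp: power2_eq_square)

lemma variance_walk_sum:
  assumes k: "k \<ge> 1" and N: "N \<ge> 1"
  shows "\<bar>variance (walk_sum k N) - real k\<bar> \<le> dev_const k / sqrt (real N)"
proof -
  define T where "T = (\<lambda>\<omega>. cycle_sum k N (arr \<omega>))"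
  define R where "R = (\<lambda>\<omega>. degenerate_sum k N (arr \<omega>) - expectation (\<lambda>\<omega>. degenerate_sum k N (arr \<omega>)))"
  let ?s = "1 / sqrt (real N)"
  have s: "?s > 0" using N by simp
  have am: "all_moments T" "all_moments R"
    unfolding T_def R_def by (intro all_moments_cycle all_moments_diff all_moments_degenerate_sum all_moments_const)+
  have i: "integrable M (\<lambda>\<omega>. (T \<omega>)\<^sup>2)" "integrable M (\<lambda>\<omega>. (R \<omega>)\<^sup>2)" "integrable M (\<lambda>\<omega>. T \<omega> * R \<omega>)"
    by (intro all_moments_integrable all_moments_power all_moments_mult am)+
  have ER: "expectation (\<lambda>\<omega>. (R \<omega>)\<^sup>2) \<le> degenerate_const k / real N"
    unfolding R_def by (rule variance_degenerate_sum[OF N k])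
  \<comment> \<open>the weighted arithmetic-geometric mean inequality replaces Cauchy-Schwarz in \<open>L\<^sup>2\<close>\<close>
  have cross: "\<bar>2 * (x * y)\<bar> \<le> ?s * x\<^sup>2 + y\<^sup>2 / ?s" for x y
  proof -
    define r where "r = sqrt ?s"
    have r: "r > 0" "r\<^sup>2 = ?s" using s by (simp_all add: r_def)
    have "\<bar>2 * (x * y)\<bar> = 2 * (r * \<bar>x\<bar>) * (\<bar>y\<bar> / r)" using r by (simp add: abs_mult)
    also have "\<dots> \<le> (r * \<bar>x\<bar>)\<^sup>2 + (\<bar>y\<bar> / r)\<^sup>2" by (rule sum_squares_bound)
    also have "\<dots> = ?s * x\<^sup>2 + y\<^sup>2 / ?s" by (simp only: power_mult_distrib power_divide r power2_abs)
    finally show ?thesis .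
  qed
  have "\<bar>2 * expectation (\<lambda>\<omega>. T \<omega> * R \<omega>)\<bar> \<le> expectation (\<lambda>\<omega>. \<bar>2 * (T \<omega> * R \<omega>)\<bar>)"
    using integral_abs_bound[of M "\<lambda>\<omega>. 2 * (T \<omega> * R \<omega>)"] by simp
  also have "\<dots> \<le> expectation (\<lambda>\<omega>. ?s * (T \<omega>)\<^sup>2 + (R \<omega>)\<^sup>2 / ?s)"
    by (rule integral_mono[OF _ _ cross]) (use i in \<open>auto intro!: integrable_abs\<close>)
  also have "\<dots> = ?s * expectation (\<lambda>\<omega>. (T \<omega>)\<^sup>2) + expectation (\<lambda>\<omega>. (R \<omega>)\<^sup>2) / ?s"
    using i by simp
  also have "\<dots> \<le> ?s * real k + (degenerate_const k / real N) / ?s"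
    using expectation_cycle_sum_square(1)[OF k N] ER s
    unfolding T_def[symmetric] by (intro add_mono mult_left_mono divide_right_mono) (auto simp: T_def)
  also have "(degenerate_const k / real N) / ?s = degenerate_const k * ?s"
    using N by (simp add: field_simps)
  finally have X: "\<bar>2 * expectation (\<lambda>\<omega>. T \<omega> * R \<omega>)\<bar> \<le> (real k + degenerate_const k) * ?s"
    by (simp add: algebra_simps)
  have "variance (walk_sum k N) = expectation (\<lambda>\<omega>. (T \<omega> + R \<omega>)\<^sup>2)"
    using centered_walk_sum_split[OF k, of N] by (simp add: centered_walk_sum_def T_def R_def)
  also have "\<dots> = expectation (\<lambda>\<omega>. (T \<omega>)\<^sup>2 + 2 * (T \<omega> * R \<omega>) + (R \<omega>)\<^sup>2)"
    by (simp add: power2_sum algebra_simps)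
  also have "\<dots> = expectation (\<lambda>\<omega>. (T \<omega>)\<^sup>2) + 2 * expectation (\<lambda>\<omega>. T \<omega> * R \<omega>) + expectation (\<lambda>\<omega>. (R \<omega>)\<^sup>2)"
    using i by simp
  finally have V: "variance (walk_sum k N) = expectation (\<lambda>\<omega>. (T \<omega>)\<^sup>2) + 2 * expectation (\<lambda>\<omega>. T \<omega> * R \<omega>) + expectation (\<lambda>\<omega>. (R \<omega>)\<^sup>2)" .
  have P: "0 \<le> expectation (\<lambda>\<omega>. (R \<omega>)\<^sup>2)" by simp
  have le: "x / real N \<le> x * ?s" if "x \<ge> 0" for x
    using mult_left_mono[OF inverse_le_inverse_sqrt[OF N] that] by simp
  have 1: "expectation (\<lambda>\<omega>. (R \<omega>)\<^sup>2) \<le> degenerate_const k * ?s"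
    using ER le[OF degenerate_const_nonneg[of k]] by linarith
  have 2: "\<bar>expectation (\<lambda>\<omega>. (T \<omega>)\<^sup>2) - real k\<bar> \<le> (real k * real ((k - 1) ^ k)) * ?s"
    using expectation_cycle_sum_square[OF k N] le[of "real k * real ((k - 1) ^ k)"] unfolding T_def by simp
  have "\<bar>variance (walk_sum k N) - real k\<bar> \<le> (real k * real ((k - 1) ^ k)) * ?s + (real k + degenerate_const k) * ?s + degenerate_const k * ?s"
    using V P 1 2 X by linarith
  also have "\<dots> = dev_const k / sqrt (real N)" by (simp add: dev_const_def algebra_simps add_divide_distrib)
  finally show ?thesis .
qed

lemma centered_close_cycle:
  assumes k: "k \<ge> 1" and N: "N \<ge> 1"
  shows "expectation (\<lambda>\<omega>. \<bar>centered_walk_sum k N \<omega> / sqrt (real k) - cycle_sum k N (arr \<omega>) / sqrt (real k)\<bar>)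
    \<le> sqrt (degenerate_const k) / sqrt (real N)"
proof -
  define R where "R = (\<lambda>\<omega>. degenerate_sum k N (arr \<omega>) - expectation (\<lambda>\<omega>. degenerate_sum k N (arr \<omega>)))"
  have am: "all_moments R"
    unfolding R_def by (intro all_moments_diff all_moments_degenerate_sum all_moments_const)
  have "expectation (\<lambda>\<omega>. \<bar>centered_walk_sum k N \<omega> / sqrt (real k) - cycle_sum k N (arr \<omega>) / sqrt (real k)\<bar>)
      = expectation (\<lambda>\<omega>. \<bar>R \<omega>\<bar>) / sqrt (real k)"
    by (simp add: centered_walk_sum_split[OF k] add_divide_distrib R_def)
  also have "\<dots> \<le> expectation (\<lambda>\<omega>. \<bar>R \<omega>\<bar>) / 1"
    using k by (intro divide_left_mono) (auto intro!: Bochner_Integration.integral_nonneg)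
  also have "\<dots> \<le> sqrt (expectation (\<lambda>\<omega>. (R \<omega>)\<^sup>2))" using expectation_abs_le_sqrt[OF am] by simp
  also have "\<dots> \<le> sqrt (degenerate_const k / real N)"
    unfolding R_def by (intro real_sqrt_le_mono variance_degenerate_sum N k)
  finally show ?thesis by (simp add: real_sqrt_divide)
qed

text \<open>True also for variance zero: then the centred sum vanishes almost surely, and so does
its quotient by zero.\<close>

lemma normalised_close_centered:
  assumes k: "k \<ge> 1" and N: "N \<ge> 1"
  shows "expectation (\<lambda>\<omega>. \<bar>centered_walk_sum k N \<omega> / sqrt (variance (walk_sum k N)) - centered_walk_sum k N \<omega> / sqrt (real k)\<bar>)
    \<le> dev_const k / sqrt (real N)"
proof -
  let ?S = "centered_walk_sum k N" and ?v = "variance (walk_sum k N)"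
  define \<sigma> where "\<sigma> = sqrt ?v"
  have v0: "?v \<ge> 0" by (rule variance_positive)
  then have \<sigma>0: "\<sigma> \<ge> 0" "\<sigma>\<^sup>2 = ?v" by (auto simp: \<sigma>_def)
  have k1: "sqrt (real k) \<ge> 1" using k by simp
  have ES: "expectation (\<lambda>\<omega>. \<bar>?S \<omega>\<bar>) \<le> \<sigma>"
    using expectation_abs_le_sqrt[OF all_moments_centered[of k N]] by (simp add: \<sigma>_def centered_walk_sum_def)
  have ES0: "expectation (\<lambda>\<omega>. \<bar>?S \<omega>\<bar>) \<ge> 0" by (rule Bochner_Integration.integral_nonneg) simp
  let ?c = "\<bar>1 / \<sigma> - 1 / sqrt (real k)\<bar>"
  have "\<bar>?S \<omega> / \<sigma> - ?S \<omega> / sqrt (real k)\<bar> = \<bar>?S \<omega>\<bar> * ?c" for \<omega>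
    by (simp add: right_diff_distrib flip: abs_mult)
  then have "expectation (\<lambda>\<omega>. \<bar>?S \<omega> / \<sigma> - ?S \<omega> / sqrt (real k)\<bar>) = expectation (\<lambda>\<omega>. \<bar>?S \<omega>\<bar>) * ?c"
    by simp
  also have "\<dots> \<le> \<sigma> * ?c" using ES by (intro mult_right_mono) auto
  also have "\<dots> \<le> \<bar>?v - real k\<bar>"
  proof (cases "\<sigma> = 0")
    case False
    then have "\<sigma> * ?c = \<bar>sqrt (real k) - \<sigma>\<bar> / sqrt (real k)"
      using \<sigma>0 k by (simp add: abs_mult[symmetric] field_simps abs_divide[symmetric] abs_of_pos)
    also have "\<dots> \<le> \<bar>sqrt (real k) - \<sigma>\<bar> / 1" using k1 by (intro divide_left_mono) auto
    also have "\<dots> \<le> \<bar>sqrt (real k) - \<sigma>\<bar> * (sqrt (real k) + \<sigma>)"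
    proof -
      have "1 \<le> sqrt (real k) + \<sigma>" using k1 \<sigma>0(1) by linarith
      from mult_left_mono[OF this, of "\<bar>sqrt (real k) - \<sigma>\<bar>"] show ?thesis by simp
    qed
    also have "\<dots> = \<bar>(sqrt (real k) - \<sigma>) * (sqrt (real k) + \<sigma>)\<bar>" using k1 \<sigma>0 by (simp add: abs_mult)
    also have "(sqrt (real k) - \<sigma>) * (sqrt (real k) + \<sigma>) = real k - ?v"
      using \<sigma>0 by (simp add: algebra_simps power2_eq_square[symmetric])
    finally show ?thesis by (simp add: abs_minus_commute)
  qed simp
  also have "\<dots> \<le> dev_const k / sqrt (real N)" by (rule variance_walk_sum[OF k N])
  finally show ?thesis unfolding \<sigma>_def .
qed

definition rate_const :: "('m::finite \<Rightarrow> nat) \<Rightarrow> real" where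
  "rate_const k = (\<Sum>b\<in>UNIV. dev_const (k b) + sqrt (degenerate_const (k b))) + real CARD('m) * stein_const k * (pi / 2)"

lemma rate_const_nonneg: "rate_const k \<ge> 0"
  unfolding rate_const_def using dev_const_nonneg degenerate_const_nonneg stein_const_nonneg
  by (intro add_nonneg_nonneg sum_nonneg mult_nonneg_nonneg) auto

text \<open>The same rate holds with the limiting and with the actual standard deviations as
normalisation.\<close>

theorem normal_approximation:
  fixes k :: "'m::finite \<Rightarrow> nat" and G :: "'q \<Rightarrow> real^'m"
  assumes k: "\<And>b. k b \<ge> 1" and inj: "inj k" and N: "N \<ge> 1"
    and Q: "prob_space Q" and G: "G \<in> borel_measurable Q" "integrable Q (\<lambda>\<omega>. (norm (G \<omega>))\<^sup>2)" "approx_stein Q G 0"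
    and \<phi>: "C2_with B \<phi> \<phi>1 \<phi>2"
  shows "\<bar>expectation (\<lambda>\<omega>. \<phi> (\<chi> b. centered_walk_sum (k b) N \<omega> / sqrt (real (k b)))) - (\<integral>\<omega>. \<phi> (G \<omega>) \<partial>Q)\<bar>
      \<le> B * rate_const k / sqrt (real N)"
    and "\<bar>expectation (\<lambda>\<omega>. \<phi> (\<chi> b. centered_walk_sum (k b) N \<omega> / sqrt (variance (walk_sum (k b) N)))) - (\<integral>\<omega>. \<phi> (G \<omega>) \<partial>Q)\<bar>
      \<le> B * rate_const k / sqrt (real N)"
proof -
  define V where "V = (\<lambda>\<omega>. cycle_vec k N (arr \<omega>))"
  define U where "U = (\<lambda>\<omega>. (\<chi> b. centered_walk_sum (k b) N \<omega> / sqrt (real (k b))) :: real^'m)"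
  define W where "W = (\<lambda>\<omega>. (\<chi> b. centered_walk_sum (k b) N \<omega> / sqrt (variance (walk_sum (k b) N))) :: real^'m)"
  have "C1_with B (\<phi>1 undefined) (\<phi>2 undefined)" using \<phi> unfolding C2_with_def by blast
  then have B: "B \<ge> 0" by (rule C1_with_nonneg)
  have am: "all_moments (\<lambda>\<omega>. V \<omega> $ b)" "all_moments (\<lambda>\<omega>. U \<omega> $ b)" "all_moments (\<lambda>\<omega>. W \<omega> $ b)" for b
    unfolding V_def U_def W_def
    by (auto intro!: all_moments_cycle_vec all_moments_divide all_moments_centered A_all_moments)
  have Vm: "V \<in> borel_measurable M" unfolding V_def by (rule cycle_vec_measurable) measurable
  have V2: "integrable M (\<lambda>\<omega>. (norm (V \<omega>))\<^sup>2)"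
    by (intro all_moments_integrable all_moments_power all_moments_vec_nth am)
  have VG: "\<bar>expectation (\<lambda>\<omega>. \<phi> (V \<omega>)) - (\<integral>\<omega>. \<phi> (G \<omega>) \<partial>Q)\<bar> \<le> real CARD('m) * B * (stein_const k / sqrt (real N) + 0) * (pi / 2)"
    using cycle_vec_approx_stein[OF k inj N]
    by (intro approx_stein_compare[OF prob_space_axioms Q Vm G(1) V2 G(2) _ G(3) \<phi>]) (simp add: V_def)
  have UV: "\<bar>expectation (\<lambda>\<omega>. \<phi> (U \<omega>)) - expectation (\<lambda>\<omega>. \<phi> (V \<omega>))\<bar> \<le> B * ((\<Sum>b\<in>UNIV. sqrt (degenerate_const (k b))) / sqrt (real N))"
  proof (rule order.trans[OF C2_with_expectation_diff[OF \<phi> am(2,1)]])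
    have "(\<Sum>b\<in>UNIV. expectation (\<lambda>\<omega>. \<bar>U \<omega> $ b - V \<omega> $ b\<bar>)) \<le> (\<Sum>b\<in>UNIV. sqrt (degenerate_const (k b)) / sqrt (real N))"
      using centered_close_cycle[OF k N] by (intro sum_mono) (simp add: U_def V_def cycle_vec_def)
    then show "B * (\<Sum>b\<in>UNIV. expectation (\<lambda>\<omega>. \<bar>U \<omega> $ b - V \<omega> $ b\<bar>)) \<le> B * ((\<Sum>b\<in>UNIV. sqrt (degenerate_const (k b))) / sqrt (real N))"
      using B by (intro mult_left_mono) (simp_all add: sum_divide_distrib)
  qed
  have WU: "\<bar>expectation (\<lambda>\<omega>. \<phi> (W \<omega>)) - expectation (\<lambda>\<omega>. \<phi> (U \<omega>))\<bar> \<le> B * ((\<Sum>b\<in>UNIV. dev_const (k b)) / sqrt (real N))"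
  proof (rule order.trans[OF C2_with_expectation_diff[OF \<phi> am(3,2)]])
    have "(\<Sum>b\<in>UNIV. expectation (\<lambda>\<omega>. \<bar>W \<omega> $ b - U \<omega> $ b\<bar>)) \<le> (\<Sum>b\<in>UNIV. dev_const (k b) / sqrt (real N))"
      using normalised_close_centered[OF k N] by (intro sum_mono) (simp add: U_def W_def)
    then show "B * (\<Sum>b\<in>UNIV. expectation (\<lambda>\<omega>. \<bar>W \<omega> $ b - U \<omega> $ b\<bar>)) \<le> B * ((\<Sum>b\<in>UNIV. dev_const (k b)) / sqrt (real N))"
      using B by (intro mult_left_mono) (simp_all add: sum_divide_distrib)
  qed
  have sum: "B * rate_const k / sqrt (real N) = B * ((\<Sum>b\<in>UNIV. dev_const (k b)) / sqrt (real N))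
      + B * ((\<Sum>b\<in>UNIV. sqrt (degenerate_const (k b))) / sqrt (real N))
      + real CARD('m) * B * (stein_const k / sqrt (real N) + 0) * (pi / 2)"
    by (simp add: rate_const_def sum.distrib add_divide_distrib algebra_simps)
  have "0 \<le> B * ((\<Sum>b\<in>UNIV. dev_const (k b)) / sqrt (real N))"
    using B by (intro mult_nonneg_nonneg divide_nonneg_nonneg sum_nonneg dev_const_nonneg) auto
  then have "\<bar>expectation (\<lambda>\<omega>. \<phi> (U \<omega>)) - (\<integral>\<omega>. \<phi> (G \<omega>) \<partial>Q)\<bar> \<le> B * rate_const k / sqrt (real N)"
    unfolding sum using UV VG by linarith
  then show "\<bar>expectation (\<lambda>\<omega>. \<phi> (\<chi> b. centered_walk_sum (k b) N \<omega> / sqrt (real (k b)))) - (\<integral>\<omega>. \<phi> (G \<omega>) \<partial>Q)\<bar>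
      \<le> B * rate_const k / sqrt (real N)" unfolding U_def .
  have "\<bar>expectation (\<lambda>\<omega>. \<phi> (W \<omega>)) - (\<integral>\<omega>. \<phi> (G \<omega>) \<partial>Q)\<bar> \<le> B * rate_const k / sqrt (real N)"
    unfolding sum using UV VG WU by linarith
  then show "\<bar>expectation (\<lambda>\<omega>. \<phi> (\<chi> b. centered_walk_sum (k b) N \<omega> / sqrt (variance (walk_sum (k b) N)))) - (\<integral>\<omega>. \<phi> (G \<omega>) \<partial>Q)\<bar>
      \<le> B * rate_const k / sqrt (real N)" unfolding W_def .
qed

end

section \<open>Gaussian fluctuations of traces\<close>

text \<open>Independence of a family is inherited by an injective reindexing of it.\<close>

lemma (in prob_space) indep_vars_reindex_borel:
  fixes X :: "'i \<Rightarrow> 'a \<Rightarrow> real" and h :: "'j \<Rightarrow> 'i"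
  assumes X: "indep_vars (\<lambda>_. borel) X I" and h: "inj_on h J" "h ` J \<subseteq> I"
  shows "indep_vars (\<lambda>_. borel) (\<lambda>j. X (h j)) J"
proof -
  have "indep_vars (\<lambda>j. Pi\<^sub>M {h j} (\<lambda>_. borel)) (\<lambda>j \<omega>. restrict (\<lambda>i. X i \<omega>) {h j}) J"
    by (rule indep_vars_restrict[OF X]) (use h in \<open>auto simp: disjoint_family_on_def inj_on_def\<close>)
  from indep_vars_compose2[OF this, of "\<lambda>j r. r (h j)" "\<lambda>_. borel"]
  have "indep_vars (\<lambda>_. borel) (\<lambda>j \<omega>. restrict (\<lambda>i. X i \<omega>) {h j} (h j)) J"
    by (simp add: measurable_component_singleton)
  then show ?thesis by simp
qed

lemma inverse_sqrt_le_powr: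
  assumes "N \<ge> 1"
  shows "1 / sqrt (real N) \<le> real N powr (- 1 / 4)"
proof -
  have "1 / sqrt (real N) = real N powr (- (1 / 2))"
    by (simp only: powr_minus powr_half_sqrt[OF of_nat_0_le_iff] inverse_eq_divide)
  also have "\<dots> \<le> real N powr (- 1 / 4)"
    by (rule powr_mono) (use assms in simp_all)
  finally show ?thesis .
qed

theorem theorem1p1:
  fixes P :: "'p measure" and X :: "'p \<Rightarrow> real"
    and M :: "'a measure" and Y :: "nat \<Rightarrow> nat \<Rightarrow> 'a \<Rightarrow> real"
    and Q :: "'q measure" and Z :: "nat \<Rightarrow> 'q \<Rightarrow> real"
    and k :: "'m::{finite,linorder} \<Rightarrow> nat"
  assumes P: "prob_space P" and X: "X \<in> borel_measurable P"
    and X_mean: "prob_space.expectation P X = 0"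
    and X_square: "prob_space.expectation P (\<lambda>\<omega>. (X \<omega>)\<^sup>2) = 1"
    and X_moments: "\<And>n::nat. n \<ge> 3 \<Longrightarrow> integrable P (\<lambda>\<omega>. \<bar>X \<omega>\<bar> ^ n)"
    and M: "prob_space M"
    and Y_indep: "prob_space.indep_vars M (\<lambda>_. borel) (\<lambda>(i, j). Y i j) ({1..} \<times> {1..})"
    and Y_copies: "\<And>i j. i \<ge> 1 \<Longrightarrow> j \<ge> 1 \<Longrightarrow> distr M borel (Y i j) = distr P borel X"
    and k_pos: "\<And>i. k i \<ge> 1" and k_mono: "strict_mono k"
    and Q: "prob_space Q"
    and Z_indep: "prob_space.indep_vars Q (\<lambda>_. borel) Z {1..}"
    and Z_gaussian: "\<And>n. n \<ge> 1 \<Longrightarrow> distributed Q lborel (Z n) (normal_density 0 (sqrt (real n)))"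
  shows "weakly_converges
           (\<lambda>N. distr M borel (\<lambda>\<omega>. \<chi> i. trace_power Y N (k i) \<omega>
                                    - prob_space.expectation M (trace_power Y N (k i))))
           (distr Q borel (\<lambda>\<omega>. \<chi> i. Z (k i) \<omega>))
       \<and> (\<forall>B. \<exists>C. \<forall>\<phi>.
           times_differentiable 3 \<phi> \<and> partials_bounded 3 B \<phi> \<longrightarrow>
           (\<forall>N\<ge>2.
             \<bar>prob_space.expectation M (\<lambda>\<omega>. \<phi> (\<chi> i.
                  (trace_power Y N (k i) \<omega> - prob_space.expectation M (trace_power Y N (k i)))
                    / sqrt (prob_space.variance M (trace_power Y N (k i)))))
              - prob_space.expectation Q (\<lambda>\<omega>. \<phi> (\<chi> i. Z (k i) \<omega> / sqrt (real (k i))))\<bar>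
             \<le> C * real N powr (- 1 / 4)))"
proof -
  interpret P: prob_space P by fact
  interpret M: prob_space M by fact
  interpret Q: prob_space Q by fact
  note X [measurable]
  have X2: "integrable P (\<lambda>\<omega>. (X \<omega>)\<^sup>2)"
    using X_square not_integrable_integral_eq by fastforce
  have X1: "integrable P X"
    by (rule P.square_integrable_imp_integrable[OF X X2])
  define A where "A = (\<lambda>(i, j). Y (Suc i) (Suc j))"
  define D where "D = distr P borel X"
  \<comment> \<open>moments of order below three: order two is finite as the second moment is not zero\<close>
  have Xn: "integrable P (\<lambda>\<omega>. \<bar>X \<omega>\<bar> ^ n)" for n
  proof -
    consider "n = 0" | "n = 1" | "n = 2" | "n \<ge> 3" by linarith
    then show ?thesis using X1 X2 X_moments by cases auto
  qed
  interpret A: iid_array M A D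
  proof
    have "M.indep_vars (\<lambda>_. borel) (\<lambda>e. (\<lambda>(i, j). Y i j) ((\<lambda>(i, j). (Suc i, Suc j)) e)) UNIV"
      by (rule M.indep_vars_reindex_borel[OF Y_indep]) (auto simp: inj_on_def)
    then show "M.indep_vars (\<lambda>_. borel) A UNIV" by (simp add: A_def case_prod_beta')
    show "distr M borel (A e) = D" for e using Y_copies by (cases e) (simp add: A_def D_def)
    show "integrable D (\<lambda>x. \<bar>x\<bar> ^ n)" for n
      unfolding D_def using Xn[of n] by (subst integrable_distr_eq) auto
    show "(\<integral>x. x \<partial>D) = 0" unfolding D_def using X_mean by (subst integral_distr) auto
    show "(\<integral>x. x\<^sup>2 \<partial>D) = 1" unfolding D_def using X_square by (subst integral_distr) auto
  qed
  have trace: "trace_power Y N (k i) = A.walk_sum (k i) N" for N i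
  proof
    fix \<omega>
    have "(\<lambda>(i, j). Y (Suc i) (Suc j) \<omega>) = (\<lambda>e. A e \<omega>)" by (simp add: A_def fun_eq_iff)
    then show "trace_power Y N (k i) \<omega> = A.walk_sum (k i) N \<omega>"
      using trace_power_closed_walks[OF k_pos, of Y N i \<omega>] by (simp add: A.walk_sum_def)
  qed
  have centered: "trace_power Y N (k i) \<omega> - M.expectation (trace_power Y N (k i)) = A.centered_walk_sum (k i) N \<omega>" for N i \<omega>
    by (simp add: trace A.centered_walk_sum_def)
  have inj: "inj k" using k_mono by (rule strict_mono_imp_inj_on)
  have sk: "sqrt (real (k i)) > 0" for i using k_pos[of i] by simp

  define G where "G = (\<lambda>\<omega>. (\<chi> i. Z (k i) \<omega> / sqrt (real (k i))) :: (real, 'm) Finite_Cartesian_Product.vec)"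
  have "Q.indep_vars (\<lambda>_. borel) (\<lambda>i. Z (k i)) UNIV"
    by (rule Q.indep_vars_reindex_borel[OF Z_indep]) (use inj k_pos in auto)
  from Q.indep_vars_compose2[OF this, of "\<lambda>i x. x / sqrt (real (k i))" "\<lambda>_. borel"]
  have G_indep: "Q.indep_vars (\<lambda>_. borel) (\<lambda>i \<omega>. G \<omega> $ i) UNIV" by (simp add: G_def)
  then have G_comp: "(\<lambda>\<omega>. G \<omega> $ i) \<in> borel_measurable Q" for i unfolding Q.indep_vars_def by auto
  have "(\<lambda>\<omega>. \<chi> i. G \<omega> $ i) \<in> borel_measurable Q" by (rule measurable_vec_lambda) (rule G_comp)
  then have Gm: "G \<in> borel_measurable Q" by simp
  have G_normal: "distr Q borel (\<lambda>\<omega>. G \<omega> $ i) = density lborel std_normal_density" for i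
  proof -
    have "distributed Q lborel (\<lambda>\<omega>. (Z (k i) \<omega> - 0) / sqrt (real (k i))) std_normal_density"
      using Z_gaussian[OF k_pos[of i]] Q.normal_standard_normal_convert[OF sk] by simp
    then have "distr Q lborel (\<lambda>\<omega>. G \<omega> $ i) = density lborel std_normal_density"
      by (simp add: distributed_def G_def)
    moreover have "distr Q borel (\<lambda>\<omega>. G \<omega> $ i) = distr Q lborel (\<lambda>\<omega>. G \<omega> $ i)" by (rule distr_cong) auto
    ultimately show ?thesis by simp
  qed
  have G2: "integrable Q (\<lambda>\<omega>. (norm (G \<omega>))\<^sup>2)"
    by (rule std_normal_vector_square_integrable[OF G_comp G_normal])
  have G_stein: "approx_stein Q G 0" by (rule std_normal_vector_stein[OF Q G_indep G_normal])
  note rate = A.normal_approximation[OF k_pos inj _ Q Gm G2 G_stein]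

  define U where "U = (\<lambda>N \<omega>. (\<chi> i. A.centered_walk_sum (k i) N \<omega> / sqrt (real (k i))) :: (real, 'm) Finite_Cartesian_Product.vec)"
  have amU: "M.all_moments (\<lambda>\<omega>. U N \<omega> $ i)" for N i
    unfolding U_def by (simp add: M.all_moments_divide A.all_moments_centered)
  have "(\<lambda>\<omega>. \<chi> i. U N \<omega> $ i) \<in> borel_measurable M" for N
    by (rule measurable_vec_lambda) (rule M.all_moments_measurable[OF amU])
  then have Um: "U N \<in> borel_measurable M" for N by simp
  define K where "K = max (\<Sum>i\<in>UNIV. real (k i) + A.dev_const (k i)) (Q.expectation (\<lambda>\<omega>. (norm (G \<omega>))\<^sup>2))"
  have U2: "integrable M (\<lambda>\<omega>. (norm (U N \<omega>))\<^sup>2)" for N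
    by (intro M.all_moments_integrable M.all_moments_power M.all_moments_vec_nth amU)
  have KU: "M.expectation (\<lambda>\<omega>. (norm (U N \<omega>))\<^sup>2) \<le> K" if N: "N \<ge> 1" for N
  proof -
    have "(norm (U N \<omega>))\<^sup>2 = (\<Sum>i\<in>UNIV. (U N \<omega> $ i)\<^sup>2)" for \<omega>
      by (simp add: norm_vec_def L2_set_def sum_nonneg)
    then have "M.expectation (\<lambda>\<omega>. (norm (U N \<omega>))\<^sup>2) = (\<Sum>i\<in>UNIV. M.expectation (\<lambda>\<omega>. (U N \<omega> $ i)\<^sup>2))"
      by (simp add: Bochner_Integration.integral_sum M.all_moments_integrable M.all_moments_power amU)
    also have "\<dots> \<le> (\<Sum>i\<in>UNIV. real (k i) + A.dev_const (k i))"
    proof (rule sum_mono)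
      fix i
      have "M.expectation (\<lambda>\<omega>. (U N \<omega> $ i)\<^sup>2) = M.variance (A.walk_sum (k i) N) / real (k i)"
        by (simp add: U_def power_divide A.centered_walk_sum_def)
      also have "\<dots> \<le> M.variance (A.walk_sum (k i) N) / 1"
        using k_pos[of i] M.variance_positive by (intro divide_left_mono) auto
      also have "\<dots> \<le> real (k i) + A.dev_const (k i) / sqrt (real N)"
        using A.variance_walk_sum[OF k_pos N, of i] by linarith
      also have "A.dev_const (k i) / sqrt (real N) \<le> A.dev_const (k i) / 1"
        using N A.dev_const_nonneg by (intro divide_left_mono) auto
      finally show "M.expectation (\<lambda>\<omega>. (U N \<omega> $ i)\<^sup>2) \<le> real (k i) + A.dev_const (k i)" by simp
    qed
    finally show ?thesis by (simp add: K_def)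
  qed
  have conv: "(\<lambda>N. M.expectation (\<lambda>\<omega>. \<phi> (U N \<omega>))) \<longlonglongrightarrow> Q.expectation (\<lambda>\<omega>. \<phi> (G \<omega>))"
    if \<phi>: "C2_with B \<phi> \<phi>1 \<phi>2" for B \<phi> \<phi>1 \<phi>2
  proof (rule LIM_zero_cancel, rule Lim_null_comparison)
    show "\<forall>\<^sub>F N in sequentially. norm (M.expectation (\<lambda>\<omega>. \<phi> (U N \<omega>)) - Q.expectation (\<lambda>\<omega>. \<phi> (G \<omega>)))
        \<le> B * A.rate_const k / sqrt (real N)"
      using eventually_ge_at_top[of 1]
    proof eventually_elim
      case (elim N)
      then show ?case using rate(1)[OF elim \<phi>] by (simp add: U_def)
    qed
    have "(\<lambda>N. c / sqrt (real N)) \<longlonglongrightarrow> 0" for c :: real by real_asymp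
    then show "(\<lambda>N. B * A.rate_const k / sqrt (real N)) \<longlonglongrightarrow> 0" .
  qed

  show ?thesis
  proof (intro conjI)
    show "weakly_converges
        (\<lambda>N. distr M borel (\<lambda>\<omega>. \<chi> i. trace_power Y N (k i) \<omega> - M.expectation (trace_power Y N (k i))))
        (distr Q borel (\<lambda>\<omega>. \<chi> i. Z (k i) \<omega>))"
      unfolding weakly_converges_def
    proof (intro allI impI)
      fix f :: "(real, 'm) Finite_Cartesian_Product.vec \<Rightarrow> real" assume f: "continuous_on UNIV f \<and> bounded (range f)"
      \<comment> \<open>undoes the normalisation by \<open>sqrt k\<close>\<close>
      define stretch where "stretch = (\<lambda>x :: (real, 'm) Finite_Cartesian_Product.vec. (\<chi> i. sqrt (real (k i)) * x $ i) :: (real, 'm) Finite_Cartesian_Product.vec)"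
      have cs: "continuous_on UNIV stretch" unfolding stretch_def by (intro continuous_intros)
      have cf: "continuous_on UNIV (\<lambda>x. f (stretch x))"
        using f cs by (intro continuous_on_compose2[of UNIV f UNIV stretch]) auto
      have [measurable]: "stretch \<in> borel_measurable borel" "f \<in> borel_measurable borel"
        using cs f by (auto intro: borel_measurable_continuous_onI)
      obtain C where "\<And>x. \<bar>f x\<bar> \<le> C" using f unfolding bounded_range_real by blast
      then have fC: "\<bar>f (stretch x)\<bar> \<le> C" for x by blast
      have "(\<lambda>N. M.expectation (\<lambda>\<omega>. f (stretch (U N \<omega>)))) \<longlonglongrightarrow> Q.expectation (\<lambda>\<omega>. f (stretch (G \<omega>)))"
        by (rule weak_convergence_from_C2[OF M Q Um Gm U2 KU G2 _ conv cf fC]) (auto simp: K_def)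
      moreover have "(\<chi> i. trace_power Y N (k i) \<omega> - M.expectation (trace_power Y N (k i))) = stretch (U N \<omega>)" for N \<omega>
        using sk by (simp add: centered stretch_def U_def Finite_Cartesian_Product.vec_eq_iff less_imp_neq[symmetric])
      moreover have "(\<chi> i. Z (k i) \<omega>) = stretch (G \<omega>)" for \<omega>
        using sk by (simp add: stretch_def G_def Finite_Cartesian_Product.vec_eq_iff less_imp_neq[symmetric])
      moreover have "integral\<^sup>L (distr M borel (\<lambda>\<omega>. stretch (U N \<omega>))) f = M.expectation (\<lambda>\<omega>. f (stretch (U N \<omega>)))" for N
        using Um[of N] by (intro integral_distr) auto
      moreover have "integral\<^sup>L (distr Q borel (\<lambda>\<omega>. stretch (G \<omega>))) f = Q.expectation (\<lambda>\<omega>. f (stretch (G \<omega>)))"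
        using Gm by (intro integral_distr) auto
      ultimately show "(\<lambda>N. integral\<^sup>L (distr M borel (\<lambda>\<omega>. \<chi> i. trace_power Y N (k i) \<omega> - M.expectation (trace_power Y N (k i)))) f)
          \<longlonglongrightarrow> integral\<^sup>L (distr Q borel (\<lambda>\<omega>. \<chi> i. Z (k i) \<omega>)) f"
        by simp
    qed
  next
    show "\<forall>B. \<exists>C. \<forall>\<phi>. times_differentiable 3 \<phi> \<and> partials_bounded 3 B \<phi> \<longrightarrow>
           (\<forall>N\<ge>2.
             \<bar>M.expectation (\<lambda>\<omega>. \<phi> (\<chi> i.
                  (trace_power Y N (k i) \<omega> - M.expectation (trace_power Y N (k i)))
                    / sqrt (M.variance (trace_power Y N (k i)))))
              - Q.expectation (\<lambda>\<omega>. \<phi> (\<chi> i. Z (k i) \<omega> / sqrt (real (k i))))\<bar>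
             \<le> C * real N powr (- 1 / 4))"
    proof (intro allI exI impI, elim conjE)
      fix B :: real and \<phi> :: "(real, 'm) Finite_Cartesian_Product.vec \<Rightarrow> real" and N :: nat
      assume d: "times_differentiable 3 \<phi>" and b: "partials_bounded 3 B \<phi>" and N: "2 \<le> N"
      let ?B = "B * real CARD('m)"
      note \<phi> = C2_with_of_partials[OF d b]
      have "C1_with ?B (partial_deriv undefined \<phi>) (\<lambda>b. partial_deriv b (partial_deriv undefined \<phi>))"
        using \<phi> unfolding C2_with_def by blast
      then have B: "?B \<ge> 0" by (rule C1_with_nonneg)
      have N1: "N \<ge> 1" using N by simp
      have "\<bar>M.expectation (\<lambda>\<omega>. \<phi> (\<chi> i. A.centered_walk_sum (k i) N \<omega> / sqrt (M.variance (A.walk_sum (k i) N)))) - Q.expectation (\<lambda>\<omega>. \<phi> (G \<omega>))\<bar>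
          \<le> ?B * A.rate_const k / sqrt (real N)"
        by (rule rate(2)[OF N1 \<phi>])
      also have "\<dots> = (?B * A.rate_const k) * (1 / sqrt (real N))" by simp
      also have "\<dots> \<le> (?B * A.rate_const k) * real N powr (- 1 / 4)"
        by (intro mult_left_mono inverse_sqrt_le_powr N1 mult_nonneg_nonneg[OF B A.rate_const_nonneg])
      finally show "\<bar>M.expectation (\<lambda>\<omega>. \<phi> (\<chi> i.
                  (trace_power Y N (k i) \<omega> - M.expectation (trace_power Y N (k i)))
                    / sqrt (M.variance (trace_power Y N (k i)))))
              - Q.expectation (\<lambda>\<omega>. \<phi> (\<chi> i. Z (k i) \<omega> / sqrt (real (k i))))\<bar>
             \<le> (?B * A.rate_const k) * real N powr (- 1 / 4)"
        by (simp add: centered trace G_def A.centered_walk_sum_def)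
    qed
  qed
qed

end
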